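(* Let $G$ be a discrete supersolvable group. An irreducible complex representation of $G$ is monomial if and only if it has finite weight.
   Context: A group $G$ is supersolvable if there is a finite series $1 = N_{k+1} \subseteq N_k \subseteq \cdots \subseteq N_0 = G$ with every $N_i$ normal in $G$ and every quotient $N_i/N_{i+1}$ cyclic (finite or infinite). "Discrete" means that $G$ is regarded as an abstract group with no further topology. Representations are abstract (possibly infinite dimensional, not necessarily unitary) complex representations; irreducible means nonzero with no proper nonzero invariant subspace (algebraically). A character of a group is a one-dimensional complex representation, i.e. a homomorphism to $\mathbb{C}^\times$. Induction is finite (compact) induction: for a representation $(\rho, W)$ of a subgroup $H\le G$, $\mathrm{Ind}_H^G(\rho)$ is the space of functions $f : G \to W$ with $f(hg) = \rho(h) f(g)$ for all $h \in H$, $g \in G$, and with support contained in a finite union of right cosets $Hx$ of $H$ in $G$, on which $G$ acts by right translation $(g\cdot f)(x) = f(xg)$. A representation of $G$ is monomial if it is isomorphic to $\mathrm{Ind}_H^G(\chi)$ for some subgroup $H$ of $G$ and some character $\chi$ of $H$. A representation $(\pi, V)$ of $G$ has finite weight if there exist a subgroup $H$ of $G$ and a character $\chi$ of $H$ such that the space $V_H(\chi) = \{ v \in V \mid \pi(h) v = \chi(h) v \text{ for all } h \in H\}$ is nonzero and finite dimensional. *)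

theory Defs
  imports "HOL-Algebra.Elementary_Groups" "HOL-Library.Function_Algebras" Complex_Main
begin

definition supersolvable_group :: "('g, 'm) monoid_scheme \<Rightarrow> bool" where
  "supersolvable_group G \<longleftrightarrow> group G \<and>
     (\<exists>(k::nat) N. N 0 = carrier G \<and> N (Suc k) = {\<one>\<^bsub>G\<^esub>} \<and>
        (\<forall>i\<le>Suc k. N i \<lhd> G) \<and>
        (\<forall>i\<le>k. N (Suc i) \<subseteq> N i \<and> cyclic_group ((G\<lparr>carrier := N i\<rparr>) Mod N (Suc i))))"

text \<open>
  A representation of \<open>G\<close> lives on a linear subspace \<open>V\<close> of an ambient complex vector space
  (a type with a scalar multiplication); the operators \<open>\<pi> g\<close> are only relevant on \<open>V\<close>.
  No topology is involved and \<open>V\<close> may be infinite dimensional. Invertibility of the \<open>\<pi> g\<close>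
  on \<open>V\<close> follows from \<open>rep_one\<close> and \<open>rep_mult\<close>.
\<close>

locale complex_rep = group G + vector_space scale
  for G :: "('g, 'm) monoid_scheme" (structure)
    and scale :: "complex \<Rightarrow> 'v::ab_group_add \<Rightarrow> 'v" +
  fixes V :: "'v set" and \<pi> :: "'g \<Rightarrow> 'v \<Rightarrow> 'v"
  assumes subspace_V: "subspace V"
    and rep_closed: "\<lbrakk>g \<in> carrier G; v \<in> V\<rbrakk> \<Longrightarrow> \<pi> g v \<in> V"
    and rep_add: "\<lbrakk>g \<in> carrier G; v \<in> V; w \<in> V\<rbrakk> \<Longrightarrow> \<pi> g (v + w) = \<pi> g v + \<pi> g w"
    and rep_scale: "\<lbrakk>g \<in> carrier G; v \<in> V\<rbrakk> \<Longrightarrow> \<pi> g (scale c v) = scale c (\<pi> g v)"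
    and rep_one: "v \<in> V \<Longrightarrow> \<pi> \<one> v = v"
    and rep_mult: "\<lbrakk>g \<in> carrier G; h \<in> carrier G; v \<in> V\<rbrakk> \<Longrightarrow> \<pi> (g \<otimes> h) v = \<pi> g (\<pi> h v)"

definition irreducible_rep ::
  "('g, 'm) monoid_scheme \<Rightarrow> (complex \<Rightarrow> 'v::ab_group_add \<Rightarrow> 'v) \<Rightarrow> 'v set \<Rightarrow> ('g \<Rightarrow> 'v \<Rightarrow> 'v) \<Rightarrow> bool"
where
  "irreducible_rep G scale V \<pi> \<longleftrightarrow> complex_rep G scale V \<pi> \<and> V \<noteq> {0} \<and>
     (\<forall>W. module.subspace scale W \<and> W \<subseteq> V \<and> (\<forall>g\<in>carrier G. \<forall>w\<in>W. \<pi> g w \<in> W)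
        \<longrightarrow> W = {0} \<or> W = V)"

definition rep_isomorphic ::
  "('g, 'm) monoid_scheme
     \<Rightarrow> (complex \<Rightarrow> 'v::ab_group_add \<Rightarrow> 'v) \<Rightarrow> 'v set \<Rightarrow> ('g \<Rightarrow> 'v \<Rightarrow> 'v)
     \<Rightarrow> (complex \<Rightarrow> 'w::ab_group_add \<Rightarrow> 'w) \<Rightarrow> 'w set \<Rightarrow> ('g \<Rightarrow> 'w \<Rightarrow> 'w) \<Rightarrow> bool"
where
  "rep_isomorphic G scale V \<pi> scale' V' \<pi>' \<longleftrightarrow>
     complex_rep G scale V \<pi> \<and> complex_rep G scale' V' \<pi>' \<and>
     (\<exists>T. bij_betw T V V' \<and>
        (\<forall>v\<in>V. \<forall>w\<in>V. T (v + w) = T v + T w) \<and>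
        (\<forall>c. \<forall>v\<in>V. T (scale c v) = scale' c (T v)) \<and>
        (\<forall>g\<in>carrier G. \<forall>v\<in>V. T (\<pi> g v) = \<pi>' g (T v)))"

definition complex_units :: "complex monoid" where
  "complex_units = \<lparr>carrier = UNIV - {0}, mult = (*), one = 1\<rparr>"

definition subgroup_character :: "('g, 'm) monoid_scheme \<Rightarrow> 'g set \<Rightarrow> ('g \<Rightarrow> complex) \<Rightarrow> bool" where
  "subgroup_character G H \<chi> \<longleftrightarrow> subgroup H G \<and> \<chi> \<in> hom (G\<lparr>carrier := H\<rparr>) complex_units"

text \<open>
  Finite induction. Functions on the group are total functions on the type \<open>'g\<close> that vanish
  outside \<open>carrier G\<close>, so that each function on \<open>carrier G\<close> has exactly one representative; they
  form a subspace of \<open>'g \<Rightarrow> 'w\<close> with the pointwise operations. Note that \<open>H #> x\<close> is the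
  right coset \<open>Hx\<close>.
\<close>

definition ind_space ::
  "('g, 'm) monoid_scheme \<Rightarrow> 'g set \<Rightarrow> 'w::ab_group_add set \<Rightarrow> ('g \<Rightarrow> 'w \<Rightarrow> 'w) \<Rightarrow> ('g \<Rightarrow> 'w) set"
where
  "ind_space G H W \<rho> =
     {f. (\<forall>x. x \<notin> carrier G \<longrightarrow> f x = 0) \<and>
         (\<forall>x\<in>carrier G. f x \<in> W) \<and>
         (\<forall>h\<in>H. \<forall>x\<in>carrier G. f (h \<otimes>\<^bsub>G\<^esub> x) = \<rho> h (f x)) \<and>
         (\<exists>F. finite F \<and> F \<subseteq> carrier G \<and> {x \<in> carrier G. f x \<noteq> 0} \<subseteq> (\<Union>x\<in>F. H #>\<^bsub>G\<^esub> x))}"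

definition ind_scale :: "(complex \<Rightarrow> 'w \<Rightarrow> 'w) \<Rightarrow> complex \<Rightarrow> ('g \<Rightarrow> 'w) \<Rightarrow> 'g \<Rightarrow> 'w" where
  "ind_scale scale c f = (\<lambda>x. scale c (f x))"

definition ind_action :: "('g, 'm) monoid_scheme \<Rightarrow> 'g \<Rightarrow> ('g \<Rightarrow> 'w::zero) \<Rightarrow> 'g \<Rightarrow> 'w" where
  "ind_action G g f = (\<lambda>x. if x \<in> carrier G then f (x \<otimes>\<^bsub>G\<^esub> g) else 0)"

lemma complex_rep_ind:
  fixes G :: "('g, 'm) monoid_scheme" and scale :: "complex \<Rightarrow> 'w::ab_group_add \<Rightarrow> 'w"
  assumes "group G" "subgroup H G" "complex_rep (G\<lparr>carrier := H\<rparr>) scale W \<rho>"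
  shows "complex_rep G (ind_scale scale) (ind_space G H W \<rho>) (ind_action G)"
proof -
  interpret G: group G by fact
  interpret H: subgroup H G by fact
  interpret R: complex_rep "G\<lparr>carrier := H\<rparr>" scale W \<rho> by fact
  interpret I: vector_space "ind_scale scale :: complex \<Rightarrow> ('g \<Rightarrow> 'w) \<Rightarrow> 'g \<Rightarrow> 'w"
    by unfold_locales
      (auto simp: ind_scale_def fun_eq_iff R.scale_right_distrib R.scale_left_distrib)
  have HG: "h \<in> carrier G" if "h \<in> H" for h
    using that H.subset by blast
  have rho0: "\<rho> h 0 = 0" if "h \<in> H" for h
    using R.rep_scale[of h 0 0] that R.subspace_V R.subspace_0 by simp
  have supp: "\<exists>F. finite F \<and> F \<subseteq> carrier G \<and> {x \<in> carrier G. f x \<noteq> 0} \<subseteq> (\<Union>x\<in>F. H #>\<^bsub>G\<^esub> x)"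
    if "f \<in> ind_space G H W \<rho>" for f
    using that by (simp add: ind_space_def)
  show ?thesis
  proof unfold_locales
    show "I.subspace (ind_space G H W \<rho>)"
    proof (rule I.subspaceI)
      show "0 \<in> ind_space G H W \<rho>"
        using rho0 R.subspace_0[OF R.subspace_V] by (auto simp: ind_space_def intro!: exI[of _ "{}"])
    next
      fix f f' assume f: "f \<in> ind_space G H W \<rho>" "f' \<in> ind_space G H W \<rho>"
      obtain F where F: "finite F" "F \<subseteq> carrier G"
          "{x \<in> carrier G. f x \<noteq> 0} \<subseteq> (\<Union>x\<in>F. H #>\<^bsub>G\<^esub> x)"
        using supp[OF f(1)] by auto
      obtain F' where F': "finite F'" "F' \<subseteq> carrier G"
          "{x \<in> carrier G. f' x \<noteq> 0} \<subseteq> (\<Union>x\<in>F'. H #>\<^bsub>G\<^esub> x)"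
        using supp[OF f(2)] by auto
      have "{x \<in> carrier G. (f + f') x \<noteq> 0} \<subseteq> {x \<in> carrier G. f x \<noteq> 0} \<union> {x \<in> carrier G. f' x \<noteq> 0}"
        by auto
      also have "\<dots> \<subseteq> (\<Union>x\<in>F \<union> F'. H #>\<^bsub>G\<^esub> x)"
        using F(3) F'(3) by auto
      finally have "\<exists>F. finite F \<and> F \<subseteq> carrier G \<and> {x \<in> carrier G. (f + f') x \<noteq> 0} \<subseteq> (\<Union>x\<in>F. H #>\<^bsub>G\<^esub> x)"
        using F(1,2) F'(1,2) by (intro exI[of _ "F \<union> F'"]) simp
      then show "f + f' \<in> ind_space G H W \<rho>"
        using f R.rep_add R.subspace_add[OF R.subspace_V] by (simp add: ind_space_def)
    next
      fix c f assume f: "f \<in> ind_space G H W \<rho>"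
      have "{x \<in> carrier G. ind_scale scale c f x \<noteq> 0} \<subseteq> {x \<in> carrier G. f x \<noteq> 0}"
        by (auto simp: ind_scale_def)
      moreover obtain F where F: "finite F" "F \<subseteq> carrier G"
          "{x \<in> carrier G. f x \<noteq> 0} \<subseteq> (\<Union>x\<in>F. H #>\<^bsub>G\<^esub> x)"
        using supp[OF f] by auto
      ultimately have "\<exists>F. finite F \<and> F \<subseteq> carrier G \<and> {x \<in> carrier G. ind_scale scale c f x \<noteq> 0} \<subseteq> (\<Union>x\<in>F. H #>\<^bsub>G\<^esub> x)"
        by (intro exI[of _ F]) auto
      then show "ind_scale scale c f \<in> ind_space G H W \<rho>"
        using f R.rep_scale R.subspace_scale[OF R.subspace_V]
        by (simp add: ind_space_def) (simp add: ind_scale_def)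
    qed
  next
    fix g f assume g: "g \<in> carrier G" and f: "f \<in> ind_space G H W \<rho>"
    obtain F where F: "finite F" "F \<subseteq> carrier G"
          "{x \<in> carrier G. f x \<noteq> 0} \<subseteq> (\<Union>x\<in>F. H #>\<^bsub>G\<^esub> x)"
        using supp[OF f] by auto
    have "x \<in> (\<Union>y\<in>(\<lambda>y. y \<otimes>\<^bsub>G\<^esub> inv\<^bsub>G\<^esub> g) ` F. H #>\<^bsub>G\<^esub> y)"
      if x: "x \<in> carrier G" "f (x \<otimes>\<^bsub>G\<^esub> g) \<noteq> 0" for x
    proof -
      have "x \<otimes>\<^bsub>G\<^esub> g \<in> (\<Union>y\<in>F. H #>\<^bsub>G\<^esub> y)"
        using F(3) x g by auto
      then obtain y h where y: "y \<in> F" "h \<in> H" "x \<otimes>\<^bsub>G\<^esub> g = h \<otimes>\<^bsub>G\<^esub> y"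
        by (auto simp: r_coset_def)
      then have yc: "y \<in> carrier G" using F(2) by blast
      have "x = x \<otimes>\<^bsub>G\<^esub> g \<otimes>\<^bsub>G\<^esub> inv\<^bsub>G\<^esub> g"
        using x g by (simp add: G.m_assoc)
      also have "\<dots> = h \<otimes>\<^bsub>G\<^esub> (y \<otimes>\<^bsub>G\<^esub> inv\<^bsub>G\<^esub> g)"
        using y yc g HG by (simp add: G.m_assoc)
      finally show ?thesis using y by (auto simp: r_coset_def)
    qed
    then have "\<exists>F. finite F \<and> F \<subseteq> carrier G \<and>
          {x \<in> carrier G. f (x \<otimes>\<^bsub>G\<^esub> g) \<noteq> 0} \<subseteq> (\<Union>x\<in>F. H #>\<^bsub>G\<^esub> x)"
      using F g by (intro exI[of _ "(\<lambda>y. y \<otimes>\<^bsub>G\<^esub> inv\<^bsub>G\<^esub> g) ` F"]) auto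
    moreover have "{x \<in> carrier G. ind_action G g f x \<noteq> 0} = {x \<in> carrier G. f (x \<otimes>\<^bsub>G\<^esub> g) \<noteq> 0}"
      by (auto simp: ind_action_def)
    ultimately have "\<exists>F. finite F \<and> F \<subseteq> carrier G \<and>
          {x \<in> carrier G. ind_action G g f x \<noteq> 0} \<subseteq> (\<Union>x\<in>F. H #>\<^bsub>G\<^esub> x)"
      by simp
    then show "ind_action G g f \<in> ind_space G H W \<rho>"
      using f g HG by (simp add: ind_space_def) (simp add: ind_action_def G.m_assoc)
  next
    fix f assume "f \<in> ind_space G H W \<rho>"
    then show "ind_action G \<one>\<^bsub>G\<^esub> f = f"
      by (auto simp: ind_action_def ind_space_def)
  next
    fix g f f' assume "g \<in> carrier G" "f \<in> ind_space G H W \<rho>" "f' \<in> ind_space G H W \<rho>"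
    show "ind_action G g (f + f') = ind_action G g f + ind_action G g f'"
      by (simp add: ind_action_def fun_eq_iff)
  next
    fix g f c assume "g \<in> carrier G" "f \<in> ind_space G H W \<rho>"
    show "ind_action G g (ind_scale scale c f) = ind_scale scale c (ind_action G g f)"
      by (simp add: ind_action_def ind_scale_def fun_eq_iff)
  next
    fix g h f assume "g \<in> carrier G" "h \<in> carrier G" "f \<in> ind_space G H W \<rho>"
    then show "ind_action G (g \<otimes>\<^bsub>G\<^esub> h) f = ind_action G g (ind_action G h f)"
      by (simp add: ind_action_def fun_eq_iff G.m_assoc)
  qed
qed

text \<open>
  A character \<open>\<chi>\<close> of \<open>H\<close> is regarded as the representation on \<open>\<complex>\<close> in which \<open>h\<close> acts as
  multiplication by \<open>\<chi> h\<close>.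
\<close>

lemma complex_rep_character:
  fixes G :: "('g, 'm) monoid_scheme"
  assumes "group G" "subgroup_character G H \<chi>"
  shows "complex_rep (G\<lparr>carrier := H\<rparr>) (*) UNIV (\<lambda>h. (*) (\<chi> h))"
proof -
  interpret G: group G by fact
  have H: "subgroup H G" and hom: "\<chi> \<in> hom (G\<lparr>carrier := H\<rparr>) complex_units"
    using assms by (auto simp: subgroup_character_def)
  interpret H: group "G\<lparr>carrier := H\<rparr>"
    using H by (rule G.subgroup_imp_group)
  interpret C: vector_space "(*) :: complex \<Rightarrow> complex \<Rightarrow> complex"
    by unfold_locales (auto simp: algebra_simps)
  have mult: "\<chi> (g \<otimes>\<^bsub>G\<^esub> h) = \<chi> g * \<chi> h" if "g \<in> H" "h \<in> H" for g h
    using hom that by (auto simp: hom_def complex_units_def)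
  have one: "\<one>\<^bsub>G\<^esub> \<in> H" using H by (rule subgroup.one_closed)
  have "\<chi> \<one>\<^bsub>G\<^esub> \<noteq> 0" using hom one by (auto simp: hom_def complex_units_def)
  then have "\<chi> \<one>\<^bsub>G\<^esub> = 1" using mult[OF one one] one H by simp
  then show ?thesis
    by unfold_locales (simp_all add: mult C.subspace_UNIV distrib_left)
qed

definition monomial_rep ::
  "('g, 'm) monoid_scheme \<Rightarrow> (complex \<Rightarrow> 'v::ab_group_add \<Rightarrow> 'v) \<Rightarrow> 'v set \<Rightarrow> ('g \<Rightarrow> 'v \<Rightarrow> 'v) \<Rightarrow> bool"
where
  "monomial_rep G scale V \<pi> \<longleftrightarrow>
     (\<exists>H \<chi>. subgroup_character G H \<chi> \<and>
        rep_isomorphic G scale V \<pi>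
          (ind_scale (*)) (ind_space G H UNIV (\<lambda>h. (*) (\<chi> h))) (ind_action G))"

definition weight_space ::
  "(complex \<Rightarrow> 'v \<Rightarrow> 'v) \<Rightarrow> 'v set \<Rightarrow> ('g \<Rightarrow> 'v \<Rightarrow> 'v) \<Rightarrow> 'g set \<Rightarrow> ('g \<Rightarrow> complex) \<Rightarrow> 'v set"
where
  "weight_space scale V \<pi> H \<chi> = {v \<in> V. \<forall>h\<in>H. \<pi> h v = scale (\<chi> h) v}"

definition finite_weight_rep ::
  "('g, 'm) monoid_scheme \<Rightarrow> (complex \<Rightarrow> 'v::ab_group_add \<Rightarrow> 'v) \<Rightarrow> 'v set \<Rightarrow> ('g \<Rightarrow> 'v \<Rightarrow> 'v) \<Rightarrow> bool"
where
  "finite_weight_rep G scale V \<pi> \<longleftrightarrow>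
     (\<exists>H \<chi>. subgroup_character G H \<chi> \<and>
        weight_space scale V \<pi> H \<chi> \<noteq> {0} \<and>
        (\<exists>B. finite B \<and> weight_space scale V \<pi> H \<chi> = module.span scale B))"

end

theory Submission
  imports Defs "HOL-Computational_Algebra.Fundamental_Theorem_Algebra" "HOL-Algebra.Zassenhaus"
    "HOL-Analysis.Continuum_Not_Denumerable"
begin

text \<open>
  Choose a vector \<open>u\<close> for which the group of all \<open>g\<close> having \<open>u\<close> as an eigenvector has maximal Hirsch
  length, and let \<open>cls u\<close> consist of the vectors on which a subgroup of finite index of that group
  acts by the same character. Maximality makes the translates of \<open>cls u\<close> pairwise equal or disjoint,
  and climbing the normal series shows that they are independent, so an irreducible \<open>V\<close> is induced
  from the stabilizer of \<open>cls u\<close>. A finite weight of \<open>V\<close> gives one of \<open>cls u\<close>, where the group \<open>H\<close>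
  of the weight commutes with each element of the stabilizer up to finite index. Under this condition
  the first \<open>x\<close> in the series that does not act by a scalar has only finitely many conjugates under
  \<open>H\<close>, so finite dimensionality produces an eigenvector of \<open>x\<close>, and the eigenspaces of \<open>x\<close> are a
  system of imprimitivity. Repeating this ends with a group acting by scalars, that is, with a line.

  Conversely, by Frobenius reciprocity the weight space of \<open>Ind \<chi>\<close> for \<open>(H, \<chi>)\<close> is its endomorphism
  algebra, which is \<open>\<complex>\<close> by Schur's lemma in the form of Dixmier, as \<open>G\<close> is countable.
\<close>

text \<open>Agreement of characters up to finite index is not symmetric in general, since the second
  vector may be an eigenvector of a much larger group. Hirsch length repairs this: when
  \<open>P\<close> is virtually contained in \<open>Q\<close> and no shorter, \<open>Q\<close> is
  also virtually contained in \<open>P\<close>. A class is a place where the commutators with the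
  group of a weight are virtually trivial on each vector, and this bounds the number of those
  operators. The cyclic factors enter twice: each has a finite automorphism group, so a subgroup of
  finite index centralizes all of them, and its part in the stabilizer of a line, multiplied by the
  terms \<open>N i\<close>, gives a subnormal chain up to \<open>G\<close> along which independence
  climbs. For Schur's lemma there is neither an inner product nor finite dimension; what replaces
  them is that \<complex> is uncountable whereas an irreducible representation of a countable group
  has countable dimension.\<close>

section \<open>Virtual containment and Hirsch length\<close>

text \<open>For subgroups this says that \<open>P \<inter> D\<close> has finite index in \<open>P\<close>.\<close>

definition covered :: "('g, 'm) monoid_scheme \<Rightarrow> 'g set \<Rightarrow> 'g set \<Rightarrow> bool" where
  "covered G P D \<longleftrightarrow> (\<exists>F. finite F \<and> F \<subseteq> carrier G \<and> P \<subseteq> (\<Union>x\<in>F. D #>\<^bsub>G\<^esub> x))"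

context group
begin

definition cj :: "'a \<Rightarrow> 'a set \<Rightarrow> 'a set" where
  "cj g P = (\<lambda>x. g \<otimes> x \<otimes> inv g) ` P"

lemma covered_subset:
  assumes "P \<subseteq> D" "P \<subseteq> carrier G"
  shows "covered G P D"
  unfolding covered_def
proof (intro exI conjI)
  show "P \<subseteq> (\<Union>x\<in>{\<one>}. D #> x)"
    using assms by (force simp: r_coset_def)
qed auto

lemma covered_mono:
  assumes "covered G P D" "P' \<subseteq> P" "D \<subseteq> D'"
  shows "covered G P' D'"
proof -
  obtain F where F: "finite F" "F \<subseteq> carrier G" "P \<subseteq> (\<Union>x\<in>F. D #> x)"
    using assms(1) by (auto simp: covered_def)
  have "(\<Union>x\<in>F. D #> x) \<subseteq> (\<Union>x\<in>F. D' #> x)"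
    using assms(3) by (auto simp: r_coset_def)
  then show ?thesis
    unfolding covered_def using F assms(2) by (intro exI[of _ F]) auto
qed

lemma covered_trans:
  assumes PD: "covered G P D" and DE: "covered G D E" and E: "E \<subseteq> carrier G"
  shows "covered G P E"
proof -
  obtain F where F: "finite F" "F \<subseteq> carrier G" "P \<subseteq> (\<Union>x\<in>F. D #> x)"
    using PD by (auto simp: covered_def)
  obtain F' where F': "finite F'" "F' \<subseteq> carrier G" "D \<subseteq> (\<Union>x\<in>F'. E #> x)"
    using DE by (auto simp: covered_def)
  have "P \<subseteq> (\<Union>x\<in>(\<lambda>(a,b). a \<otimes> b) ` (F' \<times> F). E #> x)"
  proof
    fix p assume "p \<in> P"
    then obtain f d where f: "f \<in> F" "d \<in> D" "p = d \<otimes> f"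
      using F(3) by (auto simp: r_coset_def)
    obtain f' e where f': "f' \<in> F'" "e \<in> E" "d = e \<otimes> f'"
      using F'(3) f(2) by (auto simp: r_coset_def)
    have "p = e \<otimes> (f' \<otimes> f)"
      using f f' F(2) F'(2) E by (simp add: m_assoc subset_iff)
    then show "p \<in> (\<Union>x\<in>(\<lambda>(a,b). a \<otimes> b) ` (F' \<times> F). E #> x)"
      using f f' by (force simp: r_coset_def)
  qed
  then show ?thesis
    unfolding covered_def
    using F F' by (intro exI[of _ "(\<lambda>(a,b). a \<otimes> b) ` (F' \<times> F)"]) auto
qed

text \<open>A right coset of \<open>D\<close> and one of \<open>E\<close> with a common point
  \<open>z\<close> intersect in the right coset of \<open>D \<inter> E\<close> through
  \<open>z\<close>. The function \<open>z\<close> selects such a point for each of the finitely many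
  intersecting pairs.\<close>

lemma covered_Int:
  assumes D: "subgroup D G" and E: "subgroup E G"
    and PD: "covered G P D" and PE: "covered G P E"
  shows "covered G P (D \<inter> E)"
proof -
  obtain F where F: "finite F" "F \<subseteq> carrier G" "P \<subseteq> (\<Union>x\<in>F. D #> x)"
    using PD by (auto simp: covered_def)
  obtain F' where F': "finite F'" "F' \<subseteq> carrier G" "P \<subseteq> (\<Union>x\<in>F'. E #> x)"
    using PE by (auto simp: covered_def)
  define z where "z = (\<lambda>(a,b). SOME z. z \<in> (D #> a) \<inter> (E #> b))"
  define Z where "Z = {ab \<in> F \<times> F'. (D #> fst ab) \<inter> (E #> snd ab) \<noteq> {}}"
  have zZ: "z ab \<in> (D #> fst ab) \<inter> (E #> snd ab)" if "ab \<in> Z" for ab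
    using that some_in_eq[of "(D #> fst ab) \<inter> (E #> snd ab)"]
    by (simp add: z_def Z_def case_prod_beta)
  have DG: "D \<subseteq> carrier G" and EG: "E \<subseteq> carrier G"
    using D E by (auto simp: subgroup.subset)
  have zG: "z ab \<in> carrier G" if "ab \<in> Z" for ab
  proof -
    have "fst ab \<in> carrier G" using that F(2) by (auto simp: Z_def)
    then have "D #> fst ab \<subseteq> carrier G" by (rule r_coset_subset_G[OF DG])
    then show ?thesis using zZ[OF that] by blast
  qed
  have "P \<subseteq> (\<Union>x\<in>z ` Z. (D \<inter> E) #> x)"
  proof
    fix p assume p: "p \<in> P"
    obtain a where a: "a \<in> F" "p \<in> D #> a" using F(3) p by auto
    obtain b where b: "b \<in> F'" "p \<in> E #> b" using F'(3) p by auto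
    have ab: "(a,b) \<in> Z" using a b by (auto simp: Z_def)
    have "D #> a = D #> z (a,b)" "E #> b = E #> z (a,b)"
      using zZ[OF ab] a(1) b(1) F(2) F'(2) D E repr_independence[of "z (a,b)" _ a] repr_independence[of "z (a,b)" _ b]
      by auto
    then have "p \<in> D #> z (a,b)" "p \<in> E #> z (a,b)"
      using a(2) b(2) by (metis+)
    then obtain d e where d: "d \<in> D" "p = d \<otimes> z (a,b)" and e: "e \<in> E" "p = e \<otimes> z (a,b)"
      by (auto simp: r_coset_def)
    have "d = e" using d e zG[OF ab] DG EG by (metis right_cancel subsetD)
    then have "d \<in> D \<inter> E" using d(1) e(1) by simp
    then have "p \<in> (D \<inter> E) #> z (a,b)" unfolding r_coset_def using d(2) by blast
    then show "p \<in> (\<Union>x\<in>z ` Z. (D \<inter> E) #> x)" using ab by blast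
  qed
  moreover have "finite Z" using F(1) F'(1) by (auto simp: Z_def)
  ultimately show ?thesis
    unfolding covered_def using zG by (intro exI[of _ "z ` Z"]) auto
qed

lemma covered_cj:
  assumes g: "g \<in> carrier G" and D: "D \<subseteq> carrier G" and PD: "covered G P D"
  shows "covered G (cj g P) (cj g D)"
proof -
  obtain F where F: "finite F" "F \<subseteq> carrier G" "P \<subseteq> (\<Union>x\<in>F. D #> x)"
    using PD by (auto simp: covered_def)
  have "cj g P \<subseteq> (\<Union>x\<in>cj g F. cj g D #> x)"
  proof
    fix p assume "p \<in> cj g P"
    then obtain q where q: "q \<in> P" "p = g \<otimes> q \<otimes> inv g" by (auto simp: cj_def)
    obtain f d where f: "f \<in> F" "d \<in> D" "q = d \<otimes> f"
      using F(3) q(1) by (auto simp: r_coset_def)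
    have dG: "d \<in> carrier G" "f \<in> carrier G" using f F(2) D by auto
    have "inv g \<otimes> (g \<otimes> (f \<otimes> inv g)) = f \<otimes> inv g"
      using dG g by (simp flip: m_assoc)
    then have "p = (g \<otimes> d \<otimes> inv g) \<otimes> (g \<otimes> f \<otimes> inv g)"
      unfolding q(2) f(3) using dG g by (simp add: m_assoc)
    then show "p \<in> (\<Union>x\<in>cj g F. cj g D #> x)"
      using f by (auto simp: cj_def r_coset_def)
  qed
  then show ?thesis
    unfolding covered_def
    using F g by (intro exI[of _ "cj g F"]) (auto simp: cj_def)
qed

text \<open>One element for each value of \<open>\<phi>\<close> represents all cosets that are
  needed. This is how finite index is read off from actions on cyclic factors and on finite sets of
  subspaces.\<close>

lemma covered_fibers:
  assumes P: "P \<subseteq> carrier G" and fin: "finite (\<phi> ` P)" and D: "D \<subseteq> carrier G"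
    and fib: "\<And>p q. \<lbrakk>p \<in> P; q \<in> P; \<phi> p = \<phi> q\<rbrakk> \<Longrightarrow> p \<otimes> inv q \<in> D"
  shows "covered G P D"
proof -
  obtain F where F: "F \<subseteq> P" "finite F" "\<phi> ` F = \<phi> ` P"
    using finite_subset_image[OF fin subset_refl] by metis
  have "P \<subseteq> (\<Union>x\<in>F. D #> x)"
  proof
    fix p assume p: "p \<in> P"
    then obtain q where q: "q \<in> F" "\<phi> p = \<phi> q" using F(3) by (metis imageE imageI)
    have "p = (p \<otimes> inv q) \<otimes> q"
      using p q F(1) P by (simp add: m_assoc subset_iff)
    moreover have "p \<otimes> inv q \<in> D" using fib p q F(1) by auto
    ultimately show "p \<in> (\<Union>x\<in>F. D #> x)" using q by (auto simp: r_coset_def)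
  qed
  then show ?thesis unfolding covered_def using F P by (intro exI[of _ F]) auto
qed

text \<open>By the pigeonhole principle two powers of \<open>p\<close> lie in the same right coset
  of \<open>D\<close>, and their quotient is a positive power of \<open>p\<close> in
  \<open>D\<close>.\<close>

lemma covered_pow:
  assumes P: "subgroup P G" and D: "subgroup D G" and PD: "covered G P D" and p: "p \<in> P"
  shows "\<exists>n::nat. n \<ge> 1 \<and> p [^] n \<in> D"
proof -
  obtain F where F: "finite F" "F \<subseteq> carrier G" "P \<subseteq> (\<Union>x\<in>F. D #> x)"
    using PD by (auto simp: covered_def)
  have pG: "p \<in> carrier G" using p P by (auto dest: subgroup.mem_carrier)
  have pP: "p [^] (n::nat) \<in> P" for n
    using P p by (induction n) (auto simp: subgroup.one_closed subgroup.m_closed)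
  define f where "f n = (SOME x. x \<in> F \<and> p [^] n \<in> D #> x)" for n :: nat
  have f: "f n \<in> F \<and> p [^] n \<in> D #> f n" for n
  proof -
    have "\<exists>x. x \<in> F \<and> p [^] n \<in> D #> x" using F(3) pP[of n] by auto
    then show ?thesis unfolding f_def by (rule someI_ex)
  qed
  have "finite (range f)" using f F(1) by (meson finite_subset image_subsetI)
  then have "\<not> inj f" by (meson finite_imageD infinite_UNIV_nat)
  then obtain m n where mn: "m < n" "f m = f n"
    by (metis injI linorder_neqE_nat)
  obtain d where d: "d \<in> D" "p [^] m = d \<otimes> f m" using f[of m] by (auto simp: r_coset_def)
  obtain e where e: "e \<in> D" "p [^] n = e \<otimes> f m" using f[of n] mn(2) by (auto simp: r_coset_def)
  have fG: "f m \<in> carrier G" using f F(2) by auto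
  have de: "d \<in> carrier G" "e \<in> carrier G" using d e D by (auto dest: subgroup.mem_carrier)
  have "p [^] (n - m) = p [^] n \<otimes> inv (p [^] m)"
    using mn(1) pG by (metis add_diff_inverse_nat inv_solve_right less_imp_le_nat nat_pow_closed
        nat_pow_mult not_less add.commute)
  also have "\<dots> = e \<otimes> inv d"
    unfolding d(2) e(2) using fG de by (simp add: inv_mult_group m_assoc inv_solve_left)
      (simp flip: m_assoc add: fG de)
  also have "\<dots> \<in> D" using d(1) e(1) D by (simp add: subgroup.m_closed subgroup.m_inv_closed)
  finally show ?thesis using mn(1) by (intro exI[of _ "n - m"]) auto
qed

lemma mem_cj:
  assumes "g \<in> carrier G" "P \<subseteq> carrier G"
  shows "x \<in> cj g P \<longleftrightarrow> x \<in> carrier G \<and> inv g \<otimes> x \<otimes> g \<in> P"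
proof
  assume "x \<in> cj g P"
  then obtain p where p: "p \<in> P" "x = g \<otimes> p \<otimes> inv g" by (auto simp: cj_def)
  have "p \<in> carrier G" using p assms by auto
  then have "inv g \<otimes> x \<otimes> g = p" using p(2) assms(1)
    by (simp add: m_assoc) (simp flip: m_assoc)
  then show "x \<in> carrier G \<and> inv g \<otimes> x \<otimes> g \<in> P"
    using p assms by auto
next
  assume x: "x \<in> carrier G \<and> inv g \<otimes> x \<otimes> g \<in> P"
  then have "x = g \<otimes> (inv g \<otimes> x \<otimes> g) \<otimes> inv g"
    using assms(1) by (simp add: m_assoc) (simp flip: m_assoc)
  then show "x \<in> cj g P" using x by (auto simp: cj_def)
qed

end

section \<open>Normal series with cyclic factors and the comparison of Hirsch lengths\<close>

locale cyclic_series = group +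
  fixes k :: nat and N :: "nat \<Rightarrow> 'a set"
  assumes N_0: "N 0 = carrier G"
    and N_end: "N (Suc k) = {\<one>}"
    and N_normal: "i \<le> Suc k \<Longrightarrow> N i \<lhd> G"
    and N_Suc: "i \<le> k \<Longrightarrow> N (Suc i) \<subseteq> N i"
    and N_gen: "i \<le> k \<Longrightarrow> \<exists>x\<in>N i. \<forall>y\<in>N i. \<exists>n::int. y \<otimes> inv (x [^] n) \<in> N (Suc i)"
begin

lemma N_subgroup: "i \<le> Suc k \<Longrightarrow> subgroup (N i) G"
  using N_normal normal_imp_subgroup by blast

lemma N_carrier: "i \<le> Suc k \<Longrightarrow> x \<in> N i \<Longrightarrow> x \<in> carrier G"
  using N_subgroup subgroup.mem_carrier by metis

lemma N_conj: "i \<le> Suc k \<Longrightarrow> x \<in> N i \<Longrightarrow> g \<in> carrier G \<Longrightarrow> g \<otimes> x \<otimes> inv g \<in> N i"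
  using N_normal normal.inv_op_closed2 by metis

lemma N_conj': "i \<le> Suc k \<Longrightarrow> x \<in> N i \<Longrightarrow> g \<in> carrier G \<Longrightarrow> inv g \<otimes> x \<otimes> g \<in> N i"
  using N_normal normal.inv_op_closed1 by metis

text \<open>The number of jumps is the Hirsch length of \<open>P\<close>.\<close>

definition jumps :: "'a set \<Rightarrow> nat set" where
  "jumps P = {i. i \<le> k \<and> \<not> covered G (P \<inter> N i) (P \<inter> N (Suc i))}"

lemma jumps_finite: "finite (jumps P)"
  by (rule finite_subset[of _ "{..k}"]) (auto simp: jumps_def)

lemma jumps_card: "card (jumps P) \<le> Suc k"
proof -
  have "card (jumps P) \<le> card {..k}" by (rule card_mono) (auto simp: jumps_def)
  then show ?thesis by simp
qed

text \<open>If \<open>Q\<close> did not jump at \<open>i\<close>, then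
  \<open>P \<inter> N i\<close>, being virtually contained in \<open>Q \<inter> N i\<close>, would
  be virtually contained in \<open>N (Suc i)\<close>.\<close>

lemma jumps_mono:
  assumes P: "subgroup P G" and Q: "subgroup Q G" and PQ: "covered G P Q"
  shows "jumps P \<subseteq> jumps Q"
proof
  fix i assume i: "i \<in> jumps P"
  then have ik: "i \<le> k" by (simp add: jumps_def)
  show "i \<in> jumps Q"
  proof (rule ccontr)
    assume "i \<notin> jumps Q"
    then have Qi: "covered G (Q \<inter> N i) (Q \<inter> N (Suc i))" using ik by (simp add: jumps_def)
    have sub: "subgroup (N i) G" "subgroup (N (Suc i)) G" using ik by (auto intro: N_subgroup)
    have c1: "covered G (P \<inter> N i) Q" using PQ by (rule covered_mono) auto
    have c2: "covered G (P \<inter> N i) (N i)"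
      using P subgroup.subset by (intro covered_subset) auto
    have "covered G (P \<inter> N i) (Q \<inter> N i)" using covered_Int[OF Q sub(1) c1 c2] .
    then have "covered G (P \<inter> N i) (Q \<inter> N (Suc i))"
      by (rule covered_trans[OF _ Qi]) (use subgroup.subset[OF Q] in auto)
    then have c3: "covered G (P \<inter> N i) (N (Suc i))" by (rule covered_mono) auto
    have c4: "covered G (P \<inter> N i) P"
      using P subgroup.subset by (intro covered_subset) auto
    have "covered G (P \<inter> N i) (P \<inter> N (Suc i))" using covered_Int[OF P sub(2) c4 c3] .
    then show False using i by (simp add: jumps_def)
  qed
qed

text \<open>A nontrivial subgroup of an infinite cyclic group has finite index, so at a jump of
  \<open>P\<close> finitely many residues separate \<open>Q\<close> from \<open>P\<close> modulo
  \<open>N (Suc i)\<close>. The computation is done with exponents of the generator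
  \<open>x\<close>: \<open>exmul\<close> and \<open>exinv\<close> say that exponents add and change
  sign, for any valid exponents and not only for the chosen ones \<open>ex y\<close>.\<close>

lemma covered_of_jump_step:
  assumes i: "i \<le> k" and P: "subgroup P G" and Q: "subgroup Q G" and PQ: "covered G P Q"
    and j: "\<not> covered G (P \<inter> N i) (P \<inter> N (Suc i))"
    and IH: "covered G (Q \<inter> N (Suc i)) P"
  shows "covered G (Q \<inter> N i) P"
proof -
  have sub: "subgroup (N i) G" "subgroup (N (Suc i)) G" using i by (auto intro: N_subgroup)
  obtain x where x: "x \<in> N i" "\<And>y. y \<in> N i \<Longrightarrow> \<exists>n::int. y \<otimes> inv (x [^] n) \<in> N (Suc i)"
    using N_gen[OF i] by blast
  have xG: "x \<in> carrier G" using N_carrier[OF _ x(1)] i by auto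
  define ex where "ex y = (SOME n::int. y \<otimes> inv (x [^] n) \<in> N (Suc i))" for y
  have ex: "y \<otimes> inv (x [^] ex y) \<in> N (Suc i)" if "y \<in> N i" for y
    unfolding ex_def using x(2)[OF that] by (rule someI_ex)
  have PG: "P \<subseteq> carrier G" and QG: "Q \<subseteq> carrier G" using P Q by (auto dest: subgroup.subset)
  have exmul: "y \<otimes> z \<otimes> inv (x [^] (m + n)) \<in> N (Suc i)"
    if "y \<in> carrier G" "z \<in> carrier G" "y \<otimes> inv (x [^] m) \<in> N (Suc i)" "z \<otimes> inv (x [^] n) \<in> N (Suc i)"
    for y z and m n :: int
  proof -
    have "y \<otimes> (z \<otimes> inv (x [^] n)) \<otimes> inv y \<in> N (Suc i)"
      using N_conj[of "Suc i" "z \<otimes> inv (x [^] n)" y] i that by auto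
    then have "y \<otimes> (z \<otimes> inv (x [^] n)) \<otimes> inv y \<otimes> (y \<otimes> inv (x [^] m)) \<in> N (Suc i)"
      using that(3) sub(2) by (simp add: subgroup.m_closed)
    moreover have "y \<otimes> (z \<otimes> inv (x [^] n)) \<otimes> inv y \<otimes> (y \<otimes> inv (x [^] m)) = y \<otimes> z \<otimes> inv (x [^] (m + n))"
    proof -
      have "inv y \<otimes> (y \<otimes> inv (x [^] m)) = inv (x [^] m)" using that xG by (simp flip: m_assoc)
      then show ?thesis using that xG by (simp add: m_assoc int_pow_mult inv_mult_group)
    qed
    ultimately show ?thesis by simp
  qed
  have exinv: "inv y \<otimes> inv (x [^] (- m)) \<in> N (Suc i)"
    if "y \<in> carrier G" "y \<otimes> inv (x [^] m) \<in> N (Suc i)" for y and m :: int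
  proof -
    have "inv y \<otimes> (y \<otimes> inv (x [^] m)) \<otimes> y \<in> N (Suc i)"
      using N_conj'[of "Suc i" "y \<otimes> inv (x [^] m)" y] i that by auto
    then have "inv (inv y \<otimes> (y \<otimes> inv (x [^] m)) \<otimes> y) \<in> N (Suc i)"
      using sub(2) by (simp add: subgroup.m_inv_closed)
    moreover have "inv y \<otimes> (y \<otimes> inv (x [^] m)) = inv (x [^] m)" using that xG by (simp flip: m_assoc)
    ultimately show ?thesis using that xG by (simp add: inv_mult_group int_pow_neg)
  qed
  have "\<exists>p\<in>P \<inter> N i. ex p \<noteq> 0"
  proof (rule ccontr)
    assume "\<not> ?thesis"
    then have "P \<inter> N i \<subseteq> P \<inter> N (Suc i)" using ex xG PG by fastforce
    then show False using j PG covered_subset by blast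
  qed
  then obtain p where p: "p \<in> P" "p \<in> N i" "ex p \<noteq> 0" by auto
  obtain n :: nat where n: "n \<ge> 1" "p [^] n \<in> Q" using covered_pow[OF P Q PQ p(1)] by auto
  \<comment> \<open>A power of \<open>p\<close> that also lies in \<open>Q\<close>, with an exponent
    \<open>m\<close> that is still nonzero. Multiplying by powers of \<open>q\<close> changes an
    exponent by multiples of \<open>m\<close> without leaving \<open>P\<close> or
    \<open>Q\<close>.\<close>
  define q where "q = p [^] n"
  define m where "m = int n * ex p"
  have powP: "p [^] (c::nat) \<in> P \<inter> N i \<and> p [^] c \<otimes> inv (x [^] (int c * ex p)) \<in> N (Suc i)" for c
  proof (induction c)
    case 0
    then show ?case using P sub by (simp add: subgroup.one_closed)
  next
    case (Suc c)
    have "p [^] c \<otimes> p \<otimes> inv (x [^] (int c * ex p + ex p)) \<in> N (Suc i)"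
      using Suc ex[OF p(2)] p PG by (intro exmul) auto
    moreover have "p [^] c \<otimes> p \<in> P \<inter> N i" using Suc p P sub by (simp add: subgroup.m_closed)
    ultimately show ?case by (simp add: algebra_simps)
  qed
  have q: "q \<in> P" "q \<in> Q" "q \<in> N i" "q \<otimes> inv (x [^] m) \<in> N (Suc i)"
    using powP[of n] n by (auto simp: q_def m_def)
  have qG: "q \<in> carrier G" using q PG by auto
  have m0: "m \<noteq> 0" using p(3) n(1) by (auto simp: m_def)
  have powq: "q [^] (c::nat) \<otimes> inv (x [^] (int c * m)) \<in> N (Suc i) \<and> q [^] c \<in> P \<inter> Q \<inter> N i" for c
  proof (induction c)
    case 0
    then show ?case using P Q sub by (simp add: subgroup.one_closed)
  next
    case (Suc c)
    have "q [^] c \<otimes> q \<otimes> inv (x [^] (int c * m + m)) \<in> N (Suc i)"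
      using Suc q PG by (intro exmul) auto
    moreover have "q [^] c \<otimes> q \<in> P \<inter> Q \<inter> N i" using Suc q P Q sub by (simp add: subgroup.m_closed)
    ultimately show ?case by (simp add: algebra_simps)
  qed
  have powz: "q [^] (c::int) \<otimes> inv (x [^] (c * m)) \<in> N (Suc i) \<and> q [^] c \<in> P \<inter> Q \<inter> N i" for c
  proof (cases c rule: int_cases2)
    case (nonneg n)
    show ?thesis using powq[of n] unfolding nonneg int_pow_int by blast
  next
    case (nonpos n)
    have "inv (q [^] n) \<otimes> inv (x [^] (- (int n * m))) \<in> N (Suc i)"
      using powq[of n] qG by (intro exinv) auto
    moreover have "inv (q [^] n) \<in> P \<inter> Q \<inter> N i"
      using powq[of n] P Q sub by (simp add: subgroup.m_inv_closed)
    moreover have "q [^] (- int n) = inv (q [^] n)" using qG by (simp add: int_pow_neg int_pow_int)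
    ultimately show ?thesis unfolding nonpos by simp
  qed
  define u where "u y = ex y mod m" for y
  define s where "s a = (SOME y. y \<in> Q \<inter> N i \<and> u y = a)" for a
  have s: "s (u y) \<in> Q \<inter> N i \<and> u (s (u y)) = u y" if "y \<in> Q \<inter> N i" for y
    unfolding s_def using someI[of "\<lambda>z. z \<in> Q \<inter> N i \<and> u z = u y" y] that by auto
  have fin: "finite (range u)"
  proof (rule finite_subset)
    \<comment> \<open>The sign of \<open>m\<close> is unknown and \<open>mod\<close> takes the sign
      of the divisor, hence the symmetric interval.\<close>
    show "range u \<subseteq> {-\<bar>m\<bar>..\<bar>m\<bar>}"
      using m0 by (auto simp: u_def) (smt (verit) pos_mod_bound pos_mod_sign neg_mod_bound neg_mod_sign)+
  qed auto
  obtain F where F: "finite F" "F \<subseteq> carrier G" "Q \<inter> N (Suc i) \<subseteq> (\<Union>f\<in>F. P #> f)"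
    using IH by (auto simp: covered_def)
  define U where "U = u ` (Q \<inter> N i)"
  have "Q \<inter> N i \<subseteq> (\<Union>f\<in>(\<lambda>(f,a). f \<otimes> s a) ` (F \<times> U). P #> f)"
  proof
    fix y assume y: "y \<in> Q \<inter> N i"
    define z where "z = s (u y)"
    have z: "z \<in> Q" "z \<in> N i" "u z = u y" using s[OF y] by (auto simp: z_def)
    have "ex y mod m = ex z mod m" using z(3) by (simp add: u_def)
    then have "m dvd ex y - ex z" by (metis mod_eq_dvd_iff)
    then obtain b where b: "ex y = b * m + ex z" by (metis dvdE diff_eq_eq mult.commute)
    \<comment> \<open>Removing \<open>q [^] b\<close> on the left and the representative
      \<open>z\<close> of the residue on the right leaves the exponent 0, so \<open>w\<close> lies
      in \<open>N (Suc i)\<close> and \<open>IH\<close> applies to it.\<close>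
    define w where "w = inv (q [^] b) \<otimes> y \<otimes> inv z"
    have yG: "y \<in> carrier G" "z \<in> carrier G" using y z QG by auto
    have qb: "q [^] b \<in> carrier G" "q [^] b \<in> Q" "q [^] b \<in> P" using powz[of b] qG by auto
    have 1: "inv (q [^] b) \<otimes> y \<otimes> inv (x [^] (- (b * m) + ex y)) \<in> N (Suc i)"
      using powz[of b] qb yG y ex by (intro exmul exinv) auto
    have "inv (q [^] b) \<otimes> y \<otimes> inv z \<otimes> inv (x [^] (- (b * m) + ex y + - ex z)) \<in> N (Suc i)"
      by (rule exmul[OF _ _ 1 exinv]) (use qb yG z ex in auto)
    then have "w \<in> N (Suc i)" using b qb yG by (simp add: w_def)
    moreover have "w \<in> Q" using qb y z Q by (simp add: w_def subgroup.m_closed subgroup.m_inv_closed)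
    ultimately obtain f where f: "f \<in> F" "w \<in> P #> f" using F(3) by auto
    obtain r where r: "r \<in> P" "w = r \<otimes> f" using f by (auto simp: r_coset_def)
    have fG: "f \<in> carrier G" "r \<in> carrier G" using f r F PG by auto
    have "y = q [^] b \<otimes> (w \<otimes> z)"
      unfolding w_def using qb yG by (simp add: m_assoc) (simp flip: m_assoc)
    also have "\<dots> = (q [^] b \<otimes> r) \<otimes> (f \<otimes> s (u y))"
      unfolding r z_def[symmetric] using qb yG fG by (simp add: m_assoc)
    finally have "y \<in> P #> (f \<otimes> s (u y))"
      using qb r P by (auto simp: r_coset_def subgroup.m_closed)
    then show "y \<in> (\<Union>f\<in>(\<lambda>(f,a). f \<otimes> s a) ` (F \<times> U). P #> f)"
      using f y by (force simp: U_def)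
  qed
  moreover have "finite U" using fin by (rule finite_subset[rotated]) (auto simp: U_def)
  moreover have "s a \<in> carrier G" if "a \<in> U" for a
    using that s QG by (auto simp: U_def)
  ultimately show ?thesis
    unfolding covered_def using F
    by (intro exI[of _ "(\<lambda>(f,a). f \<otimes> s a) ` (F \<times> U)"]) auto
qed

text \<open>The converse of monotonicity, by induction from the trivial end of the series up to the
  whole group. At a jump of \<open>Q\<close>, which is one of \<open>P\<close> as well, the
  preceding lemma applies; elsewhere \<open>Q \<inter> N i\<close> is virtually contained in
  \<open>Q \<inter> N (Suc i)\<close> and nothing new appears.\<close>

lemma covered_of_jumps:
  assumes P: "subgroup P G" and Q: "subgroup Q G" and PQ: "covered G P Q"
    and J: "jumps Q \<subseteq> jumps P"
  shows "covered G Q P"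
proof -
  have PG: "P \<subseteq> carrier G" using P by (auto dest: subgroup.subset)
  have "covered G (Q \<inter> N i) P" if "i \<le> Suc k" for i
    using that
  proof (induction "Suc k - i" arbitrary: i)
    case 0
    then have "N i = {\<one>}" using N_end by (metis diff_is_0_eq le_antisym)
    then show ?case using P by (intro covered_subset) (auto simp: subgroup.one_closed)
  next
    case (Suc d)
    then have ik: "i \<le> k" by auto
    have IH: "covered G (Q \<inter> N (Suc i)) P" using Suc(1)[of "Suc i"] Suc(2) ik by auto
    show ?case
    proof (cases "i \<in> jumps Q")
      case True
      then show ?thesis using covered_of_jump_step[OF ik P Q PQ _ IH] J by (auto simp: jumps_def)
    next
      case False
      then have "covered G (Q \<inter> N i) (Q \<inter> N (Suc i))" using ik by (auto simp: jumps_def)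
      then show ?thesis using IH PG by (rule covered_trans)
    qed
  qed
  from this[of 0] have "covered G (Q \<inter> N 0) P" by simp
  moreover have "Q \<inter> N 0 = Q" using N_0 subgroup.subset[OF Q] by auto
  ultimately show ?thesis by simp
qed

end

section \<open>The subgroup of finite index that centralizes all factors\<close>

context cyclic_series
begin

text \<open>The common kernel of the conjugation actions of \<open>G\<close> on the factors of the
  series: modulo \<open>N (Suc i)\<close> its elements commute with those of
  \<open>N i\<close>.\<close>

definition central_part :: "'a set" where
  "central_part = {g \<in> carrier G. \<forall>i\<le>k. \<forall>x\<in>N i. g \<otimes> x \<otimes> inv g \<otimes> inv x \<in> N (Suc i)}"

abbreviation coset :: "nat \<Rightarrow> 'a \<Rightarrow> 'a set" where
  "coset i x \<equiv> N (Suc i) #> x"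

lemma coset_hom: "i \<le> k \<Longrightarrow> group_hom G (G Mod N (Suc i)) (coset i)"
  by (simp add: group_hom_def group_hom_axioms_def N_normal normal.factorgroup_is_group
      normal.r_coset_hom_Mod)

lemma coset_eq_iff:
  assumes "i \<le> k" "x \<in> carrier G" "y \<in> carrier G"
  shows "coset i x = coset i y \<longleftrightarrow> x \<otimes> inv y \<in> N (Suc i)"
proof -
  have sub: "subgroup (N (Suc i)) G" using assms(1) by (auto intro: N_subgroup)
  have "x \<in> coset i y \<longleftrightarrow> x \<otimes> inv y \<in> N (Suc i)"
    using subgroup.rcos_module[OF sub] assms by auto
  moreover have "coset i x = coset i y \<longleftrightarrow> x \<in> coset i y"
    using repr_independence[OF _ assms(3) sub] rcos_self[OF assms(2) sub] by auto
  ultimately show ?thesis by simp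
qed

lemma coset_conj_commute:
  assumes "i \<le> k" "g \<in> carrier G" "x \<in> carrier G"
  shows "g \<otimes> x \<otimes> inv g \<otimes> inv x \<in> N (Suc i) \<longleftrightarrow> coset i (g \<otimes> x \<otimes> inv g) = coset i x"
  using coset_eq_iff[of i "g \<otimes> x \<otimes> inv g" x] assms by simp

lemma coset_gen:
  assumes "i \<le> k"
  obtains x where "x \<in> N i" "\<And>y. y \<in> N i \<Longrightarrow> \<exists>n::int. coset i y = coset i (x [^] n)"
proof -
  obtain x where x: "x \<in> N i" "\<forall>y\<in>N i. \<exists>n::int. y \<otimes> inv (x [^] n) \<in> N (Suc i)"
    using N_gen[OF assms] by blast
  have "x \<in> carrier G" using N_carrier[OF _ x(1)] assms by auto
  then have "\<exists>n::int. coset i y = coset i (x [^] n)" if "y \<in> N i" for y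
    using x(2) that coset_eq_iff[OF assms] N_carrier[of i y] assms by auto
  then show ?thesis using that x(1) by blast
qed

lemma coset_conj_cong:
  assumes "i \<le> k" "g \<in> carrier G" "x \<in> carrier G" "y \<in> carrier G" "coset i x = coset i y"
  shows "coset i (g \<otimes> x \<otimes> inv g) = coset i (g \<otimes> y \<otimes> inv g)"
proof -
  interpret q: group_hom G "G Mod N (Suc i)" "coset i" by (rule coset_hom[OF assms(1)])
  show ?thesis using assms by (simp add: q.hom_mult)
qed

lemma coset_conj_pow:
  assumes "i \<le> k" "g \<in> carrier G" "x \<in> carrier G"
  shows "g \<otimes> (x [^] (n::int)) \<otimes> inv g = (g \<otimes> x \<otimes> inv g) [^] n"
proof -
  have nat: "g \<otimes> (x [^] (n::nat)) \<otimes> inv g = (g \<otimes> x \<otimes> inv g) [^] n" for n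
  proof (induction n)
    case (Suc n)
    have "(g \<otimes> x [^] n \<otimes> inv g) \<otimes> (g \<otimes> x \<otimes> inv g) = g \<otimes> (x [^] n \<otimes> x) \<otimes> inv g"
    proof -
      have "inv g \<otimes> (g \<otimes> (x \<otimes> inv g)) = x \<otimes> inv g" using assms by (simp flip: m_assoc)
      then show ?thesis using assms by (simp add: m_assoc)
    qed
    then show ?case using Suc by simp
  qed (use assms in auto)
  show ?thesis
  proof (cases n rule: int_cases2)
    case (nonneg m)
    show ?thesis unfolding nonneg int_pow_int by (rule nat)
  next
    case (nonpos m)
    have "inv (g \<otimes> x [^] m \<otimes> inv g) = g \<otimes> inv (x [^] m) \<otimes> inv g"
      using assms by (simp add: inv_mult_group m_assoc)
    then have "g \<otimes> inv (x [^] m) \<otimes> inv g = inv ((g \<otimes> x \<otimes> inv g) [^] m)" using nat[of m] by simp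
    then show ?thesis unfolding nonpos using assms by (simp add: int_pow_neg int_pow_int)
  qed
qed

lemma coset_int_pow_cong:
  assumes "i \<le> k" "x \<in> carrier G" "y \<in> carrier G" "coset i x = coset i y"
  shows "coset i (x [^] (n::int)) = coset i (y [^] n)"
proof -
  interpret q: group_hom G "G Mod N (Suc i)" "coset i" by (rule coset_hom[OF assms(1)])
  show ?thesis using assms by (simp add: q.hom_int_pow)
qed

text \<open>The centralizer of a single factor, written with cosets so that the quotient
  homomorphism can be used in place of commutator identities.\<close>

definition fixer :: "nat \<Rightarrow> 'a set" where
  "fixer i = {g \<in> carrier G. \<forall>x\<in>N i. coset i (g \<otimes> x \<otimes> inv g) = coset i x}"

lemma central_part_eq: "central_part = {g \<in> carrier G. \<forall>i\<le>k. g \<in> fixer i}"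
proof -
  have "(\<forall>x\<in>N i. g \<otimes> x \<otimes> inv g \<otimes> inv x \<in> N (Suc i)) \<longleftrightarrow> g \<in> fixer i"
    if "i \<le> k" "g \<in> carrier G" for g i
  proof -
    have "x \<in> carrier G" if "x \<in> N i" for x using N_carrier[OF _ that] \<open>i \<le> k\<close> by simp
    then show ?thesis using coset_conj_commute[OF that] that by (simp add: fixer_def)
  qed
  then show ?thesis unfolding central_part_def by blast
qed

lemma conj_mult: "\<lbrakk>g \<in> carrier G; h \<in> carrier G; x \<in> carrier G\<rbrakk> \<Longrightarrow>
   g \<otimes> h \<otimes> x \<otimes> inv (g \<otimes> h) = g \<otimes> (h \<otimes> x \<otimes> inv h) \<otimes> inv g"
  by (simp add: m_assoc inv_mult_group)

lemma fixer_subgroup: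
  assumes i: "i \<le> k"
  shows "subgroup (fixer i) G"
proof (rule subgroupI)
  show "fixer i \<subseteq> carrier G" by (auto simp: fixer_def)
  have "\<one> \<in> fixer i"
    using N_carrier[of i] i by (simp add: fixer_def)
  then show "fixer i \<noteq> {}" by auto
next
  fix g h assume gh: "g \<in> fixer i" "h \<in> fixer i"
  then have G: "g \<in> carrier G" "h \<in> carrier G" by (auto simp: fixer_def)
  have "coset i (g \<otimes> h \<otimes> x \<otimes> inv (g \<otimes> h)) = coset i x" if x: "x \<in> N i" for x
  proof -
    have xG: "x \<in> carrier G" using N_carrier[OF _ x] i by auto
    have "h \<otimes> x \<otimes> inv h \<in> N i" using N_conj[OF _ x] i G by auto
    then show ?thesis using gh x G xG by (simp add: conj_mult fixer_def)
  qed
  then show "g \<otimes> h \<in> fixer i" using G by (simp add: fixer_def)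
next
  fix g assume g: "g \<in> fixer i"
  then have G: "g \<in> carrier G" by (auto simp: fixer_def)
  have "coset i (inv g \<otimes> x \<otimes> inv (inv g)) = coset i x" if x: "x \<in> N i" for x
  proof -
    have xG: "x \<in> carrier G" using N_carrier[OF _ x] i by auto
    have y: "inv g \<otimes> x \<otimes> g \<in> N i" using N_conj'[OF _ x] i G by auto
    have "g \<otimes> (inv g \<otimes> x \<otimes> g) \<otimes> inv g = x"
      using G xG by (simp add: m_assoc) (simp flip: m_assoc)
    then show ?thesis using g y G by (auto simp: fixer_def)
  qed
  then show "inv g \<in> fixer i" using G by (simp add: fixer_def)
qed

lemma fixer_conj:
  assumes i: "i \<le> k" and g: "g \<in> fixer i" and h: "h \<in> carrier G"
  shows "h \<otimes> g \<otimes> inv h \<in> fixer i"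
proof -
  have G: "g \<in> carrier G" using g by (simp add: fixer_def)
  have "coset i ((h \<otimes> g \<otimes> inv h) \<otimes> x \<otimes> inv (h \<otimes> g \<otimes> inv h)) = coset i x" if x: "x \<in> N i" for x
  proof -
    have xG: "x \<in> carrier G" using N_carrier[OF _ x] i by auto
    define y where "y = inv h \<otimes> x \<otimes> h"
    have y: "y \<in> N i" "y \<in> carrier G" using N_conj'[OF _ x] xG i h by (auto simp: y_def)
    have e: "(h \<otimes> g \<otimes> inv h) \<otimes> x \<otimes> inv (h \<otimes> g \<otimes> inv h) = h \<otimes> (g \<otimes> y \<otimes> inv g) \<otimes> inv h"
      using G h xG by (simp add: y_def m_assoc inv_mult_group)
    have "coset i (g \<otimes> y \<otimes> inv g) = coset i y" using g y by (simp add: fixer_def)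
    then have "coset i (h \<otimes> (g \<otimes> y \<otimes> inv g) \<otimes> inv h) = coset i (h \<otimes> y \<otimes> inv h)"
      using G h y i by (intro coset_conj_cong) auto
    moreover have "h \<otimes> y \<otimes> inv h = x"
      unfolding y_def using h xG by (simp add: m_assoc) (simp flip: m_assoc)
    ultimately show ?thesis unfolding e by simp
  qed
  then show ?thesis using G h by (simp add: fixer_def)
qed

lemma central_part_subgroup: "subgroup central_part G"
proof -
  have "central_part = \<Inter> (fixer ` {..k})"
    unfolding central_part_eq by (auto simp: fixer_def)
  moreover have "subgroup (\<Inter> (fixer ` {..k})) G"
    using fixer_subgroup by (intro subgroups_Inter) auto
  ultimately show ?thesis by simp
qed

lemma central_part_conj: "g \<in> central_part \<Longrightarrow> h \<in> carrier G \<Longrightarrow> h \<otimes> g \<otimes> inv h \<in> central_part"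
  unfolding central_part_eq using fixer_conj by blast

text \<open>The automorphism group of a cyclic group is finite, and an automorphism is determined by
  the image of a generator; \<open>\<phi> g\<close> is the image of the generator under conjugation
  by \<open>inv g\<close>. In a finite factor there are only finitely many values. In an infinite
  one the exponents belonging to \<open>g\<close> and \<open>inv g\<close> have product 1, so both
  are 1 or both are -1.\<close>

lemma fixer_covered:
  assumes i: "i \<le> k"
  shows "covered G (carrier G) (fixer i)"
proof -
  interpret q: group_hom G "G Mod N (Suc i)" "coset i" by (rule coset_hom[OF i])
  obtain x where x: "x \<in> N i" and gen: "\<And>y. y \<in> N i \<Longrightarrow> \<exists>n::int. coset i y = coset i (x [^] n)"
    using coset_gen[OF i] by blast
  have xG: "x \<in> carrier G" using N_carrier[OF _ x] i by auto
  define \<phi> where "\<phi> g = coset i (inv g \<otimes> x \<otimes> g)" for g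
  have rng: "\<phi> g \<in> range (\<lambda>n::int. coset i (x [^] n))" if "g \<in> carrier G" for g
    using gen[of "inv g \<otimes> x \<otimes> g"] N_conj'[OF _ x that] i by (auto simp: \<phi>_def)
  have fin: "finite (\<phi> ` carrier G)"
  proof (cases "\<exists>m::int. m \<noteq> 0 \<and> coset i (x [^] m) = coset i \<one>")
    case True
    then obtain m :: int where m: "m \<noteq> 0" "coset i (x [^] m) = coset i \<one>" by auto
    have red: "coset i (x [^] n) = coset i (x [^] (n mod m))" for n
    proof -
      have "x [^] n = x [^] (m * (n div m) + n mod m)" by simp
      also have "\<dots> = x [^] (m * (n div m)) \<otimes> x [^] (n mod m)" using xG by (rule int_pow_mult)
      also have "x [^] (m * (n div m)) = (x [^] m) [^] (n div m)" using int_pow_pow[OF xG] by simp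
      finally have "coset i (x [^] n) = coset i ((x [^] m) [^] (n div m) \<otimes> x [^] (n mod m))"
        by (rule arg_cong)
      also have "\<dots> = coset i ((x [^] m) [^] (n div m)) \<otimes>\<^bsub>G Mod N (Suc i)\<^esub> coset i (x [^] (n mod m))"
        by (rule q.hom_mult) (use xG in auto)
      also have "coset i ((x [^] m) [^] (n div m)) = coset i (\<one> [^] (n div m))"
        using m xG i by (intro coset_int_pow_cong) auto
      also have "\<dots> \<otimes>\<^bsub>G Mod N (Suc i)\<^esub> coset i (x [^] (n mod m))
          = coset i (\<one> [^] (n div m) \<otimes> x [^] (n mod m))"
        by (rule q.hom_mult[symmetric]) (use xG in auto)
      also have "\<one> [^] (n div m) \<otimes> x [^] (n mod m) = x [^] (n mod m)" using xG by simp
      finally show ?thesis .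
    qed
    have bd: "coset i (x [^] n) \<in> (\<lambda>n. coset i (x [^] n)) ` {-\<bar>m\<bar>..\<bar>m\<bar>}" for n :: int
    proof -
      have "n mod m \<in> {-\<bar>m\<bar>..\<bar>m\<bar>}"
        using m(1) by simp (smt (verit) pos_mod_bound pos_mod_sign neg_mod_bound neg_mod_sign)
      then show ?thesis by (subst red) (rule imageI)
    qed
    have "\<phi> ` carrier G \<subseteq> (\<lambda>n. coset i (x [^] n)) ` {-\<bar>m\<bar>..\<bar>m\<bar>}"
    proof (rule image_subsetI)
      fix g assume "g \<in> carrier G"
      then have "\<phi> g \<in> range (\<lambda>n::int. coset i (x [^] n))" by (rule rng)
      then obtain n :: int where e: "\<phi> g = coset i (x [^] n)" by (rule rangeE)
      show "\<phi> g \<in> (\<lambda>n. coset i (x [^] n)) ` {-\<bar>m\<bar>..\<bar>m\<bar>}" unfolding e by (rule bd)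
    qed
    then show ?thesis by (rule finite_subset) simp
  next
    case False
    have "\<phi> g \<in> (\<lambda>n::int. coset i (x [^] n)) ` {1, -1}" if g: "g \<in> carrier G" for g
    proof -
      obtain a :: int where a: "\<phi> g = coset i (x [^] a)" using rng[OF g] by auto
      obtain b :: int where b: "\<phi> (inv g) = coset i (x [^] b)" using rng[of "inv g"] g by auto
      have 1: "coset i (g \<otimes> x \<otimes> inv g) = coset i (x [^] b)" using b g by (simp add: \<phi>_def)
      have "g \<otimes> (inv g \<otimes> x \<otimes> g) \<otimes> inv g = x"
        using g xG by (simp add: m_assoc) (simp flip: m_assoc)
      then have "coset i x = coset i (g \<otimes> (inv g \<otimes> x \<otimes> g) \<otimes> inv g)" by simp
      also have "\<dots> = coset i (g \<otimes> (x [^] a) \<otimes> inv g)"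
        using a g xG i by (intro coset_conj_cong) (auto simp: \<phi>_def)
      also have "\<dots> = coset i ((g \<otimes> x \<otimes> inv g) [^] a)" using coset_conj_pow i g xG by simp
      also have "\<dots> = coset i ((x [^] b) [^] a)" using 1 g xG i by (intro coset_int_pow_cong) auto
      finally have "coset i x = coset i (x [^] (b * a))" using xG by (simp add: int_pow_pow)
      note ba = this
      have "coset i (x [^] (b * a) \<otimes> inv x) = coset i (x [^] (b * a)) \<otimes>\<^bsub>G Mod N (Suc i)\<^esub> coset i (inv x)"
        by (rule q.hom_mult) (use xG in auto)
      also have "\<dots> = coset i (x \<otimes> inv x)"
        unfolding ba[symmetric] by (rule q.hom_mult[symmetric]) (use xG in auto)
      finally have "coset i (x [^] (b * a) \<otimes> inv x) = coset i \<one>" using xG by simp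
      moreover have "x [^] (b * a) \<otimes> inv x = x [^] (b * a - 1)"
        using int_pow_mult[OF xG, of "b * a" "-1"] int_pow_neg[OF xG, of 1] xG by simp
      ultimately have "b * a - 1 = 0" using False by metis
      then have "a = 1 \<or> a = -1" by (metis eq_iff_diff_eq_0 mult.commute zmult_eq_1_iff)
      then show ?thesis using a by blast
    qed
    then have "\<phi> ` carrier G \<subseteq> (\<lambda>n::int. coset i (x [^] n)) ` {1, -1}" by (rule image_subsetI)
    then show ?thesis by (rule finite_subset) simp
  qed
  show ?thesis
  proof (rule covered_fibers[OF _ fin])
    show "fixer i \<subseteq> carrier G" by (auto simp: fixer_def)
  next
    fix p q assume p: "p \<in> carrier G" and q: "q \<in> carrier G" and e: "\<phi> p = \<phi> q"
    define g where "g = p \<otimes> inv q"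
    have g: "g \<in> carrier G" using p q by (simp add: g_def)
    have "coset i (p \<otimes> (inv p \<otimes> x \<otimes> p) \<otimes> inv p) = coset i (p \<otimes> (inv q \<otimes> x \<otimes> q) \<otimes> inv p)"
      using e p q xG i by (intro coset_conj_cong) (auto simp: \<phi>_def)
    moreover have "p \<otimes> (inv p \<otimes> x \<otimes> p) \<otimes> inv p = x"
      using p xG by (simp add: m_assoc) (simp flip: m_assoc)
    moreover have "p \<otimes> (inv q \<otimes> x \<otimes> q) \<otimes> inv p = g \<otimes> x \<otimes> inv g"
      using p q xG by (simp add: g_def m_assoc inv_mult_group)
    ultimately have gx: "coset i (g \<otimes> x \<otimes> inv g) = coset i x" by simp
    have "coset i (g \<otimes> y \<otimes> inv g) = coset i y" if y: "y \<in> N i" for y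
    proof -
      have yG: "y \<in> carrier G" using N_carrier[OF _ y] i by auto
      obtain n :: int where n: "coset i y = coset i (x [^] n)" using gen[OF y] by auto
      have "coset i (g \<otimes> y \<otimes> inv g) = coset i (g \<otimes> (x [^] n) \<otimes> inv g)"
        using n g yG xG i by (intro coset_conj_cong) auto
      also have "\<dots> = coset i ((g \<otimes> x \<otimes> inv g) [^] n)" using coset_conj_pow i g xG by simp
      also have "\<dots> = coset i (x [^] n)" using gx g xG i by (intro coset_int_pow_cong) auto
      finally show ?thesis using n by simp
    qed
    then show "p \<otimes> inv q \<in> fixer i" using g by (simp add: fixer_def g_def)
  qed simp
qed

lemma central_part_covered: "covered G (carrier G) central_part"
proof -
  have "covered G (carrier G) (\<Inter> (fixer ` {..n}))" if "n \<le> k" for n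
    using that
  proof (induction n)
    case 0
    then show ?case using fixer_covered by simp
  next
    case (Suc n)
    have "covered G (carrier G) (fixer (Suc n) \<inter> \<Inter> (fixer ` {..n}))"
      using Suc fixer_covered fixer_subgroup by (intro covered_Int subgroups_Inter) auto
    then show ?case by (simp add: atMost_Suc)
  qed
  moreover have "central_part = \<Inter> (fixer ` {..k})"
    unfolding central_part_eq by (auto simp: fixer_def)
  ultimately show ?thesis using le_refl by metis
qed

text \<open>This is what Schur's lemma requires of the group: a vector has only countably many
  translates. Each cyclic factor multiplies by a countable set.\<close>

lemma countable_carrier: "countable (carrier G)"
proof -
  have "countable (N i)" if "i \<le> Suc k" for i
    using that
  proof (induction "Suc k - i" arbitrary: i)
    case 0
    then have "i = Suc k" by simp
    then show ?case using N_end by simp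
  next
    case (Suc d)
    have ik: "i \<le> k" using Suc(2) by simp
    have IH: "countable (N (Suc i))"
      by (rule Suc(1)) (use Suc(2) ik in auto)
    obtain x where x: "x \<in> N i" "\<forall>y\<in>N i. \<exists>n::int. y \<otimes> inv (x [^] n) \<in> N (Suc i)"
      using N_gen[OF ik] by blast
    have xG: "x \<in> carrier G" using N_carrier[OF _ x(1)] ik by auto
    have "N i \<subseteq> (\<lambda>(z, n::int). z \<otimes> x [^] n) ` (N (Suc i) \<times> UNIV)"
    proof
      fix y assume y: "y \<in> N i"
      then obtain n :: int where n: "y \<otimes> inv (x [^] n) \<in> N (Suc i)" using x(2) by blast
      have "y = (y \<otimes> inv (x [^] n)) \<otimes> x [^] n" using xG N_carrier[OF _ y] ik by (simp add: m_assoc)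
      then show "y \<in> (\<lambda>(z, n::int). z \<otimes> x [^] n) ` (N (Suc i) \<times> UNIV)" using n by force
    qed
    then show ?case using IH by (meson countable_SIGMA countable_image countable_subset countableI_type)
  qed
  from this[of 0] show ?thesis using N_0 by simp
qed

end

text \<open>The cyclic quotients of the definition are formed inside \<open>G\<close> restricted to
  \<open>N i\<close>. Lifting a generator of each to \<open>N i\<close> turns cyclicity into a
  statement about elements of \<open>G\<close> alone.\<close>

lemma supersolvable_imp_cyclic_series:
  assumes "supersolvable_group G"
  obtains k N where "cyclic_series G k N"
proof -
  from assms have G: "group G" unfolding supersolvable_group_def by (rule conjunct1)
  from assms obtain k N where *: "N 0 = carrier G \<and> N (Suc k) = {\<one>\<^bsub>G\<^esub>} \<and> (\<forall>i\<le>Suc k. N i \<lhd> G) \<and>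
        (\<forall>i\<le>k. N (Suc i) \<subseteq> N i \<and> cyclic_group ((G\<lparr>carrier := N i\<rparr>) Mod N (Suc i)))"
    unfolding supersolvable_group_def by (elim conjE exE) (rule that, intro conjI)
  then have N: "N 0 = carrier G" "N (Suc k) = {\<one>\<^bsub>G\<^esub>}"
    "\<And>i. i \<le> Suc k \<Longrightarrow> N i \<lhd> G" "\<And>i. i \<le> k \<Longrightarrow> N (Suc i) \<subseteq> N i"
    "\<And>i. i \<le> k \<Longrightarrow> cyclic_group ((G\<lparr>carrier := N i\<rparr>) Mod N (Suc i))"
    by simp_all
  interpret group G by fact
  have "\<exists>x\<in>N i. \<forall>y\<in>N i. \<exists>n::int. y \<otimes>\<^bsub>G\<^esub> inv\<^bsub>G\<^esub> (x [^]\<^bsub>G\<^esub> n) \<in> N (Suc i)" if i: "i \<le> k" for i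
  proof -
    let ?H = "G\<lparr>carrier := N i\<rparr>"
    have sub: "subgroup (N i) G" "subgroup (N (Suc i)) G"
      using N(3)[of i] N(3)[of "Suc i"] i normal_imp_subgroup by auto
    interpret H: group ?H using sub(1) by (rule subgroup_imp_group)
    have nor: "N (Suc i) \<lhd> ?H"
    proof (rule H.normal_invI)
      show "subgroup (N (Suc i)) ?H" using sub N(4)[OF i] by (intro subgroup_incl) auto
      fix x h assume x: "x \<in> carrier ?H" and h: "h \<in> N (Suc i)"
      have "x \<otimes>\<^bsub>G\<^esub> h \<otimes>\<^bsub>G\<^esub> inv\<^bsub>G\<^esub> x \<in> N (Suc i)"
        using normal.inv_op_closed2[OF N(3)] i x h sub by (auto dest: subgroup.mem_carrier)
      then show "x \<otimes>\<^bsub>?H\<^esub> h \<otimes>\<^bsub>?H\<^esub> inv\<^bsub>?H\<^esub> x \<in> N (Suc i)"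
        using x sub(1) by (simp add: m_inv_consistent)
    qed
    interpret Q: group "?H Mod N (Suc i)" using nor by (rule normal.factorgroup_is_group)
    interpret q: group_hom ?H "?H Mod N (Suc i)" "\<lambda>x. N (Suc i) #>\<^bsub>?H\<^esub> x"
      unfolding group_hom_def group_hom_axioms_def
      using normal.r_coset_hom_Mod[OF nor] H.group_axioms Q.group_axioms by blast
    obtain X where X: "X \<in> carrier (?H Mod N (Suc i))"
      "carrier (?H Mod N (Suc i)) = range (\<lambda>n::int. X [^]\<^bsub>?H Mod N (Suc i)\<^esub> n)"
      using N(5)[OF i] Q.cyclic_group by blast
    obtain x where x: "x \<in> N i" "X = N (Suc i) #>\<^bsub>?H\<^esub> x"
      using X(1) by (auto simp: FactGroup_def RCOSETS_def)
    have "\<exists>n::int. y \<otimes>\<^bsub>G\<^esub> inv\<^bsub>G\<^esub> (x [^]\<^bsub>G\<^esub> n) \<in> N (Suc i)" if y: "y \<in> N i" for y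
    proof -
      have "N (Suc i) #>\<^bsub>?H\<^esub> y \<in> carrier (?H Mod N (Suc i))"
        using y q.hom_closed by simp
      then obtain n :: int where n: "N (Suc i) #>\<^bsub>?H\<^esub> y = X [^]\<^bsub>?H Mod N (Suc i)\<^esub> n"
        unfolding X(2) by blast
      then have "N (Suc i) #>\<^bsub>?H\<^esub> y = N (Suc i) #>\<^bsub>?H\<^esub> (x [^]\<^bsub>?H\<^esub> n)"
        using x q.hom_int_pow[of x n] by simp
      then have "N (Suc i) #>\<^bsub>G\<^esub> y = N (Suc i) #>\<^bsub>G\<^esub> (x [^]\<^bsub>G\<^esub> n)"
        using int_pow_consistent[OF sub(1) x(1)] by (simp add: r_coset_def)
      moreover have yx: "y \<in> carrier G" "x [^]\<^bsub>G\<^esub> n \<in> carrier G"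
        using y x sub by (auto dest: subgroup.mem_carrier)
      ultimately have "y \<in> N (Suc i) #>\<^bsub>G\<^esub> (x [^]\<^bsub>G\<^esub> n)" using rcos_self[OF yx(1) sub(2)] by simp
      then have "y \<otimes>\<^bsub>G\<^esub> inv\<^bsub>G\<^esub> (x [^]\<^bsub>G\<^esub> n) \<in> N (Suc i)"
        using subgroup.rcos_module_imp[OF sub(2) group_axioms yx(2)] by simp
      then show ?thesis by blast
    qed
    then show ?thesis using x(1) by blast
  qed
  then have "cyclic_series G k N"
    using N G by (auto simp: cyclic_series_def cyclic_series_axioms_def)
  then show ?thesis using that by blast
qed

section \<open>Polynomials in an operator\<close>

text \<open>The operator needs to be linear on the subspace \<open>W\<close> only. It will be the
  action of one group element, a sum of powers of such actions on a weight space, or an endomorphism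
  of the representation.\<close>

locale complex_operator = vector_space scale
  for scale :: "complex \<Rightarrow> 'v::ab_group_add \<Rightarrow> 'v" +
  fixes W :: "'v set" and T :: "'v \<Rightarrow> 'v"
  assumes subspace_W: "subspace W"
    and T_closed: "w \<in> W \<Longrightarrow> T w \<in> W"
    and T_add: "\<lbrakk>v \<in> W; w \<in> W\<rbrakk> \<Longrightarrow> T (v + w) = T v + T w"
    and T_scale: "w \<in> W \<Longrightarrow> T (scale c w) = scale c (T w)"
begin

lemma T_zero: "T 0 = 0"
  using T_scale[of 0 0] subspace_0[OF subspace_W] by simp

text \<open>The vector \<open>p(T) v\<close> by Horner's scheme, which makes induction along
  \<open>pCons\<close> immediate.\<close>

definition peval :: "complex poly \<Rightarrow> 'v \<Rightarrow> 'v" where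
  "peval p v = fold_coeffs (\<lambda>a u. scale a v + T u) p 0"

lemma peval_0 [simp]: "peval 0 v = 0"
  by (simp add: peval_def)

lemma peval_pCons [simp]: "peval (pCons a p) v = scale a v + T (peval p v)"
  by (cases "p = 0 \<and> a = 0") (auto simp: peval_def T_zero)

lemma peval_closed: "v \<in> W \<Longrightarrow> peval p v \<in> W"
  by (induction p) (auto intro!: subspace_add[OF subspace_W] subspace_scale[OF subspace_W] T_closed
      simp: subspace_0[OF subspace_W])

lemma peval_add: "v \<in> W \<Longrightarrow> peval (p + q) v = peval p v + peval q v"
proof (induction p q rule: poly_induct2)
  case (pCons a p b q)
  then show ?case by (simp add: T_add peval_closed scale_left_distrib)
qed simp

lemma peval_smult: "v \<in> W \<Longrightarrow> peval (smult c p) v = scale c (peval p v)"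
  by (induction p) (auto simp: T_scale peval_closed scale_right_distrib)

lemma peval_sum: "v \<in> W \<Longrightarrow> peval (sum f A) v = (\<Sum>i\<in>A. peval (f i) v)"
  by (induction A rule: infinite_finite_induct) (auto simp: peval_add)

lemma peval_mult: "v \<in> W \<Longrightarrow> peval (p * q) v = peval p (peval q v)"
  by (induction p) (auto simp: peval_add peval_smult mult_pCons_left)

lemma peval_vadd: "v \<in> W \<Longrightarrow> w \<in> W \<Longrightarrow> peval p (v + w) = peval p v + peval p w"
  by (induction p) (auto simp: T_add peval_closed scale_right_distrib)

lemma peval_vscale: "v \<in> W \<Longrightarrow> peval p (scale c v) = scale c (peval p v)"
  by (induction p) (auto simp: T_scale T_zero peval_closed scale_right_distrib mult.commute)

lemma peval_vsum: "(\<And>i. i \<in> A \<Longrightarrow> f i \<in> W) \<Longrightarrow> peval p (sum f A) = (\<Sum>i\<in>A. peval p (f i))"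
proof (induction A rule: infinite_finite_induct)
  case (insert x A)
  then show ?case by (simp add: peval_vadd subspace_sum[OF subspace_W])
qed (use peval_vscale[of 0 p 0] subspace_0[OF subspace_W] in auto)

lemma peval_monom: "v \<in> W \<Longrightarrow> peval (monom c n) v = scale c ((T ^^ n) v)"
proof (induction n)
  case (Suc n)
  have "(T ^^ n) v \<in> W" using Suc(2) by (induction n) (auto intro: T_closed)
  then show ?case using Suc by (simp add: monom_Suc T_scale)
qed (simp add: monom_0 T_zero)

lemma peval_linear_factor: "peval [:-l, 1:] v = T v - scale l v"
  by (simp add: T_zero)

text \<open>Over \<complex> the polynomial has a root \<open>l\<close>. Writing \<open>p\<close> as
  the linear factor times \<open>q\<close>, either \<open>q\<close> annihilates \<open>v\<close>
  already and has smaller degree, or \<open>peval q v\<close> is an eigenvector for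
  \<open>l\<close>.\<close>

lemma eigenvector_of_annihilator:
  assumes "p \<noteq> 0" "v \<in> W" "v \<noteq> 0" "peval p v = 0"
  shows "\<exists>l. \<exists>w\<in>W. w \<noteq> 0 \<and> T w = scale l w \<and> (\<exists>q. w = peval q v)"
  using assms
proof (induction "degree p" arbitrary: p)
  case 0
  then obtain c where "p = [:c:]" "c \<noteq> 0" by (metis degree_0_id degree_eq_zeroE pCons_0_0)
  then show ?case using 0 by (auto simp: T_zero)
next
  case (Suc d)
  have "\<not> constant (poly p)" using Suc(2) by (simp add: constant_degree)
  then obtain l where "poly p l = 0" using fundamental_theorem_of_algebra by blast
  then obtain q where q: "p = [:-l, 1:] * q" unfolding poly_eq_0_iff_dvd dvd_def by blast
  have q0: "q \<noteq> 0" using Suc(3) unfolding q by (metis mult_zero_right)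
  show ?case
  proof (cases "peval q v = 0")
    case True
    have "degree p = 1 + degree q" using q q0 by (simp add: degree_mult_eq del: mult_pCons_left)
    then show ?thesis using Suc True q0 by auto
  next
    case False
    have "T (peval q v) - scale l (peval q v) = 0"
      using Suc(6) unfolding q peval_mult[OF Suc(4)] peval_linear_factor .
    then show ?thesis using False peval_closed[OF Suc(4)] by auto
  qed
qed

text \<open>A linear relation among the iterates of a nonzero vector is a polynomial that
  annihilates it. A repetition among the iterates is treated separately, because linear dependence
  is a property of a set of vectors and a repetition would be invisible there.\<close>

lemma eigenvector_of_finite_dim:
  assumes B: "finite B" "W \<subseteq> span B" and W: "W \<noteq> {0}"
  shows "\<exists>l. \<exists>w\<in>W. w \<noteq> 0 \<and> T w = scale l w"
proof -
  obtain v where v: "v \<in> W" "v \<noteq> 0" using W subspace_0[OF subspace_W] by blast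
  have TW: "(T ^^ n) v \<in> W" for n using v(1) by (induction n) (auto intro: T_closed)
  have "\<exists>p. p \<noteq> 0 \<and> peval p v = 0"
  proof (cases "inj (\<lambda>n. (T ^^ n) v)")
    case False
    then obtain m n where mn: "m < n" "(T ^^ m) v = (T ^^ n) v"
      unfolding inj_def by (metis linorder_neqE_nat)
    have "peval (monom 1 m + monom (-1) n) v = 0"
      using mn v by (simp add: peval_add peval_monom)
    moreover have "coeff (monom 1 m + monom (-1::complex) n) m = 1" using mn by simp
    then have "monom 1 m + monom (-1::complex) n \<noteq> 0" by force
    ultimately show ?thesis by blast
  next
    case True
    define S where "S = (\<lambda>n. (T ^^ n) v) ` {..card B}"
    have "card S = Suc (card B)" unfolding S_def
      using True by (subst card_image) (auto intro: inj_on_subset)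
    moreover have "S \<subseteq> span B" using TW B(2) by (auto simp: S_def)
    ultimately have "dependent S"
      using independent_span_bound[OF B(1), of S] by linarith
    then obtain u where u: "\<exists>w\<in>S. u w \<noteq> 0" "(\<Sum>w\<in>S. scale (u w) w) = 0"
      using dependent_finite[of S] by (auto simp: S_def)
    define p where "p = (\<Sum>n\<le>card B. monom (u ((T ^^ n) v)) n)"
    have "peval p v = (\<Sum>n\<le>card B. scale (u ((T ^^ n) v)) ((T ^^ n) v))"
      unfolding p_def using v by (simp add: peval_sum peval_monom)
    also have "\<dots> = (\<Sum>w\<in>S. scale (u w) w)"
      unfolding S_def using True by (subst sum.reindex) (auto intro: inj_on_subset)
    finally have "peval p v = 0" using u(2) by simp
    moreover have "p \<noteq> 0"
    proof -
      obtain n where n: "n \<le> card B" "u ((T ^^ n) v) \<noteq> 0" using u(1) by (auto simp: S_def)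
      have "coeff p n = u ((T ^^ n) v)" unfolding p_def using n(1)
        by (simp add: coeff_sum if_distrib sum.delta cong: if_cong)
      then show ?thesis using n(2) by auto
    qed
    ultimately show ?thesis by blast
  qed
  then show ?thesis using eigenvector_of_annihilator v by metis
qed

end

section \<open>Independent families of subspaces\<close>

context complex_rep
begin

lemma V_zero [simp]: "0 \<in> V"
  using subspace_0[OF subspace_V] .

lemma V_add: "v \<in> V \<Longrightarrow> w \<in> V \<Longrightarrow> v + w \<in> V"
  using subspace_add[OF subspace_V] .

lemma V_scale: "v \<in> V \<Longrightarrow> scale c v \<in> V"
  using subspace_scale[OF subspace_V] .

lemma V_sum: "(\<And>i. i \<in> F \<Longrightarrow> f i \<in> V) \<Longrightarrow> sum f F \<in> V"
  using subspace_sum[OF subspace_V] .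

lemma rep_zero [simp]: "g \<in> carrier G \<Longrightarrow> \<pi> g 0 = 0"
  using rep_scale[of g 0 0] by simp

lemma rep_neg: "g \<in> carrier G \<Longrightarrow> v \<in> V \<Longrightarrow> \<pi> g (- v) = - \<pi> g v"
  using rep_scale[of g v "-1"] by simp

lemma rep_diff: "g \<in> carrier G \<Longrightarrow> v \<in> V \<Longrightarrow> w \<in> V \<Longrightarrow> \<pi> g (v - w) = \<pi> g v - \<pi> g w"
  using rep_add[of g v "- w"] rep_neg subspace_neg[OF subspace_V] by simp

lemma rep_sum: "g \<in> carrier G \<Longrightarrow> (\<And>i. i \<in> F \<Longrightarrow> f i \<in> V) \<Longrightarrow> \<pi> g (sum f F) = (\<Sum>i\<in>F. \<pi> g (f i))"
proof (induction F rule: infinite_finite_induct)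
  case (insert x F)
  then show ?case by (simp add: rep_add V_sum)
qed auto

lemma rep_inv [simp]: "g \<in> carrier G \<Longrightarrow> v \<in> V \<Longrightarrow> \<pi> (inv g) (\<pi> g v) = v"
  using rep_mult[of "inv g" g v] rep_one by simp

lemma rep_inv' [simp]: "g \<in> carrier G \<Longrightarrow> v \<in> V \<Longrightarrow> \<pi> g (\<pi> (inv g) v) = v"
  using rep_mult[of g "inv g" v] rep_one by simp

lemma rep_inj: "g \<in> carrier G \<Longrightarrow> v \<in> V \<Longrightarrow> w \<in> V \<Longrightarrow> \<pi> g v = \<pi> g w \<longleftrightarrow> v = w"
  by (metis rep_inv)

lemma rep_eq_0: "g \<in> carrier G \<Longrightarrow> v \<in> V \<Longrightarrow> \<pi> g v = 0 \<longleftrightarrow> v = 0"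
  using rep_inj[of g v 0] by simp

definition act :: "'g \<Rightarrow> 'v set \<Rightarrow> 'v set" where
  "act g A = \<pi> g ` A"

definition orb :: "'g set \<Rightarrow> 'v set \<Rightarrow> 'v set set" where
  "orb L A = (\<lambda>g. act g A) ` L"

definition subsp :: "'v set \<Rightarrow> bool" where
  "subsp A \<longleftrightarrow> subspace A \<and> A \<subseteq> V"

definition invsub :: "'g set \<Rightarrow> 'v set \<Rightarrow> bool" where
  "invsub L X \<longleftrightarrow> subsp X \<and> (\<forall>g\<in>L. \<forall>x\<in>X. \<pi> g x \<in> X)"

lemma subsp_0: "subsp A \<Longrightarrow> 0 \<in> A"
  by (simp add: subsp_def subspace_0)

lemma subsp_span: "A \<subseteq> V \<Longrightarrow> subsp (span A)"
  using span_minimal[OF _ subspace_V] by (simp add: subsp_def)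

lemma act_mult: "g \<in> carrier G \<Longrightarrow> h \<in> carrier G \<Longrightarrow> A \<subseteq> V \<Longrightarrow> act g (act h A) = act (g \<otimes> h) A"
  by (force simp: act_def rep_mult)

lemma act_one: "A \<subseteq> V \<Longrightarrow> act \<one> A = A"
  by (force simp: act_def rep_one)

lemma act_inv [simp]: "g \<in> carrier G \<Longrightarrow> A \<subseteq> V \<Longrightarrow> act (inv g) (act g A) = A"
  by (simp add: act_mult act_one)

lemma act_inv' [simp]: "g \<in> carrier G \<Longrightarrow> A \<subseteq> V \<Longrightarrow> act g (act (inv g) A) = A"
  by (simp add: act_mult act_one)

lemma act_V: "g \<in> carrier G \<Longrightarrow> A \<subseteq> V \<Longrightarrow> act g A \<subseteq> V"
  by (auto simp: act_def rep_closed)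

lemma act_mono: "A \<subseteq> B \<Longrightarrow> act g A \<subseteq> act g B"
  by (auto simp: act_def)

lemma act_inj: "g \<in> carrier G \<Longrightarrow> A \<subseteq> V \<Longrightarrow> B \<subseteq> V \<Longrightarrow> act g A = act g B \<longleftrightarrow> A = B"
  by (metis act_inv)

lemma act_subsp: "g \<in> carrier G \<Longrightarrow> subsp A \<Longrightarrow> subsp (act g A)"
  unfolding subsp_def
proof (intro conjI, elim conjE)
  assume g: "g \<in> carrier G" and A: "subspace A" "A \<subseteq> V"
  show "subspace (act g A)"
  proof (rule subspaceI)
    show "0 \<in> act g A" using g subspace_0[OF A(1)] by (force simp: act_def)
  next
    fix x y assume "x \<in> act g A" "y \<in> act g A"
    then obtain a b where ab: "a \<in> A" "b \<in> A" "x = \<pi> g a" "y = \<pi> g b" by (auto simp: act_def)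
    then have "x + y = \<pi> g (a + b)" using rep_add[of g a b] g subsetD[OF A(2)] by simp
    then show "x + y \<in> act g A" using ab subspace_add[OF A(1)] by (auto simp: act_def)
  next
    fix c x assume "x \<in> act g A"
    then obtain a where a: "a \<in> A" "x = \<pi> g a" by (auto simp: act_def)
    then have "scale c x = \<pi> g (scale c a)" using rep_scale[of g a c] g subsetD[OF A(2)] by simp
    then show "scale c x \<in> act g A" using a subspace_scale[OF A(1)] by (auto simp: act_def)
  qed
qed (auto dest: act_V)

lemma act_span: 
  assumes g: "g \<in> carrier G" and A: "A \<subseteq> V"
  shows "act g (span A) = span (act g A)"
proof (rule subset_antisym)
  have 1: "span (act g A) \<subseteq> act g (span A)" if "g \<in> carrier G" "A \<subseteq> V" for g A
    using act_subsp[OF that(1) subsp_span[OF that(2)]] act_mono[OF span_superset]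
    by (intro span_minimal) (auto simp: subsp_def)
  show "span (act g A) \<subseteq> act g (span A)" using 1 g A .
  have "span (act (inv g) (act g A)) \<subseteq> act (inv g) (span (act g A))"
    using g A by (intro 1 act_V) auto
  then have "act g (span A) \<subseteq> act g (act (inv g) (span (act g A)))"
    using g A by (intro act_mono) simp
  also have "\<dots> = span (act g A)"
    using g subsp_span[OF act_V[OF g A]] by (simp add: subsp_def)
  finally show "act g (span A) \<subseteq> span (act g A)" .
qed

lemma act_Union: "act g (\<Union>\<A>) = \<Union>(act g ` \<A>)"
  by (auto simp: act_def)

lemma invsub_act: "invsub L X \<Longrightarrow> g \<in> L \<Longrightarrow> act g X \<subseteq> X"
  by (auto simp: act_def invsub_def)

lemma invsub_act_eq:
  assumes "invsub L X" "subgroup L G" "g \<in> L"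
  shows "act g X = X"
proof
  show "act g X \<subseteq> X" using assms invsub_act by blast
  have "act (inv g) X \<subseteq> X" using assms invsub_act subgroup.m_inv_closed by metis
  then have "act g (act (inv g) X) \<subseteq> act g X" by (rule act_mono)
  moreover have "g \<in> carrier G" using assms subgroup.mem_carrier by metis
  ultimately show "X \<subseteq> act g X" using assms by (simp add: invsub_def subsp_def)
qed

lemma orb_V: "L \<subseteq> carrier G \<Longrightarrow> A \<subseteq> V \<Longrightarrow> \<Union>(orb L A) \<subseteq> V"
proof (rule Union_least)
  fix B assume "L \<subseteq> carrier G" "A \<subseteq> V" "B \<in> orb L A"
  then show "B \<subseteq> V" using act_V[of _ A] by (auto simp: orb_def)
qed

lemma orb_subsp: "L \<subseteq> carrier G \<Longrightarrow> subsp A \<Longrightarrow> B \<in> orb L A \<Longrightarrow> subsp B"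
  using act_subsp by (auto simp: orb_def)

lemma orb_act_right:
  assumes "subgroup L G" "g \<in> L" "A \<subseteq> V"
  shows "orb L (act g A) = orb L A"
proof
  have LG: "L \<subseteq> carrier G" using assms(1) by (rule subgroup.subset)
  then have gG: "g \<in> carrier G" using assms(2) by auto
  show "orb L (act g A) \<subseteq> orb L A"
    using assms LG gG by (auto simp: orb_def act_mult subset_iff subgroup.m_closed)
  show "orb L A \<subseteq> orb L (act g A)"
  proof
    fix B assume "B \<in> orb L A"
    then obtain h where h: "h \<in> L" "B = act h A" by (auto simp: orb_def)
    have hG: "h \<in> carrier G" using h LG by auto
    have "B = act (h \<otimes> inv g) (act g A)"
      using h hG gG assms(3) by (simp add: act_mult m_assoc)
    moreover have "h \<otimes> inv g \<in> L"
      using h assms by (simp add: subgroup.m_closed subgroup.m_inv_closed)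
    ultimately show "B \<in> orb L (act g A)" by (auto simp: orb_def)
  qed
qed

lemma orb_act_left:
  assumes "subgroup L G" "g \<in> L" "A \<subseteq> V"
  shows "act g ` orb L A = orb L A"
proof
  have LG: "L \<subseteq> carrier G" using assms(1) by (rule subgroup.subset)
  then have gG: "g \<in> carrier G" using assms(2) by auto
  show "act g ` orb L A \<subseteq> orb L A"
    using assms LG gG by (auto simp: orb_def act_mult subset_iff subgroup.m_closed)
  show "orb L A \<subseteq> act g ` orb L A"
  proof
    fix B assume "B \<in> orb L A"
    then obtain h where h: "h \<in> L" "B = act h A" by (auto simp: orb_def)
    have hG: "h \<in> carrier G" using h LG by auto
    have "B = act g (act (inv g \<otimes> h) A)"
      using h hG gG assms(3) by (simp add: act_mult) (simp flip: m_assoc)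
    moreover have "inv g \<otimes> h \<in> L"
      using h assms by (simp add: subgroup.m_closed subgroup.m_inv_closed)
    ultimately show "B \<in> act g ` orb L A" by (auto simp: orb_def)
  qed
qed

lemma span_orb_invsub:
  assumes "subgroup L G" "A \<subseteq> V"
  shows "invsub L (span (\<Union>(orb L A)))"
proof -
  have LG: "L \<subseteq> carrier G" using assms(1) by (rule subgroup.subset)
  have sub: "\<Union>(orb L A) \<subseteq> V" using orb_V LG assms(2) .
  have "act g (span (\<Union>(orb L A))) = span (\<Union>(orb L A))" if g: "g \<in> L" for g
  proof -
    have "act g (span (\<Union>(orb L A))) = span (act g (\<Union>(orb L A)))"
      using g LG sub by (intro act_span) auto
    also have "act g (\<Union>(orb L A)) = \<Union>(orb L A)"
      unfolding act_Union using orb_act_left[OF assms(1) g assms(2)] by simp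
    finally show ?thesis .
  qed
  then show ?thesis using subsp_span[OF sub] by (auto simp: invsub_def act_def)
qed

lemma orb_self: "subgroup L G \<Longrightarrow> A \<subseteq> V \<Longrightarrow> A \<in> orb L A"
  unfolding orb_def using act_one[of A] subgroup.one_closed[of L G] by (metis imageI)

text \<open>For subspaces: their sum is direct. The family is a set, so that translates that
  coincide count once, as an orbit requires.\<close>

definition indep :: "'v set set \<Rightarrow> bool" where
  "indep \<A> \<longleftrightarrow> (\<forall>F f. finite F \<and> F \<subseteq> \<A> \<and> (\<forall>A\<in>F. f A \<in> A) \<and> sum f F = 0 \<longrightarrow> (\<forall>A\<in>F. f A = 0))"

lemma indepD: "\<lbrakk>indep \<A>; finite F; F \<subseteq> \<A>; \<And>A. A \<in> F \<Longrightarrow> f A \<in> A; sum f F = 0; A \<in> F\<rbrakk> \<Longrightarrow> f A = 0"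
  by (auto simp: indep_def)

lemma indepI: "(\<And>F f A. \<lbrakk>finite F; F \<subseteq> \<A>; \<And>A. A \<in> F \<Longrightarrow> f A \<in> A; sum f F = 0; A \<in> F\<rbrakk> \<Longrightarrow> f A = 0) \<Longrightarrow> indep \<A>"
  unfolding indep_def by blast

lemma indep_mono: "indep \<B> \<Longrightarrow> \<A> \<subseteq> \<B> \<Longrightarrow> indep \<A>"
  by (auto simp: indep_def)

lemma indep_unique:
  assumes ind: "indep \<A>" and sub: "\<And>A. A \<in> \<A> \<Longrightarrow> subsp A"
    and F: "finite F" "F \<subseteq> \<A>" "\<And>A. A \<in> F \<Longrightarrow> f A \<in> A"
    and F': "finite F'" "F' \<subseteq> \<A>" "\<And>A. A \<in> F' \<Longrightarrow> f' A \<in> A"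
    and eq: "sum f F = sum f' F'"
  shows "A \<in> F \<Longrightarrow> A \<in> F' \<Longrightarrow> f A = f' A" "A \<in> F \<Longrightarrow> A \<notin> F' \<Longrightarrow> f A = 0"
    "A \<in> F' \<Longrightarrow> A \<notin> F \<Longrightarrow> f' A = 0"
proof -
  define d where "d A = (if A \<in> F then f A else 0) - (if A \<in> F' then f' A else 0)" for A
  have "(\<Sum>A\<in>F \<union> F'. if A \<in> F then f A else 0) = sum f F"
    using F(1) F'(1) by (intro sum.mono_neutral_cong_right) auto
  moreover have "(\<Sum>A\<in>F \<union> F'. if A \<in> F' then f' A else 0) = sum f' F'"
    using F(1) F'(1) by (intro sum.mono_neutral_cong_right) auto
  ultimately have "sum d (F \<union> F') = 0" unfolding d_def by (simp add: sum_subtractf eq)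
  moreover have "d A \<in> A" if "A \<in> F \<union> F'" for A
  proof -
    have "subspace A" using sub that F(2) F'(2) by (auto simp: subsp_def)
    then show ?thesis unfolding d_def
      using F(3) F'(3) by (intro subspace_diff) (auto simp: subspace_0)
  qed
  ultimately have "d A = 0" if "A \<in> F \<union> F'" for A
    using indepD[OF ind, of "F \<union> F'" d A] F F' that by auto
  then show "A \<in> F \<Longrightarrow> A \<in> F' \<Longrightarrow> f A = f' A" "A \<in> F \<Longrightarrow> A \<notin> F' \<Longrightarrow> f A = 0"
    "A \<in> F' \<Longrightarrow> A \<notin> F \<Longrightarrow> f' A = 0"
    by (auto simp: d_def) (metis UnI1 UnI2 eq_iff_diff_eq_0 diff_0_right diff_0 neg_0_equal_iff_equal)+
qed

lemma indep_act:
  assumes ind: "indep \<A>" and g: "g \<in> carrier G" and sub: "\<And>A. A \<in> \<A> \<Longrightarrow> A \<subseteq> V"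
  shows "indep (act g ` \<A>)"
proof (rule indepI)
  fix F f A
  assume F: "finite F" "F \<subseteq> act g ` \<A>" "\<And>A. A \<in> F \<Longrightarrow> f A \<in> A" "sum f F = 0" "A \<in> F"
  have FV: "B \<subseteq> V" if "B \<in> F" for B using that F(2) sub act_V[OF g] by blast
  then have fV: "f B \<in> V" if "B \<in> F" for B using F(3) that by blast
  define f' where "f' B = \<pi> (inv g) (f (act g B))" for B
  have inj: "inj_on (act (inv g)) F" using FV act_inj[of "inv g"] g by (auto simp: inj_on_def)
  have gB: "act g (act (inv g) B) = B" if "B \<in> F" for B using FV that g by simp
  have "sum f' (act (inv g) ` F) = (\<Sum>B\<in>F. \<pi> (inv g) (f B))"
    using gB by (simp add: sum.reindex[OF inj] f'_def)
  also have "\<dots> = 0" using F(4) fV g by (simp flip: rep_sum)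
  finally have s: "sum f' (act (inv g) ` F) = 0" .
  have "f' (act (inv g) A) = 0"
  proof (rule indepD[OF ind _ _ _ s])
    show "finite (act (inv g) ` F)" using F(1) by simp
    show "act (inv g) ` F \<subseteq> \<A>" using F(2) sub g by auto
    show "f' B \<in> B" if "B \<in> act (inv g) ` F" for B
    proof -
      from that obtain C where C: "B = act (inv g) C" "C \<in> F" by (rule imageE)
      then have "f' B = \<pi> (inv g) (f C)" using gB by (simp add: f'_def)
      then show ?thesis using F(3)[OF C(2)] C(1) by (auto simp: act_def)
    qed
    show "act (inv g) A \<in> act (inv g) ` F" using F(5) by simp
  qed
  then have "\<pi> (inv g) (f A) = 0" using gB F(5) by (simp add: f'_def)
  then show "f A = 0" using rep_eq_0[of "inv g" "f A"] fV F(5) g by simp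
qed

text \<open>Directness can be checked in two stages. A vanishing sum is collected along the blocks
  \<open>\<kappa> A\<close>; each partial sum is 0 because the blocks are independent, and then each
  term is 0 because the members inside one block are.\<close>

lemma indep_group:
  assumes ind: "indep \<B>" and sub: "\<And>B. B \<in> \<B> \<Longrightarrow> subsp B"
    and cov: "\<And>A. A \<in> \<A> \<Longrightarrow> \<exists>B\<in>\<B>. A \<subseteq> B"
    and loc: "\<And>B. B \<in> \<B> \<Longrightarrow> indep {A \<in> \<A>. A \<subseteq> B}"
  shows "indep \<A>"
proof (rule indepI)
  fix F f A
  assume F: "finite F" "F \<subseteq> \<A>" "\<And>A. A \<in> F \<Longrightarrow> f A \<in> A" "sum f F = 0" "A \<in> F"
  define \<kappa> where "\<kappa> A = (SOME B. B \<in> \<B> \<and> A \<subseteq> B)" for A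
  have \<kappa>: "\<kappa> A \<in> \<B> \<and> A \<subseteq> \<kappa> A" if "A \<in> \<A>" for A
    unfolding \<kappa>_def using cov[OF that] someI_ex[of "\<lambda>B. B \<in> \<B> \<and> A \<subseteq> B"] by blast
  define h where "h B = (\<Sum>A\<in>{A \<in> F. \<kappa> A = B}. f A)" for B
  have "sum h (\<kappa> ` F) = 0" unfolding h_def using F(1,4) by (simp add: sum.group)
  moreover have "h B \<in> B" if "B \<in> \<kappa> ` F" for B
  proof -
    have "subspace B" using that \<kappa> F(2) sub by (auto simp: subsp_def)
    then show ?thesis unfolding h_def
      using F(2,3) \<kappa> by (intro subspace_sum) auto
  qed
  ultimately have "h (\<kappa> A) = 0"
    using indepD[OF ind, of "\<kappa> ` F" h "\<kappa> A"] F \<kappa> by auto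
  then have h0: "sum f {C \<in> F. \<kappa> C = \<kappa> A} = 0" unfolding h_def .
  have "indep {C \<in> \<A>. C \<subseteq> \<kappa> A}" using loc \<kappa> F(2,5) by blast
  then show "f A = 0"
  proof (rule indepD[OF _ _ _ _ h0])
    show "{C \<in> F. \<kappa> C = \<kappa> A} \<subseteq> {C \<in> \<A>. C \<subseteq> \<kappa> A}"
    proof
      fix C assume "C \<in> {C \<in> F. \<kappa> C = \<kappa> A}"
      then show "C \<in> {C \<in> \<A>. C \<subseteq> \<kappa> A}" using \<kappa>[of C] F(2) by auto
    qed
  qed (use F(1,3,5) in auto)
qed

lemma span_UN:
  assumes sub: "\<And>i. i \<in> I \<Longrightarrow> subspace (E i)" and x: "x \<in> span (\<Union>i\<in>I. E i)"
  shows "\<exists>F f. finite F \<and> F \<subseteq> I \<and> (\<forall>i\<in>F. f i \<in> E i) \<and> x = sum f F"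
  using x
proof (induction rule: span_induct_alt)
  case base
  show ?case by (rule exI[of _ "{}"]) auto
next
  case (step c a y)
  then obtain F f where F: "finite F" "F \<subseteq> I" "\<forall>i\<in>F. f i \<in> E i" "y = sum f F" by blast
  obtain i where i: "i \<in> I" "a \<in> E i" using step by auto
  define f' where "f' j = (if j \<in> F then f j else 0) + (if j = i then scale c a else 0)" for j
  have "sum f' (insert i F) = scale c a + y"
  proof -
    have "(\<Sum>j\<in>insert i F. if j \<in> F then f j else 0) = sum f F"
      using F(1) by (intro sum.mono_neutral_cong_right) auto
    moreover have "(\<Sum>j\<in>insert i F. if j = i then scale c a else 0) = scale c a"
      using F(1) by (simp add: sum.delta')
    ultimately show ?thesis unfolding f'_def by (simp add: sum.distrib F(4))
  qed
  moreover have "f' j \<in> E j" if "j \<in> insert i F" for j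
  proof -
    have "subspace (E j)" using sub that F(2) i(1) by auto
    then show ?thesis unfolding f'_def
      using F(3) i(2) by (intro subspace_add) (auto simp: subspace_0 subspace_scale)
  qed
  ultimately show ?case using F(1,2) i(1)
    by (intro exI[of _ "insert i F"] exI[of _ f']) auto
qed

lemma span_Union:
  assumes sub: "\<And>A. A \<in> \<A> \<Longrightarrow> subsp A" and x: "x \<in> span (\<Union>\<A>)"
  obtains F f where "finite F" "F \<subseteq> \<A>" "\<And>A. A \<in> F \<Longrightarrow> f A \<in> A" "x = sum f F"
proof -
  have "\<exists>F f. finite F \<and> F \<subseteq> \<A> \<and> (\<forall>i\<in>F. f i \<in> i) \<and> x = sum f F"
    using span_UN[of \<A> "\<lambda>A. A" x] assms by (simp add: subsp_def)
  then show ?thesis using that by metis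
qed

end

section \<open>Commensurability classes of eigenvectors\<close>

context group
begin

lemma cj_cj: "g \<in> carrier G \<Longrightarrow> h \<in> carrier G \<Longrightarrow> P \<subseteq> carrier G \<Longrightarrow> cj g (cj h P) = cj (g \<otimes> h) P"
proof -
  assume g: "g \<in> carrier G" and h: "h \<in> carrier G" and P: "P \<subseteq> carrier G"
  have "g \<otimes> (h \<otimes> x \<otimes> inv h) \<otimes> inv g = g \<otimes> h \<otimes> x \<otimes> inv (g \<otimes> h)" if "x \<in> P" for x
    using g h subsetD[OF P that] by (simp add: m_assoc inv_mult_group)
  then show ?thesis unfolding cj_def image_image by (intro image_cong) auto
qed

lemma cj_one: "P \<subseteq> carrier G \<Longrightarrow> cj \<one> P = P"
  by (force simp: cj_def)

lemma cj_carrier: "g \<in> carrier G \<Longrightarrow> P \<subseteq> carrier G \<Longrightarrow> cj g P \<subseteq> carrier G"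
  by (auto simp: cj_def)

lemma cj_mono: "P \<subseteq> Q \<Longrightarrow> cj g P \<subseteq> cj g Q"
  by (auto simp: cj_def)

end

context complex_rep
begin

definition lstab2 :: "'v \<Rightarrow> 'v \<Rightarrow> 'g set" where
  "lstab2 u v = {g \<in> carrier G. \<exists>c. \<pi> g u = scale c u \<and> \<pi> g v = scale c v}"

abbreviation lstab :: "'v \<Rightarrow> 'g set" where
  "lstab u \<equiv> lstab2 u u"

text \<open>
  Since \<open>lstab2 u v\<close> consists of the elements with the same eigenvalue on \<open>u\<close> and \<open>v\<close>, a vector \<open>v\<close>
  belongs to \<open>cls u\<close> if the two characters agree on a subgroup of finite index.
\<close>

definition cls :: "'v \<Rightarrow> 'v set" where
  "cls u = {v \<in> V. covered G (lstab u) (lstab2 u v)}"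

lemma eigenvalue_inv:
  assumes "g \<in> carrier G" "u \<in> V" "u \<noteq> 0" "\<pi> g u = scale c u"
  shows "c \<noteq> 0"
  using assms rep_eq_0[of g u] by auto

lemma eigenvector_inv:
  assumes "g \<in> carrier G" "v \<in> V" "c \<noteq> 0" "\<pi> g v = scale c v"
  shows "\<pi> (inv g) v = scale (inverse c) v"
proof -
  have "v = scale c (\<pi> (inv g) v)" using assms rep_inv[of g v] rep_scale[of "inv g" v c] by simp
  then have "scale (inverse c) v = scale (inverse c * c) (\<pi> (inv g) v)" by (metis scale_scale)
  then show ?thesis using assms by simp
qed

lemma lstab2_subgroup:
  assumes u: "u \<in> V" "u \<noteq> 0" and v: "v \<in> V"
  shows "subgroup (lstab2 u v) G"
proof (rule subgroupI)
  show "lstab2 u v \<subseteq> carrier G" by (auto simp: lstab2_def)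
  have "\<one> \<in> lstab2 u v" using u v rep_one by (auto simp: lstab2_def intro!: exI[of _ 1])
  then show "lstab2 u v \<noteq> {}" by auto
next
  fix g assume "g \<in> lstab2 u v"
  then obtain c where g: "g \<in> carrier G" "\<pi> g u = scale c u" "\<pi> g v = scale c v" by (auto simp: lstab2_def)
  have "c \<noteq> 0" using eigenvalue_inv g u by blast
  then show "inv g \<in> lstab2 u v" using g u v eigenvector_inv by (auto simp: lstab2_def)
next
  fix g h assume "g \<in> lstab2 u v" "h \<in> lstab2 u v"
  then obtain c d where g: "g \<in> carrier G" "\<pi> g u = scale c u" "\<pi> g v = scale c v"
    and h: "h \<in> carrier G" "\<pi> h u = scale d u" "\<pi> h v = scale d v" by (auto simp: lstab2_def)
  have "\<pi> (g \<otimes> h) u = scale (d * c) u" "\<pi> (g \<otimes> h) v = scale (d * c) v"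
    using g h u v rep_mult rep_scale by (simp_all)
  then show "g \<otimes> h \<in> lstab2 u v" using g h by (auto simp: lstab2_def)
qed

lemma lstab2_carrier: "lstab2 u v \<subseteq> carrier G"
  by (auto simp: lstab2_def)

lemma lstab2_sym: "lstab2 u v = lstab2 v u"
  by (auto simp: lstab2_def)

lemma lstab2_le: "lstab2 u v \<subseteq> lstab u"
  by (auto simp: lstab2_def)

text \<open>The eigenvalue on the nonzero vector \<open>u\<close> is unique, so the scalars on
  \<open>v\<close> and on \<open>w\<close> are the same.\<close>

lemma lstab2_Int_trans:
  assumes "u \<noteq> 0"
  shows "lstab2 u v \<inter> lstab2 u w \<subseteq> lstab2 v w"
  using assms by (auto simp: lstab2_def)

lemma lstab2_Int_add:
  assumes "u \<noteq> 0" "v \<in> V" "w \<in> V"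
  shows "lstab2 u v \<inter> lstab2 u w \<subseteq> lstab2 u (v + w)"
  using assms by (auto simp: lstab2_def rep_add scale_right_distrib)

lemma lstab2_scale:
  assumes "v \<in> V"
  shows "lstab2 u v \<subseteq> lstab2 u (scale c v)"
  using assms by (auto simp: lstab2_def rep_scale mult.commute)

lemma lstab_scale:
  assumes u: "u \<in> V" and c: "c \<noteq> 0"
  shows "lstab2 (scale c u) v = lstab2 u v"
proof -
  have "\<pi> x (scale c u) = scale a (scale c u) \<longleftrightarrow> \<pi> x u = scale a u" if "x \<in> carrier G" for x a
  proof -
    have "scale a (scale c u) = scale c (scale a u)" by (rule scale_left_commute)
    then show ?thesis using rep_scale[OF that u] c by (simp del: scale_scale)
  qed
  then show ?thesis unfolding lstab2_def by blast
qed

lemma cls_subsp: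
  assumes u: "u \<in> V" "u \<noteq> 0"
  shows "subsp (cls u)"
  unfolding subsp_def
proof
  show "subspace (cls u)"
  proof (rule subspaceI)
    have "lstab u \<subseteq> lstab2 u 0" by (auto simp: lstab2_def)
    then show "0 \<in> cls u" unfolding cls_def using covered_subset[OF _ lstab2_carrier] by simp
  next
    fix v w assume vw: "v \<in> cls u" "w \<in> cls u"
    then have V: "v \<in> V" "w \<in> V" by (auto simp: cls_def)
    have "covered G (lstab u) (lstab2 u v \<inter> lstab2 u w)"
      using vw V u by (intro covered_Int lstab2_subgroup) (auto simp: cls_def)
    then have "covered G (lstab u) (lstab2 u (v + w))"
      by (rule covered_mono) (use lstab2_Int_add u V in auto)
    then show "v + w \<in> cls u" using V by (simp add: cls_def V_add)
  next
    fix c v assume v: "v \<in> cls u"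
    then have "v \<in> V" "covered G (lstab u) (lstab2 u v)" by (auto simp: cls_def)
    then show "scale c v \<in> cls u"
      using covered_mono[OF _ subset_refl lstab2_scale[of v u c]] by (simp add: cls_def V_scale)
  qed
qed (auto simp: cls_def)

lemma cls_self: "u \<in> V \<Longrightarrow> u \<in> cls u"
  using covered_subset[OF subset_refl lstab2_carrier] by (auto simp: cls_def)

lemma lstab2_rep:
  assumes g: "g \<in> carrier G" and u: "u \<in> V" and v: "v \<in> V"
  shows "lstab2 (\<pi> g u) (\<pi> g v) = cj g (lstab2 u v)"
proof -
  have "x \<in> lstab2 (\<pi> g u) (\<pi> g v) \<longleftrightarrow> inv g \<otimes> x \<otimes> g \<in> lstab2 u v" if x: "x \<in> carrier G" for x
  proof -
    have "\<pi> x (\<pi> g w) = scale c (\<pi> g w) \<longleftrightarrow> \<pi> (inv g \<otimes> x \<otimes> g) w = scale c w" if w: "w \<in> V" for w c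
    proof -
      have "\<pi> (inv g \<otimes> x \<otimes> g) w = \<pi> (inv g) (\<pi> x (\<pi> g w))"
        using g x w by (simp add: rep_mult rep_closed)
      moreover have "scale c w = \<pi> (inv g) (scale c (\<pi> g w))"
        using g w by (simp add: rep_scale rep_closed)
      ultimately show ?thesis
        using g x w rep_inj[of "inv g" "\<pi> x (\<pi> g w)" "scale c (\<pi> g w)"] by (simp add: rep_closed V_scale)
    qed
    then show ?thesis using g x u v by (simp add: lstab2_def)
  qed
  then show ?thesis
    using mem_cj[OF g lstab2_carrier[of u v]] lstab2_carrier[of "\<pi> g u" "\<pi> g v"] by blast
qed

text \<open>Translating both vectors conjugates \<open>lstab2 u v\<close>, and finite index survives
  conjugation. Hence an orbit of a class consists of classes, to which disjointness applies.\<close>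

lemma act_cls:
  assumes g: "g \<in> carrier G" and u: "u \<in> V"
  shows "act g (cls u) = cls (\<pi> g u)"
proof
  have sub: "act g (cls u) \<subseteq> cls (\<pi> g u)" if "g \<in> carrier G" "u \<in> V" for g u
  proof
    fix x assume "x \<in> act g (cls u)"
    then obtain v where v: "v \<in> V" "covered G (lstab u) (lstab2 u v)" "x = \<pi> g v"
      by (auto simp: act_def cls_def)
    then show "x \<in> cls (\<pi> g u)"
      using covered_cj[OF that(1) lstab2_carrier v(2)] that by (simp add: cls_def lstab2_rep rep_closed)
  qed
  show "act g (cls u) \<subseteq> cls (\<pi> g u)" using sub g u .
  have "act (inv g) (cls (\<pi> g u)) \<subseteq> cls u" using sub[of "inv g" "\<pi> g u"] g u by (simp add: rep_closed)
  then have "act g (act (inv g) (cls (\<pi> g u))) \<subseteq> act g (cls u)" by (rule act_mono)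
  then show "cls (\<pi> g u) \<subseteq> act g (cls u)" using g by (simp add: cls_def)
qed

lemma cls_scale:
  assumes "u \<in> V" "c \<noteq> 0"
  shows "cls (scale c u) = cls u"
proof -
  have "lstab2 (scale c u) (scale c u) = lstab u"
    using assms lstab_scale lstab2_sym by metis
  then show ?thesis using assms by (simp add: cls_def lstab_scale)
qed

end

section \<open>Maximal vectors and the layers between their cores and the group\<close>

locale series_rep = complex_rep G scale V \<pi> + cyclic_series G k N
  for G :: "('g, 'm) monoid_scheme" (structure)
    and scale :: "complex \<Rightarrow> 'v::ab_group_add \<Rightarrow> 'v" and V \<pi> k N
begin

definition maximal :: "'v \<Rightarrow> bool" where
  "maximal u \<longleftrightarrow> u \<in> V \<and> u \<noteq> 0 \<and>
     (\<forall>w\<in>V. w \<noteq> 0 \<longrightarrow> card (jumps (lstab w)) \<le> card (jumps (lstab u)))"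

lemma maximal_exists:
  assumes "V \<noteq> {0}"
  shows "\<exists>u. maximal u"
proof -
  obtain v where v: "v \<in> V \<and> v \<noteq> 0" using assms by auto
  have "\<forall>y. y \<in> V \<and> y \<noteq> 0 \<longrightarrow> card (jumps (lstab y)) < Suc (Suc k)"
    using jumps_card le_imp_less_Suc by blast
  then have "\<exists>x. (x \<in> V \<and> x \<noteq> 0) \<and> (\<forall>y. y \<in> V \<and> y \<noteq> 0 \<longrightarrow> card (jumps (lstab y)) \<le> card (jumps (lstab x)))"
    using ex_has_greatest_nat[of "\<lambda>v. v \<in> V \<and> v \<noteq> 0" v "\<lambda>w. card (jumps (lstab w))"] v by blast
  then show ?thesis unfolding maximal_def by blast
qed

text \<open>Virtual containment can only add jumps, and maximality of \<open>u\<close> bounds their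
  number. So the jumps agree, which makes the two groups commensurable.\<close>

lemma maximal_covered:
  assumes u: "maximal u" and w: "w \<in> V" "w \<noteq> 0" and c: "covered G (lstab u) (lstab w)"
  shows "covered G (lstab w) (lstab u)" "maximal w"
proof -
  have uV: "u \<in> V" "u \<noteq> 0" using u by (auto simp: maximal_def)
  have sub: "subgroup (lstab u) G" "subgroup (lstab w) G" using uV w lstab2_subgroup by auto
  have J: "jumps (lstab u) \<subseteq> jumps (lstab w)" using jumps_mono[OF sub c] .
  moreover have "card (jumps (lstab w)) \<le> card (jumps (lstab u))" using u w by (simp add: maximal_def)
  ultimately have eq: "jumps (lstab u) = jumps (lstab w)"
    using jumps_finite card_subset_eq[of "jumps (lstab w)" "jumps (lstab u)"] card_mono by (metis le_antisym)
  show "covered G (lstab w) (lstab u)" using covered_of_jumps[OF sub c] eq by simp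
  show "maximal w" using u w eq by (simp add: maximal_def)
qed

text \<open>This is the purpose of maximality. It makes \<open>lstab u\<close> and
  \<open>lstab v\<close> commensurable, so that agreement of characters up to finite index becomes
  symmetric, and then classes are equivalence classes together with 0.\<close>

lemma cls_eq:
  assumes u: "maximal u" and v: "v \<in> cls u" "v \<noteq> 0"
  shows "maximal v" "cls v = cls u"
proof -
  have sub: "maximal v \<and> u \<in> cls v \<and> cls u \<subseteq> cls v" if u: "maximal u" and v: "v \<in> cls u" "v \<noteq> 0" for u v
  proof -
    have uV: "u \<in> V" "u \<noteq> 0" using u by (auto simp: maximal_def)
    have vV: "v \<in> V" and uv: "covered G (lstab u) (lstab2 u v)" using v by (auto simp: cls_def)
    have "covered G (lstab u) (lstab v)"
      by (rule covered_mono[OF uv subset_refl]) (auto simp: lstab2_def)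
    then have vu: "covered G (lstab v) (lstab u)" and "maximal v"
      using maximal_covered[OF u vV v(2)] by auto
    moreover have "w \<in> cls v" if w: "w \<in> cls u" for w
    proof -
      have wV: "w \<in> V" and uw: "covered G (lstab u) (lstab2 u w)" using w by (auto simp: cls_def)
      have "covered G (lstab u) (lstab2 u v \<inter> lstab2 u w)"
        using uv uw uV vV wV by (intro covered_Int lstab2_subgroup)
      then have "covered G (lstab u) (lstab2 v w)"
        by (rule covered_mono[OF _ subset_refl]) (use lstab2_Int_trans uV in auto)
      then have "covered G (lstab v) (lstab2 v w)"
        using vu lstab2_carrier by (intro covered_trans[OF vu])
      then show ?thesis using wV by (simp add: cls_def)
    qed
    ultimately show ?thesis using cls_self uV by blast
  qed
  show "maximal v" using sub[OF u v] by blast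
  have "u \<noteq> 0" using u by (simp add: maximal_def)
  then show "cls v = cls u" using sub[OF u v] sub[of v u] by blast
qed

lemma cls_disjoint:
  assumes "maximal u" "maximal u'" "v \<in> cls u" "v \<in> cls u'" "v \<noteq> 0"
  shows "cls u = cls u'"
  using cls_eq(2) assms by metis

lemma jumps_cj:
  assumes g: "g \<in> carrier G" and P: "P \<subseteq> carrier G"
  shows "jumps (cj g P) = jumps P"
proof
  have cjN: "cj g (P \<inter> N i) = cj g P \<inter> N i" if g: "g \<in> carrier G" and P: "P \<subseteq> carrier G" and i: "i \<le> Suc k" for g P i
  proof
    show "cj g (P \<inter> N i) \<subseteq> cj g P \<inter> N i" using N_conj[OF i _ g] by (auto simp: cj_def)
    show "cj g P \<inter> N i \<subseteq> cj g (P \<inter> N i)"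
    proof
      fix x assume x: "x \<in> cj g P \<inter> N i"
      then have "inv g \<otimes> x \<otimes> g \<in> P \<inter> N i" "x \<in> carrier G"
        using N_conj'[OF i _ g] mem_cj[OF g P] by auto
      then show "x \<in> cj g (P \<inter> N i)" using mem_cj[OF g, of "P \<inter> N i"] P by auto
    qed
  qed
  have sub: "jumps (cj g P) \<subseteq> jumps P" if g: "g \<in> carrier G" and P: "P \<subseteq> carrier G" for g P
  proof
    fix i assume i: "i \<in> jumps (cj g P)"
    then have ik: "i \<le> k" by (simp add: jumps_def)
    show "i \<in> jumps P"
    proof (rule ccontr)
      assume "i \<notin> jumps P"
      then have "covered G (P \<inter> N i) (P \<inter> N (Suc i))" using ik by (simp add: jumps_def)
      then have "covered G (cj g (P \<inter> N i)) (cj g (P \<inter> N (Suc i)))"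
        using P by (intro covered_cj[OF g]) auto
      then show False using i ik cjN[OF g P] by (simp add: jumps_def)
    qed
  qed
  show "jumps (cj g P) \<subseteq> jumps P" using sub[OF g P] .
  have "jumps (cj (inv g) (cj g P)) \<subseteq> jumps (cj g P)"
    using g P by (intro sub cj_carrier) auto
  then show "jumps P \<subseteq> jumps (cj g P)" using g P by (simp add: cj_cj cj_one)
qed

lemma maximal_rep:
  assumes "maximal u" "g \<in> carrier G"
  shows "maximal (\<pi> g u)"
  using assms rep_eq_0[of g u] rep_closed[of g u] jumps_cj[OF assms(2) lstab2_carrier[of u u]]
  by (simp add: maximal_def lstab2_rep)

text \<open>Classes see a group only up to finite index, so the stabilizer of the line may be cut
  down to elements that centralize all factors.\<close>

definition core :: "'v \<Rightarrow> 'g set" where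
  "core u = lstab u \<inter> central_part"

lemma covered_core_Int:
  assumes u: "u \<in> V" "u \<noteq> 0" and v: "v \<in> cls u"
  shows "covered G (lstab u) (lstab2 u v \<inter> central_part)"
proof (rule covered_Int)
  show "covered G (lstab u) central_part"
    using covered_mono[OF central_part_covered lstab2_carrier subset_refl] .
qed (use v u central_part_subgroup in \<open>auto simp: cls_def intro: lstab2_subgroup\<close>)

lemma core_subgroup: "u \<in> V \<Longrightarrow> u \<noteq> 0 \<Longrightarrow> subgroup (core u) G"
  unfolding core_def by (intro subgroups_Inter_pair lstab2_subgroup central_part_subgroup)

lemma core_rep:
  assumes g: "g \<in> carrier G" and u: "u \<in> V"
  shows "core (\<pi> g u) = cj g (core u)"
proof -
  have "central_part \<subseteq> carrier G" by (auto simp: central_part_def)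
  then have "x \<in> cj g (core u) \<longleftrightarrow> x \<in> cj g (lstab u) \<and> x \<in> central_part" for x
  proof -
    assume cG: "central_part \<subseteq> carrier G"
    have "inv g \<otimes> x \<otimes> g \<in> central_part \<longleftrightarrow> x \<in> central_part" if x: "x \<in> carrier G"
    proof
      assume "x \<in> central_part"
      then show "inv g \<otimes> x \<otimes> g \<in> central_part" using central_part_conj[of x "inv g"] g by simp
    next
      assume "inv g \<otimes> x \<otimes> g \<in> central_part"
      then have "g \<otimes> (inv g \<otimes> x \<otimes> g) \<otimes> inv g \<in> central_part" using g by (rule central_part_conj)
      moreover have "g \<otimes> (inv g \<otimes> x \<otimes> g) \<otimes> inv g = x"
        using g x by (simp add: m_assoc) (simp flip: m_assoc)
      ultimately show "x \<in> central_part" by simp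
    qed
    then show ?thesis
      using mem_cj[OF g lstab2_carrier[of u u], of x] mem_cj[OF g, of "core u" x] cG
      unfolding core_def by blast
  qed
  then show ?thesis using lstab2_rep[OF g u u] unfolding core_def by auto
qed

text \<open>Restricting to \<open>central_part\<close> is what makes \<open>layer (Suc i) u\<close> normal in \<open>layer i u\<close>.\<close>

definition layer :: "nat \<Rightarrow> 'v \<Rightarrow> 'g set" where
  "layer i u = N i <#> core u"

lemma layer_subgroup: "i \<le> Suc k \<Longrightarrow> u \<in> V \<Longrightarrow> u \<noteq> 0 \<Longrightarrow> subgroup (layer i u) G"
  unfolding layer_def by (intro mult_norm_subgroup N_normal core_subgroup)

lemma core_layer: "i \<le> Suc k \<Longrightarrow> core u \<subseteq> layer i u"
proof
  fix x assume i: "i \<le> Suc k" and x: "x \<in> core u"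
  then have "x \<in> carrier G" using lstab2_carrier by (auto simp: core_def)
  moreover have "\<one> \<in> N i" using N_subgroup[OF i] subgroup.one_closed by blast
  ultimately show "x \<in> layer i u" using x unfolding layer_def set_mult_def
    by (intro UN_I[of \<one>] UN_I[of x]) auto
qed

lemma N_layer: "i \<le> Suc k \<Longrightarrow> u \<in> V \<Longrightarrow> u \<noteq> 0 \<Longrightarrow> N i \<subseteq> layer i u"
proof
  fix x assume i: "i \<le> Suc k" and u: "u \<in> V" "u \<noteq> 0" and x: "x \<in> N i"
  have "x \<in> carrier G" using N_carrier[OF i x] .
  moreover have "\<one> \<in> core u" using core_subgroup[OF u] subgroup.one_closed by blast
  ultimately show "x \<in> layer i u" using x unfolding layer_def set_mult_def
    by (intro UN_I[of x] UN_I[of \<one>]) auto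
qed

lemma layer_end: "layer (Suc k) u = core u"
proof -
  have "core u \<subseteq> carrier G" using lstab2_carrier by (auto simp: core_def)
  then have "\<one> \<otimes> x = x" if "x \<in> core u" for x using that by auto
  then show ?thesis unfolding layer_def N_end set_mult_def by auto
qed

lemma layer_0: "u \<in> V \<Longrightarrow> u \<noteq> 0 \<Longrightarrow> layer 0 u = carrier G"
  using N_layer[of 0 u] N_0 layer_subgroup[of 0 u] subgroup.subset by blast

lemma layer_Suc: "i \<le> k \<Longrightarrow> layer (Suc i) u \<subseteq> layer i u"
  unfolding layer_def set_mult_def using N_Suc by blast

lemma cj_layer:
  assumes i: "i \<le> Suc k" and g: "g \<in> carrier G" and u: "u \<in> V"
  shows "cj g (layer i u) = layer i (\<pi> g u)"
proof -
  have cG: "core u \<subseteq> carrier G" using lstab2_carrier by (auto simp: core_def)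
  have e: "g \<otimes> (n \<otimes> p) \<otimes> inv g = (g \<otimes> n \<otimes> inv g) \<otimes> (g \<otimes> p \<otimes> inv g)"
    if "n \<in> N i" "p \<in> core u" for n p
  proof -
    have np: "n \<in> carrier G" "p \<in> carrier G" using N_carrier[OF i that(1)] that(2) cG by auto
    have "inv g \<otimes> (g \<otimes> (p \<otimes> inv g)) = p \<otimes> inv g" using np g by (simp flip: m_assoc)
    then show ?thesis using np g by (simp add: m_assoc)
  qed
  have Ni: "cj g (N i) = N i"
  proof
    show "cj g (N i) \<subseteq> N i" using N_conj[OF i _ g] by (auto simp: cj_def)
    show "N i \<subseteq> cj g (N i)"
      using mem_cj[OF g, of "N i"] N_conj'[OF i _ g] N_carrier[OF i] by blast
  qed
  have "cj g (layer i u) = cj g (N i) <#> cj g (core u)"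
    using e unfolding cj_def layer_def set_mult_def by (force simp: image_iff)
  then show ?thesis using Ni core_rep[OF g u] by (simp add: layer_def)
qed

text \<open>Normality in disguise, since \<open>layer (Suc i) (\<pi> h u)\<close> is the conjugate
  of \<open>layer (Suc i) u\<close> by \<open>h\<close>. Write \<open>h\<close> as a product of
  \<open>n\<close> in \<open>N i\<close> and \<open>p\<close> in the core: \<open>p\<close>
  normalizes the core, and conjugation by \<open>n\<close> alters an element of the core only by a
  factor in \<open>N (Suc i)\<close>.\<close>

lemma layer_normal:
  assumes i: "i \<le> k" and u: "u \<in> V" "u \<noteq> 0" and h: "h \<in> layer i u"
  shows "layer (Suc i) (\<pi> h u) = layer (Suc i) u"
proof -
  have sub: "subgroup (layer i u) G" "subgroup (layer (Suc i) u) G" using i u by (auto intro: layer_subgroup)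
  interpret q: group_hom G "G Mod N (Suc i)" "coset i" by (rule coset_hom[OF i])
  have MG: "layer (Suc i) u \<subseteq> carrier G" using subgroup.subset[OF sub(2)] .
  have cG: "core u \<subseteq> carrier G" using lstab2_carrier by (auto simp: core_def)
  have step: "cj h (layer (Suc i) u) \<subseteq> layer (Suc i) u" if h: "h \<in> layer i u" for h
  proof
    fix x assume "x \<in> cj h (layer (Suc i) u)"
    then obtain m where m: "m \<in> layer (Suc i) u" "x = h \<otimes> m \<otimes> inv h" by (auto simp: cj_def)
    obtain n p where np: "n \<in> N i" "p \<in> core u" "h = n \<otimes> p"
      using h by (auto simp: layer_def set_mult_def)
    obtain n' q where n'q: "n' \<in> N (Suc i)" "q \<in> core u" "m = n' \<otimes> q"
      using m by (auto simp: layer_def set_mult_def)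
    have G: "n \<in> carrier G" "p \<in> carrier G" "n' \<in> carrier G" "q \<in> carrier G"
      using N_carrier[OF _ np(1)] N_carrier[OF _ n'q(1)] i np n'q cG by auto
    have hG: "h \<in> carrier G" using G np by simp
    define r where "r = p \<otimes> q \<otimes> inv p"
    have r: "r \<in> core u"
      using core_subgroup[OF u] np n'q by (simp add: r_def subgroup.m_closed subgroup.m_inv_closed)
    have rG: "r \<in> carrier G" using r cG by auto
    have "r \<in> fixer i" using r i by (simp add: core_def central_part_eq)
    then have "coset i (r \<otimes> n \<otimes> inv r) = coset i n" using np(1) by (simp add: fixer_def)
    \<comment> \<open>Multiplying by \<open>r \<otimes> inv n\<close> on the right turns the
      statement that \<open>r\<close> fixes the coset of \<open>n\<close> into the statement that
      \<open>n\<close> fixes the coset of \<open>r\<close>.\<close>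
    then have "coset i (r \<otimes> n \<otimes> inv r) \<otimes>\<^bsub>G Mod N (Suc i)\<^esub> coset i (r \<otimes> inv n)
       = coset i n \<otimes>\<^bsub>G Mod N (Suc i)\<^esub> coset i (r \<otimes> inv n)" by simp
    then have "coset i (r \<otimes> n \<otimes> inv r \<otimes> (r \<otimes> inv n)) = coset i (n \<otimes> (r \<otimes> inv n))"
      using rG G by (simp only: q.hom_mult[symmetric] m_closed inv_closed)
    moreover have "r \<otimes> n \<otimes> inv r \<otimes> (r \<otimes> inv n) = r"
    proof -
      have "inv r \<otimes> (r \<otimes> inv n) = inv n" using rG G by (simp flip: m_assoc)
      then show ?thesis using rG G by (simp add: m_assoc)
    qed
    ultimately have nr: "coset i (n \<otimes> r \<otimes> inv n) = coset i r"
      using rG G by (simp only: m_assoc inv_closed)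
    have mq: "coset i m = coset i q"
      using coset_eq_iff[of i m q] i n'q G by (simp add: m_assoc)
    have "coset i x = coset i (h \<otimes> q \<otimes> inv h)"
      unfolding m(2) using mq hG G n'q(3) i by (intro coset_conj_cong) auto
    also have "h \<otimes> q \<otimes> inv h = n \<otimes> r \<otimes> inv n"
      unfolding np(3) r_def using G by (simp add: conj_mult)
    finally have "coset i x = coset i r" using nr by simp
    moreover have xG: "x \<in> carrier G" using m MG hG by auto
    ultimately have "x \<otimes> inv r \<in> N (Suc i)" using coset_eq_iff[OF i] rG by simp
    moreover have "x = (x \<otimes> inv r) \<otimes> r" using xG rG by (simp add: m_assoc)
    ultimately show "x \<in> layer (Suc i) u" using r unfolding layer_def set_mult_def by blast
  qed
  have hG: "h \<in> carrier G" using h subgroup.subset[OF sub(1)] by blast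
  have "inv h \<in> layer i u" using h sub(1) by (simp add: subgroup.m_inv_closed)
  then have "cj h (cj (inv h) (layer (Suc i) u)) \<subseteq> cj h (layer (Suc i) u)"
    by (intro cj_mono step)
  then have "layer (Suc i) u \<subseteq> cj h (layer (Suc i) u)" using hG MG by (simp add: cj_cj cj_one)
  then have "cj h (layer (Suc i) u) = layer (Suc i) u" using step[OF h] by blast
  then show ?thesis using cj_layer[of "Suc i" h u] i hG u by simp
qed

end

section \<open>Independence of the translates of a class\<close>

context complex_rep
begin

text \<open>An element of \<open>D\<close> permutes the translates, and by uniqueness of components
  the permuted components of the eigenvector are those of its multiple by \<open>c p\<close>. So
  \<open>D\<close> acts on the finite set \<open>F\<close>, and the kernel of this action has finite
  index.\<close>

lemma permute_finite_support:
  assumes ind: "indep (orb M A0)" and M: "subgroup M G" and A0: "subsp A0"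
    and F: "finite F" "F \<subseteq> orb M A0" "\<And>A. A \<in> F \<Longrightarrow> f A \<in> A" "\<And>A. A \<in> F \<Longrightarrow> f A \<noteq> 0"
    and D: "subgroup D G" "D \<subseteq> M" and eig: "\<And>p. p \<in> D \<Longrightarrow> \<pi> p (sum f F) = scale (c p) (sum f F)"
  shows "\<And>p A. \<lbrakk>p \<in> D; A \<in> F\<rbrakk> \<Longrightarrow> act p A \<in> F \<and> \<pi> p (f A) = scale (c p) (f (act p A))"
    and "covered G D {p \<in> D. \<forall>A\<in>F. act p A = A}"
proof -
  have MG: "M \<subseteq> carrier G" using M by (rule subgroup.subset)
  have DG: "D \<subseteq> carrier G" using D MG by blast
  have osub: "subsp A" if "A \<in> orb M A0" for A using orb_subsp[OF MG A0 that] .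
  have FV: "A \<subseteq> V" if "A \<in> F" for A using osub F(2) that by (auto simp: subsp_def)
  have fV: "f A \<in> V" if "A \<in> F" for A using FV[OF that] F(3)[OF that] by blast
  show key: "act p A \<in> F \<and> \<pi> p (f A) = scale (c p) (f (act p A))" if p: "p \<in> D" and A: "A \<in> F" for p A
  proof -
    have pG: "p \<in> carrier G" using p DG by auto
    define f1 where "f1 B = \<pi> p (f (act (inv p) B))" for B
    have f1: "f1 (act p B) = \<pi> p (f B)" if "B \<in> F" for B using FV[OF that] pG by (simp add: f1_def)
    have inj: "inj_on (act p) F" using FV act_inj[OF pG] by (auto simp: inj_on_def)
    have "sum f1 (act p ` F) = (\<Sum>B\<in>F. \<pi> p (f B))" using f1 by (simp add: sum.reindex[OF inj])
    also have "\<dots> = \<pi> p (sum f F)" using fV pG by (simp add: rep_sum)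
    also have "\<dots> = (\<Sum>B\<in>F. scale (c p) (f B))" using eig[OF p] by (simp add: scale_sum_right)
    finally have eq: "sum f1 (act p ` F) = (\<Sum>B\<in>F. scale (c p) (f B))" .
    have s1: "act p ` F \<subseteq> orb M A0"
      using orb_act_left[OF M, of p A0] F(2) p D(2) A0 by (auto simp: subsp_def)
    have s2: "f1 B \<in> B" if "B \<in> act p ` F" for B using that f1 F(3) by (auto simp: act_def)
    have s3: "scale (c p) (f B) \<in> B" if "B \<in> F" for B
      using osub F(2,3) that subspace_scale by (auto simp: subsp_def)
    note u = indep_unique[OF ind osub finite_imageI[OF F(1)] s1 s2 F(1) F(2) s3 eq]
    have nz: "f1 (act p A) \<noteq> 0" using f1[OF A] F(4)[OF A] rep_eq_0[OF pG fV[OF A]] by simp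
    have "act p A \<in> F" using u(2)[of "act p A"] nz A by blast
    moreover have "f1 (act p A) = scale (c p) (f (act p A))" using u(1)[of "act p A"] A \<open>act p A \<in> F\<close> by blast
    ultimately show ?thesis using f1[OF A] by simp
  qed
  \<comment> \<open>The inverse makes the fibers of \<open>\<phi>\<close> fit right cosets; the
    constant value outside \<open>F\<close> leaves only finitely many functions.\<close>
  define \<phi> where "\<phi> p = (\<lambda>A. if A \<in> F then act (inv p) A else {})" for p
  have "\<phi> ` D \<subseteq> {\<phi>. \<forall>A. (A \<in> F \<longrightarrow> \<phi> A \<in> F) \<and> (A \<notin> F \<longrightarrow> \<phi> A = {})}"
    using key D(1) by (auto simp: \<phi>_def subgroup.m_inv_closed)
  then have fin: "finite (\<phi> ` D)"
    using finite_set_of_finite_funs[OF F(1) F(1)] by (rule finite_subset)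
  show "covered G D {p \<in> D. \<forall>A\<in>F. act p A = A}"
  proof (rule covered_fibers[OF DG fin])
    fix p q assume p: "p \<in> D" and q: "q \<in> D" and e: "\<phi> p = \<phi> q"
    have "act (p \<otimes> inv q) A = A" if A: "A \<in> F" for A
    proof -
      have "act (inv p) A = act (inv q) A" using fun_cong[OF e, of A] A by (simp add: \<phi>_def)
      then have "act p (act (inv q) A) = A" using FV[OF A] p DG by (metis act_inv' subsetD)
      then show ?thesis using FV[OF A] p q DG by (simp add: act_mult subset_iff)
    qed
    then show "p \<otimes> inv q \<in> {p \<in> D. \<forall>A\<in>F. act p A = A}"
      using p q D(1) by (simp add: subgroup.m_closed subgroup.m_inv_closed)
  qed (use DG in auto)
qed

end

context series_rep
begin

text \<open>A subgroup of finite index in \<open>lstab u\<close> acts on \<open>z\<close> with the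
  character of \<open>u\<close> and permutes the finitely many components of \<open>z\<close>. A
  smaller one, still of finite index, keeps each component and acts on it with that character. So a
  nonzero component lies in \<open>cls u\<close> and also in a member of the orbit, and two classes
  of maximal vectors with a common nonzero vector are equal.\<close>

lemma cls_in_orbit:
  assumes u: "maximal u" and u': "maximal u'" and M: "subgroup M G" and core: "core u \<subseteq> M"
    and ind: "indep (orb M (cls u'))"
    and z: "z \<in> cls u" "z \<in> span (\<Union>(orb M (cls u')))" "z \<noteq> 0"
  shows "cls u \<in> orb M (cls u')"
proof -
  have uV: "u \<in> V" "u \<noteq> 0" "u' \<in> V" "u' \<noteq> 0" using u u' by (auto simp: maximal_def)
  have MG: "M \<subseteq> carrier G" using M by (rule subgroup.subset)
  have zV: "z \<in> V" using z(1) by (simp add: cls_def)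
  have s0: "subsp (cls u')" using cls_subsp uV by blast
  have osub: "subsp A" if "A \<in> orb M (cls u')" for A using orb_subsp[OF MG s0 that] .
  obtain F0 f where F0: "finite F0" "F0 \<subseteq> orb M (cls u')" "\<And>A. A \<in> F0 \<Longrightarrow> f A \<in> A" "z = sum f F0"
    using span_Union[of "orb M (cls u')" z] osub z(2) by blast
  define F where "F = {A \<in> F0. f A \<noteq> 0}"
  have zF: "z = sum f F" unfolding F_def F0(4) using F0(1) by (intro sum.mono_neutral_right) auto
  have F: "finite F" "F \<subseteq> orb M (cls u')" "\<And>A. A \<in> F \<Longrightarrow> f A \<in> A" "\<And>A. A \<in> F \<Longrightarrow> f A \<noteq> 0"
    using F0 by (auto simp: F_def)
  obtain A where A: "A \<in> F" using z(3) zF by (cases "F = {}") auto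
  define D where "D = lstab2 u z \<inter> central_part"
  have D: "subgroup D G" unfolding D_def
    using uV zV by (intro subgroups_Inter_pair lstab2_subgroup central_part_subgroup) auto
  have DM: "D \<subseteq> M" using core lstab2_le by (auto simp: D_def core_def)
  define c where "c p = (SOME c. \<pi> p u = scale c u \<and> \<pi> p z = scale c z)" for p
  have c: "\<pi> p u = scale (c p) u \<and> \<pi> p z = scale (c p) z" if "p \<in> D" for p
  proof -
    have "\<exists>c. \<pi> p u = scale c u \<and> \<pi> p z = scale c z" using that by (simp add: D_def lstab2_def)
    then show ?thesis unfolding c_def by (rule someI_ex)
  qed
  have eig: "\<pi> p (sum f F) = scale (c p) (sum f F)" if "p \<in> D" for p using c[OF that] zF by simp
  have perm1: "act p A \<in> F \<and> \<pi> p (f A) = scale (c p) (f (act p A))" if "p \<in> D" "A \<in> F" for p A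
    by (rule permute_finite_support(1)[OF ind M s0 F(1,2) _ _ D DM]) (use F(3,4) eig that in auto)
  have perm2: "covered G D {p \<in> D. \<forall>A\<in>F. act p A = A}"
    by (rule permute_finite_support(2)[OF ind M s0 F(1,2) _ _ D DM, of f c]) (use F(3,4) eig in auto)
  define D' where "D' = {p \<in> D. \<forall>A\<in>F. act p A = A}"
  have "covered G (lstab u) D'"
    using covered_core_Int[OF uV(1,2) z(1)] perm2 unfolding D_def[symmetric] D'_def[symmetric]
    by (rule covered_trans) (use DM MG in \<open>auto simp: D'_def\<close>)
  moreover have "D' \<subseteq> lstab2 u (f A)"
  proof
    fix p assume p: "p \<in> D'"
    then have pD: "p \<in> D" "act p A = A" using A by (auto simp: D'_def)
    then have "\<pi> p (f A) = scale (c p) (f A)" using perm1[OF pD(1) A] by simp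
    then show "p \<in> lstab2 u (f A)" using c[OF pD(1)] pD DM MG by (auto simp: lstab2_def)
  qed
  ultimately have "covered G (lstab u) (lstab2 u (f A))" using covered_mono subset_refl by metis
  then have fA: "f A \<in> cls u" using F(2,3) A osub by (auto simp: cls_def subsp_def)
  obtain l where l: "l \<in> M" "A = act l (cls u')" using F(2) A by (auto simp: orb_def)
  then have lG: "l \<in> carrier G" using MG by auto
  have "A = cls (\<pi> l u')" using l act_cls[OF lG uV(3)] by simp
  moreover have "maximal (\<pi> l u')" using maximal_rep[OF u' lG] .
  ultimately have "cls u = A" using cls_disjoint[OF u _ fA] F(3,4)[OF A] by metis
  then show ?thesis using F(2) A by blast
qed

definition tot :: "'g set \<Rightarrow> 'v \<Rightarrow> 'v set" where
  "tot M w = span (\<Union>(orb M (cls w)))"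

text \<open>Independence by itself does not climb from one layer to the next: shortening a relation
  requires moving one of its terms into a single class by operators from \<open>M\<close>. The
  second clause provides this and is therefore carried through the induction.\<close>

definition good :: "'g set \<Rightarrow> 'v \<Rightarrow> bool" where
  "good M u \<longleftrightarrow> indep (orb M (cls u)) \<and>
     (\<forall>X. invsub M X \<longrightarrow> (\<exists>x\<in>X \<inter> tot M u. x \<noteq> 0) \<longrightarrow> (\<exists>x\<in>X \<inter> cls u. x \<noteq> 0))"

lemma tot_invsub: "subgroup M G \<Longrightarrow> invsub M (tot M w)"
  unfolding tot_def by (rule span_orb_invsub) (auto simp: cls_def)

lemma subsp_add: "subsp A \<Longrightarrow> v \<in> A \<Longrightarrow> w \<in> A \<Longrightarrow> v + w \<in> A"
  by (simp add: subsp_def subspace_add)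

lemma subsp_diff: "subsp A \<Longrightarrow> v \<in> A \<Longrightarrow> w \<in> A \<Longrightarrow> v - w \<in> A"
  by (simp add: subsp_def subspace_diff)

lemma subsp_scale: "subsp A \<Longrightarrow> v \<in> A \<Longrightarrow> scale c v \<in> A"
  by (simp add: subsp_def subspace_scale)

text \<open>
  Minimal-length argument: a relation among the blocks \<open>tot M (\<pi> h u)\<close> is shortened by first moving
  one of its terms into a class \<open>cls w\<close> (goodness of \<open>M\<close>) and then applying \<open>\<pi> p - c\<close>, which kills
  that term; a term killed by all these operators lies in \<open>cls w\<close> itself.
\<close>

lemma relation_meets_class:
  assumes u: "maximal u" and L: "subgroup L G" and M: "subgroup M G"
    and core: "\<And>h. h \<in> L \<Longrightarrow> core (\<pi> h u) \<subseteq> M"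
    and good: "\<And>h. h \<in> L \<Longrightarrow> good M (\<pi> h u)"
    and X: "invsub M X"
    and F: "finite F" "F \<subseteq> (\<lambda>h. tot M (\<pi> h u)) ` L" "\<And>B. B \<in> F \<Longrightarrow> f B \<in> B" "sum f F \<in> X"
      "B0 \<in> F" "f B0 \<noteq> 0"
  shows "\<exists>h\<in>L. \<exists>x\<in>X \<inter> cls (\<pi> h u). x \<noteq> 0"
  using F
proof (induction "card F" arbitrary: F f B0)
  case 0
  then show ?case by auto
next
  case (Suc n)
  note F = Suc.prems
  have LG: "L \<subseteq> carrier G" and MG: "M \<subseteq> carrier G" using L M by (auto dest: subgroup.subset)
  obtain h0 where h0: "h0 \<in> L" "B0 = tot M (\<pi> h0 u)" using F by blast
  define w where "w = \<pi> h0 u"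
  have w: "maximal w" unfolding w_def using maximal_rep[OF u] h0 LG by blast
  have wV: "w \<in> V" "w \<noteq> 0" using w by (auto simp: maximal_def)
  have Bsub: "subsp B" and Binv: "\<And>m x. m \<in> M \<Longrightarrow> x \<in> B \<Longrightarrow> \<pi> m x \<in> B" if "B \<in> F" for B
    using that F(2) tot_invsub[OF M] by (auto simp: invsub_def)
  have Xsub: "subsp X" using X by (simp add: invsub_def)
  define F' where "F' = F - {B0}"
  have F': "finite F'" "F' \<subseteq> F" "card F' = n" using F Suc(2) by (auto simp: F'_def)
  \<comment> \<open>The parts in \<open>B0\<close> of all sums over \<open>F\<close> that fall into
    \<open>X\<close>. As \<open>X\<close> and the blocks are invariant under \<open>M\<close>, so is
    \<open>X1\<close>, and goodness applies to it instead of to \<open>X\<close>.\<close>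
  define X1 where "X1 = {x \<in> B0. \<exists>g. (\<forall>B\<in>F'. g B \<in> B) \<and> x + sum g F' \<in> X}"
  have X1: "invsub M X1"
    unfolding invsub_def subsp_def
  proof (intro conjI ballI)
    show "X1 \<subseteq> V" using Bsub[OF F(5)] by (auto simp: X1_def subsp_def)
    show "subspace X1"
    proof (rule subspaceI)
      show "0 \<in> X1" unfolding X1_def
        using F' Bsub F(5) subsp_0 Xsub by (auto intro!: exI[of _ "\<lambda>_. 0"])
    next
      fix x y assume "x \<in> X1" "y \<in> X1"
      then obtain g g' where g: "x \<in> B0" "\<forall>B\<in>F'. g B \<in> B" "x + sum g F' \<in> X"
        and g': "y \<in> B0" "\<forall>B\<in>F'. g' B \<in> B" "y + sum g' F' \<in> X" by (auto simp: X1_def)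
      have "x + sum g F' + (y + sum g' F') \<in> X" using g g' subsp_add[OF Xsub] by blast
      then have "x + y + (\<Sum>B\<in>F'. g B + g' B) \<in> X" by (simp add: sum.distrib algebra_simps)
      moreover have "g B + g' B \<in> B" if "B \<in> F'" for B
        using that subsp_add[OF Bsub] g(2) g'(2) F'(2) by (meson subsetD)
      moreover have "x + y \<in> B0" using g g' Bsub[OF F(5)] subsp_add by blast
      ultimately show "x + y \<in> X1" unfolding X1_def by (auto intro!: exI[of _ "\<lambda>B. g B + g' B"])
    next
      fix a x assume "x \<in> X1"
      then obtain g where g: "x \<in> B0" "\<forall>B\<in>F'. g B \<in> B" "x + sum g F' \<in> X" by (auto simp: X1_def)
      have "scale a (x + sum g F') \<in> X" using g subsp_scale[OF Xsub] by blast
      then have "scale a x + (\<Sum>B\<in>F'. scale a (g B)) \<in> X" by (simp add: scale_right_distrib scale_sum_right)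
      moreover have "\<forall>B\<in>F'. scale a (g B) \<in> B" using g F' Bsub subsp_scale by blast
      moreover have "scale a x \<in> B0" using g Bsub[OF F(5)] subsp_scale by blast
      ultimately show "scale a x \<in> X1" unfolding X1_def by (auto intro!: exI[of _ "\<lambda>B. scale a (g B)"])
    qed
    fix m x assume m: "m \<in> M" and "x \<in> X1"
    then obtain g where g: "x \<in> B0" "\<forall>B\<in>F'. g B \<in> B" "x + sum g F' \<in> X" by (auto simp: X1_def)
    have mG: "m \<in> carrier G" using m MG by auto
    have gV: "g B \<in> V" if "B \<in> F'" for B using g(2) Bsub F' that by (auto simp: subsp_def)
    have xV: "x \<in> V" using g(1) Bsub[OF F(5)] by (auto simp: subsp_def)
    have "\<pi> m (x + sum g F') = \<pi> m x + (\<Sum>B\<in>F'. \<pi> m (g B))"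
      using mG gV xV by (simp add: rep_add rep_sum V_sum)
    moreover have "\<pi> m (x + sum g F') \<in> X" using X m g(3) by (simp add: invsub_def)
    ultimately have "\<pi> m x + (\<Sum>B\<in>F'. \<pi> m (g B)) \<in> X" by simp
    moreover have "\<forall>B\<in>F'. \<pi> m (g B) \<in> B" using g(2) F' Binv m by blast
    moreover have "\<pi> m x \<in> B0" using Binv[OF F(5) m g(1)] .
    ultimately show "\<pi> m x \<in> X1" unfolding X1_def by (auto intro!: exI[of _ "\<lambda>B. \<pi> m (g B)"])
  qed
  have "f B0 \<in> X1"
  proof -
    have "sum f F = f B0 + sum f F'" unfolding F'_def using F(1,5) by (simp add: sum.remove)
    then show ?thesis unfolding X1_def using F F' by auto
  qed
  then have "\<exists>x\<in>X1 \<inter> tot M w. x \<noteq> 0" using F(3,5,6) h0 by (auto simp: w_def)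
  then obtain y where y: "y \<in> X1" "y \<in> cls w" "y \<noteq> 0"
    using good[OF h0(1)] X1 unfolding good_def w_def[symmetric] by blast
  then obtain g where g: "y \<in> B0" "\<forall>B\<in>F'. g B \<in> B" "y + sum g F' \<in> X" by (auto simp: X1_def)
  have gV: "g B \<in> V" if "B \<in> F'" for B using g(2) Bsub F' that by (auto simp: subsp_def)
  have yV: "y \<in> V" using y(2) by (simp add: cls_def)
  define D where "D = lstab2 w y \<inter> central_part"
  have DM: "D \<subseteq> M" using core[OF h0(1)] lstab2_le by (auto simp: D_def core_def w_def)
  have cov: "covered G (lstab w) D" unfolding D_def using covered_core_Int wV y(2) by blast
  show ?case
  proof (cases "\<exists>p\<in>D. \<exists>c. \<pi> p y = scale c y \<and> (\<exists>B\<in>F'. \<pi> p (g B) - scale c (g B) \<noteq> 0)")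
    case True
    then obtain p c B where p: "p \<in> D" "\<pi> p y = scale c y" "B \<in> F'" "\<pi> p (g B) - scale c (g B) \<noteq> 0"
      by blast
    have pM: "p \<in> M" using p DM by auto
    have pG: "p \<in> carrier G" using pM MG by auto
    have "\<pi> p (y + sum g F') - scale c (y + sum g F') \<in> X"
      using X g(3) pM by (intro subsp_diff subsp_scale Xsub) (auto simp: invsub_def)
    moreover have "\<pi> p (y + sum g F') - scale c (y + sum g F') = (\<Sum>B\<in>F'. \<pi> p (g B) - scale c (g B))"
      using pG gV yV p(2) by (simp add: rep_add rep_sum V_sum scale_right_distrib scale_sum_right sum_subtractf)
    ultimately have "(\<Sum>B\<in>F'. \<pi> p (g B) - scale c (g B)) \<in> X" by simp
    moreover have "\<pi> p (g B) - scale c (g B) \<in> B" if "B \<in> F'" for B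
      using that F' g(2) pM by (intro subsp_diff subsp_scale Bsub Binv) auto
    ultimately show ?thesis
      using Suc.hyps(1)[of F' "\<lambda>B. \<pi> p (g B) - scale c (g B)" B] F' F(2) p(3,4) by blast
  next
    case False
    \<comment> \<open>Here \<open>D\<close> acts on each \<open>g B\<close> with the character of
      \<open>w\<close>. A nonzero \<open>g B\<close> would lie in \<open>cls w\<close> and in the
      block \<open>B\<close>, so \<open>cls w\<close> would belong to the orbit spanning
      \<open>B\<close> and \<open>B\<close> would equal \<open>B0\<close>.\<close>
    have "g B = 0" if B: "B \<in> F'" for B
    proof (rule ccontr)
      assume gB: "g B \<noteq> 0"
      have "D \<subseteq> lstab2 w (g B)"
      proof
        fix p assume p: "p \<in> D"
        then obtain c where c: "p \<in> carrier G" "\<pi> p w = scale c w" "\<pi> p y = scale c y"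
          by (auto simp: D_def lstab2_def)
        then have "\<pi> p (g B) - scale c (g B) = 0" using False B p by blast
        then show "p \<in> lstab2 w (g B)" using c by (auto simp: lstab2_def)
      qed
      then have "covered G (lstab w) (lstab2 w (g B))" using covered_mono[OF cov subset_refl] by blast
      then have gw: "g B \<in> cls w" using gV[OF B] by (simp add: cls_def)
      obtain h where h: "h \<in> L" "B = tot M (\<pi> h u)" using F(2) F' B by blast
      have hG: "h \<in> carrier G" using h LG by auto
      have "cls w \<in> orb M (cls (\<pi> h u))"
      proof (rule cls_in_orbit[OF w maximal_rep[OF u hG] M _ _ gw _ gB])
        show "core w \<subseteq> M" using core h0 by (simp add: w_def)
        show "indep (orb M (cls (\<pi> h u)))" using good[OF h(1)] by (simp add: good_def)
        show "g B \<in> span (\<Union>(orb M (cls (\<pi> h u))))" using g(2) B h(2) by (auto simp: tot_def)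
      qed
      then obtain m where m: "m \<in> M" "cls w = act m (cls (\<pi> h u))" by (auto simp: orb_def)
      have "orb M (cls w) = orb M (cls (\<pi> h u))"
        unfolding m(2) using M m(1) by (rule orb_act_right) (auto simp: cls_def)
      then have "B = B0" using h(2) h0(2) by (simp add: tot_def w_def)
      then show False using B by (simp add: F'_def)
    qed
    then have "y \<in> X" using g(3) by simp
    then show ?thesis using y h0 by (auto simp: w_def)
  qed
qed

text \<open>The blocks \<open>tot M (\<pi> h u)\<close> are independent, and inside each block the
  classes form part of one independent \<open>M\<close>-orbit, so the two-stage criterion applies.
  That the same \<open>M\<close> is good for all \<open>\<pi> h u\<close> is what normality of
  \<open>M\<close> in \<open>L\<close> will supply.\<close>

lemma good_step:
  assumes u: "maximal u" and L: "subgroup L G" and M: "subgroup M G" and le: "M \<subseteq> L"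
    and core: "\<And>h. h \<in> L \<Longrightarrow> core (\<pi> h u) \<subseteq> M"
    and good: "\<And>h. h \<in> L \<Longrightarrow> good M (\<pi> h u)"
  shows "good L u"
proof -
  have LG: "L \<subseteq> carrier G" and MG: "M \<subseteq> carrier G" using L M by (auto dest: subgroup.subset)
  have uV: "u \<in> V" using u by (simp add: maximal_def)
  let ?\<B> = "(\<lambda>h. tot M (\<pi> h u)) ` L"
  have Bsub: "subsp B" if "B \<in> ?\<B>" for B using that tot_invsub[OF M] by (auto simp: invsub_def)
  have orbL: "\<exists>h\<in>L. A = cls (\<pi> h u)" if "A \<in> orb L (cls u)" for A
    using that act_cls uV LG by (auto simp: orb_def)
  have incl: "cls w \<subseteq> tot M w" for w
  proof -
    have "cls w \<in> orb M (cls w)" using orb_self[OF M] by (auto simp: cls_def)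
    then show ?thesis unfolding tot_def using span_superset by blast
  qed
  have indB: "indep ?\<B>"
  proof (rule indepI, rule ccontr)
    fix F f A assume F: "finite F" "F \<subseteq> ?\<B>" "\<And>A. A \<in> F \<Longrightarrow> f A \<in> A" "sum f F = 0" "A \<in> F" "f A \<noteq> 0"
    \<comment> \<open>A nontrivial relation with \<open>X = {0}\<close> would produce a nonzero
      element of \<open>{0}\<close>.\<close>
    have "invsub M {0}" using MG by (auto simp: invsub_def subsp_def)
    from relation_meets_class[OF u L M core good this F(1,2,3) _ F(5,6)] F(4) show False by simp
  qed
  have "indep (orb L (cls u))"
  proof (rule indep_group[OF indB Bsub])
    fix A assume "A \<in> orb L (cls u)"
    then show "\<exists>B\<in>?\<B>. A \<subseteq> B" using orbL incl by blast
  next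
    fix B assume "B \<in> ?\<B>"
    then obtain h where h: "h \<in> L" "B = tot M (\<pi> h u)" by auto
    have hG: "h \<in> carrier G" using h LG by auto
    have ind: "indep (orb M (cls (\<pi> h u)))" using good[OF h(1)] by (simp add: good_def)
    show "indep {A \<in> orb L (cls u). A \<subseteq> B}"
    proof (rule indep_mono[OF ind], rule subsetI)
      fix A assume A: "A \<in> {A \<in> orb L (cls u). A \<subseteq> B}"
      then obtain h' where h': "h' \<in> L" "A = cls (\<pi> h' u)" using orbL by blast
      have m': "maximal (\<pi> h' u)" using maximal_rep[OF u] h' LG by blast
      then have n: "\<pi> h' u \<in> V" "\<pi> h' u \<noteq> 0" by (auto simp: maximal_def)
      have "A \<subseteq> span (\<Union>(orb M (cls (\<pi> h u))))" using A h by (simp add: tot_def)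
      then show "A \<in> orb M (cls (\<pi> h u))"
        unfolding h'(2) using cls_self[OF n(1)] n(2) core[OF h'(1)]
        by (intro cls_in_orbit[OF m' maximal_rep[OF u hG] M _ ind, of "\<pi> h' u"]) auto
    qed
  qed
  moreover have "\<exists>x\<in>X \<inter> cls u. x \<noteq> 0" if X: "invsub L X" and x: "x \<in> X" "x \<in> tot L u" "x \<noteq> 0" for X x
  proof -
    have XM: "invsub M X" using X le by (auto simp: invsub_def)
    have "\<Union>(orb L (cls u)) \<subseteq> \<Union>?\<B>" using orbL incl by blast
    then have "x \<in> span (\<Union>?\<B>)" using x(2) span_mono unfolding tot_def[of L] by blast
    then obtain F f where F: "finite F" "F \<subseteq> ?\<B>" "\<And>A. A \<in> F \<Longrightarrow> f A \<in> A" "x = sum f F"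
      using span_Union[of ?\<B> x] Bsub by blast
    obtain B where B: "B \<in> F" "f B \<noteq> 0" using F(4) x(3) by (meson sum.neutral)
    have "\<exists>h\<in>L. \<exists>y\<in>X \<inter> cls (\<pi> h u). y \<noteq> 0"
      by (rule relation_meets_class[OF u L M core good XM F(1,2,3) _ B]) (use x F in auto)
    then obtain h y where h: "h \<in> L" "y \<in> X" "y \<in> act h (cls u)" "y \<noteq> 0"
      using act_cls uV LG by blast
    then obtain z where z: "z \<in> cls u" "y = \<pi> h z" by (auto simp: act_def)
    have hG: "h \<in> carrier G" using h LG by auto
    have zV: "z \<in> V" using z by (simp add: cls_def)
    \<comment> \<open>The vector found lies in a translate of the class; invariance of
      \<open>X\<close> under all of \<open>L\<close>, not only \<open>M\<close>, brings it back to
      \<open>cls u\<close>.\<close>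
    have "\<pi> (inv h) y \<in> X" using X h L by (simp add: invsub_def subgroup.m_inv_closed)
    then have "z \<in> X" using z hG zV by simp
    moreover have "z \<noteq> 0" using h(4) z(2) hG by auto
    ultimately show ?thesis using z(1) by blast
  qed
  ultimately show ?thesis unfolding good_def by blast
qed

text \<open>The induction starts at \<open>core u\<close>, which acts on \<open>u\<close> by
  scalars, so that \<open>cls u\<close> is its only translate and both clauses are trivial. It
  ranges over all maximal vectors because the step needs goodness for every
  \<open>\<pi> h u\<close>, whose next layer is that of \<open>u\<close> by normality.\<close>

lemma good_layer:
  assumes "i \<le> Suc k" "maximal u"
  shows "good (layer i u) u"
  using assms
proof (induction "Suc k - i" arbitrary: i u)
  case 0
  then have i: "i = Suc k" by simp
  have uV: "u \<in> V" "u \<noteq> 0" using 0 by (auto simp: maximal_def)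
  have "act p (cls u) = cls u" if p: "p \<in> core u" for p
  proof -
    obtain c where c: "p \<in> carrier G" "\<pi> p u = scale c u" using p by (auto simp: core_def lstab2_def)
    then have "c \<noteq> 0" using eigenvalue_inv uV by blast
    then show ?thesis using act_cls[OF c(1) uV(1)] c(2) cls_scale uV by simp
  qed
  then have o: "orb (core u) (cls u) = {cls u}"
    using core_subgroup[OF uV] subgroup.one_closed unfolding orb_def by fastforce
  have "subspace (cls u)" using cls_subsp uV by (simp add: subsp_def)
  then have "tot (core u) u = cls u" unfolding tot_def o by simp
  moreover have "indep {cls u}"
  proof (rule indepI)
    fix F f A assume F: "finite F" "F \<subseteq> {cls u}" "sum f F = 0" "A \<in> F"
    then have "F = {A}" by auto
    then show "f A = 0" using F(3) by simp
  qed
  ultimately show ?case unfolding i layer_end good_def o by simp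
next
  case (Suc d)
  have ik: "i \<le> k" using Suc.hyps(2) by simp
  have uV: "u \<in> V" "u \<noteq> 0" using Suc by (auto simp: maximal_def)
  have sub: "subgroup (layer i u) G" "subgroup (layer (Suc i) u) G"
    using ik uV by (auto intro: layer_subgroup)
  show ?case
  proof (rule good_step[OF Suc.prems(2) sub layer_Suc[OF ik]])
    fix h assume h: "h \<in> layer i u"
    have e: "layer (Suc i) (\<pi> h u) = layer (Suc i) u" using layer_normal[OF ik uV h] .
    have hG: "h \<in> carrier G" using h subgroup.subset[OF sub(1)] by blast
    show "core (\<pi> h u) \<subseteq> layer (Suc i) u" using core_layer[of "Suc i" "\<pi> h u"] ik e by simp
    show "good (layer (Suc i) u) (\<pi> h u)"
      using Suc.hyps(1)[of "Suc i" "\<pi> h u"] Suc.hyps(2) ik maximal_rep[OF Suc.prems(2) hG] e by simp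
  qed
qed

theorem indep_classes: "maximal u \<Longrightarrow> indep (orb (carrier G) (cls u))"
  using good_layer[of 0 u] layer_0[of u] by (simp add: good_def maximal_def)

end

section \<open>Systems of imprimitivity\<close>

context complex_rep
begin

definition stab :: "'g set \<Rightarrow> 'v set \<Rightarrow> 'g set" where
  "stab S A = {g \<in> S. act g A = A}"

definition irr :: "'g set \<Rightarrow> 'v set \<Rightarrow> bool" where
  "irr S W \<longleftrightarrow> invsub S W \<and> W \<noteq> {0} \<and> (\<forall>X. invsub S X \<and> X \<subseteq> W \<longrightarrow> X = {0} \<or> X = W)"

definition finite_dim :: "'v set \<Rightarrow> bool" where
  "finite_dim X \<longleftrightarrow> (\<exists>B. finite B \<and> X = span B)"

definition is_char :: "'g set \<Rightarrow> ('g \<Rightarrow> complex) \<Rightarrow> bool" where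
  "is_char H \<chi> \<longleftrightarrow> (\<forall>g\<in>H. \<chi> g \<noteq> 0) \<and> (\<forall>g\<in>H. \<forall>h\<in>H. \<chi> (g \<otimes> h) = \<chi> g * \<chi> h)"

text \<open>
  For irreducible \<open>W\<close> the translates of the line then decompose \<open>W\<close>, so that \<open>W\<close> is induced from
  the character by which the stabilizer of the line acts on it.
\<close>

definition monomial :: "'g set \<Rightarrow> 'v set \<Rightarrow> bool" where
  "monomial S W \<longleftrightarrow> (\<exists>e\<in>W. e \<noteq> 0 \<and> indep (orb S (span {e})))"

abbreviation weights :: "'v set \<Rightarrow> 'g set \<Rightarrow> ('g \<Rightarrow> complex) \<Rightarrow> 'v set" where
  "weights W H \<chi> \<equiv> weight_space scale W \<pi> H \<chi>"

lemma stab_subgroup: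
  assumes S: "subgroup S G" and A: "A \<subseteq> V"
  shows "subgroup (stab S A) G"
proof (rule subgroupI)
  have SG: "S \<subseteq> carrier G" using S by (rule subgroup.subset)
  show "stab S A \<subseteq> carrier G" using SG by (auto simp: stab_def)
  have "\<one> \<in> stab S A" using S A by (simp add: stab_def act_one subgroup.one_closed)
  then show "stab S A \<noteq> {}" by auto
next
  fix g assume "g \<in> stab S A"
  then have g: "g \<in> S" "g \<in> carrier G" "act g A = A"
    using subgroup.subset[OF S] by (auto simp: stab_def)
  have "act (inv g) A = A" using act_inv[OF g(2) A] g(3) by simp
  then show "inv g \<in> stab S A" using g(1) S by (simp add: stab_def subgroup.m_inv_closed)
next
  fix g h assume "g \<in> stab S A" "h \<in> stab S A"
  then have g: "g \<in> S" "g \<in> carrier G" "act g A = A" and h: "h \<in> S" "h \<in> carrier G" "act h A = A"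
    using subgroup.subset[OF S] by (auto simp: stab_def)
  have "act (g \<otimes> h) A = A" using act_mult[OF g(2) h(2) A] g(3) h(3) by simp
  then show "g \<otimes> h \<in> stab S A" using g h S by (simp add: stab_def subgroup.m_closed)
qed

lemma indep_singleton: "indep {A}"
proof (rule indepI)
  fix F f B assume F: "finite F" "F \<subseteq> {A}" "sum f F = 0" "B \<in> F"
  then have "F = {B}" by auto
  then show "f B = 0" using F(3) by simp
qed

lemma indep_common:
  assumes ind: "indep \<A>" and sub: "\<And>A. A \<in> \<A> \<Longrightarrow> subsp A"
    and "A \<in> \<A>" "B \<in> \<A>" "v \<in> A" "v \<in> B" "v \<noteq> 0"
  shows "A = B"
proof (rule ccontr)
  assume "A \<noteq> B"
  then show False
    using indep_unique(2)[OF ind sub, of "{A}" "\<lambda>_. v" "{B}" "\<lambda>_. v" A] assms by simp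
qed

lemma indep_complement:
  assumes ind: "indep \<A>" and sub: "\<And>A. A \<in> \<A> \<Longrightarrow> subsp A" and A: "A \<in> \<A>"
    and a: "a \<in> A" "a \<in> span (\<Union>(\<A> - {A}))"
  shows "a = 0"
proof -
  obtain F f where F: "finite F" "F \<subseteq> \<A> - {A}" "\<And>B. B \<in> F \<Longrightarrow> f B \<in> B" "a = sum f F"
    using span_Union[of "\<A> - {A}" a] sub a(2) by blast
  then show ?thesis
    using indep_unique(2)[OF ind sub, of "{A}" "\<lambda>_. a" F f A] A a(1) by auto
qed

lemma projection_exists:
  assumes ind: "indep \<A>" and sub: "\<And>A. A \<in> \<A> \<Longrightarrow> subsp A" and A: "A \<in> \<A>"
  obtains p where "\<And>z. z \<in> span (\<Union>\<A>) \<Longrightarrow> p z \<in> A \<and> z - p z \<in> span (\<Union>(\<A> - {A}))"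
    and "\<And>z a. a \<in> A \<Longrightarrow> z - a \<in> span (\<Union>(\<A> - {A})) \<Longrightarrow> p z = a"
proof -
  let ?R = "span (\<Union>(\<A> - {A}))"
  define p where "p z = (SOME a. a \<in> A \<and> z - a \<in> ?R)" for z
  have uniq: "a = b" if "a \<in> A" "b \<in> A" "z - a \<in> ?R" "z - b \<in> ?R" for a b z
  proof -
    have "a - b \<in> A" using that sub[OF A] by (simp add: subsp_def subspace_diff)
    moreover have "(z - b) - (z - a) \<in> ?R" using that by (simp only: span_diff)
    ultimately have "a - b = 0" using indep_complement[OF ind sub A, of "a - b"] by simp
    then show ?thesis by simp
  qed
  have ex: "\<exists>a. a \<in> A \<and> z - a \<in> ?R" if z: "z \<in> span (\<Union>\<A>)" for z
  proof -
    have "\<Union>\<A> = A \<union> \<Union>(\<A> - {A})" using A by auto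
    then have "z \<in> span (A \<union> \<Union>(\<A> - {A}))" using z by simp
    then obtain x y where "x \<in> span A" "y \<in> ?R" "z = x + y" unfolding span_Un by blast
    moreover have "span A = A" using sub[OF A] by (simp add: subsp_def)
    ultimately show ?thesis by (intro exI[of _ x]) simp
  qed
  show ?thesis
  proof (rule that)
    show "p z \<in> A \<and> z - p z \<in> ?R" if "z \<in> span (\<Union>\<A>)" for z
      unfolding p_def using ex[OF that] by (rule someI_ex)
    show "p z = a" if "a \<in> A" "z - a \<in> ?R" for z a
    proof -
      have "p z \<in> A \<and> z - p z \<in> ?R" unfolding p_def
        using someI[of "\<lambda>a. a \<in> A \<and> z - a \<in> ?R" a] that by blast
      then show ?thesis using uniq that by blast
    qed
  qed
qed

lemma span_orb_eq:
  assumes S: "subgroup S G" and W: "irr S W" and A: "subsp A" "A \<subseteq> W" "A \<noteq> {0}"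
  shows "span (\<Union>(orb S A)) = W"
proof -
  have AV: "A \<subseteq> V" using A by (simp add: subsp_def)
  have Wsub: "subspace W" and Winv: "invsub S W" using W by (auto simp: irr_def invsub_def subsp_def)
  have "act g A \<subseteq> W" if "g \<in> S" for g using act_mono[OF A(2), of g] invsub_act[OF Winv that] by blast
  then have "\<Union>(orb S A) \<subseteq> W" by (auto simp: orb_def)
  then have "span (\<Union>(orb S A)) \<subseteq> W" using Wsub by (rule span_minimal)
  moreover have "A \<subseteq> span (\<Union>(orb S A))" using orb_self[OF S AV] span_superset by blast
  then have "span (\<Union>(orb S A)) \<noteq> {0}" using A subsp_0 by blast
  ultimately show ?thesis using W span_orb_invsub[OF S AV] by (auto simp: irr_def)
qed

text \<open>A part of Clifford theory. The translates of a nonzero invariant \<open>X\<close> inside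
  \<open>A\<close> span \<open>W\<close>, but only one translate \<open>E C\<close> of
  \<open>X\<close> lies in each block \<open>C\<close>; comparing components in the block
  \<open>A\<close> gives \<open>A \<subseteq> X\<close>.\<close>

lemma irr_stab:
  assumes S: "subgroup S G" and W: "irr S W" and A: "subsp A" "A \<subseteq> W" "A \<noteq> {0}"
    and ind: "indep (orb S A)"
  shows "irr (stab S A) A"
  unfolding irr_def
proof (intro conjI allI impI)
  have AV: "A \<subseteq> V" using A by (simp add: subsp_def)
  have SG: "S \<subseteq> carrier G" using S by (rule subgroup.subset)
  have T: "subgroup (stab S A) G" using stab_subgroup[OF S AV] .
  show "invsub (stab S A) A" using A(1) by (auto simp: invsub_def stab_def act_def)
  show "A \<noteq> {0}" by fact
  fix X assume X: "invsub (stab S A) X \<and> X \<subseteq> A"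
  then have Xs: "subsp X" by (simp add: invsub_def)
  have XV: "X \<subseteq> V" using Xs by (simp add: subsp_def)
  show "X = {0} \<or> X = A"
  proof (rule disjCI)
    assume "X \<noteq> A"
    show "X = {0}"
    proof (rule ccontr)
      assume X0: "X \<noteq> {0}"
      have spX: "span (\<Union>(orb S X)) = W" using span_orb_eq[OF S W Xs _ X0] X A by blast
      define g where "g C = (SOME g. g \<in> S \<and> act g A = C)" for C
      have g: "g C \<in> S \<and> act (g C) A = C" if "C \<in> orb S A" for C
        unfolding g_def using that by (intro someI_ex[of "\<lambda>g. g \<in> S \<and> act g A = C"]) (auto simp: orb_def)
      define E where "E C = act (g C) X" for C
      \<comment> \<open>The translate of \<open>X\<close> depends only on the block it lies in,
        because two elements that send \<open>A\<close> to the same block differ by an element of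
        the stabilizer.\<close>
      have E: "act h X = E (act h A)" if h: "h \<in> S" for h
      proof -
        define C where "C = act h A"
        have gC: "g C \<in> S" "act (g C) A = act h A" using g[of C] h by (auto simp: C_def orb_def)
        have G: "h \<in> carrier G" "g C \<in> carrier G" using h gC SG by auto
        have "act (inv (g C) \<otimes> h) A = act (inv (g C)) (act h A)" using G AV by (simp add: act_mult)
        also have "\<dots> = A" using gC(2)[symmetric] G AV by simp
        finally have "inv (g C) \<otimes> h \<in> stab S A"
          using h gC S by (simp add: stab_def subgroup.m_closed subgroup.m_inv_closed)
        then have e: "act (inv (g C) \<otimes> h) X = X" using invsub_act_eq[OF _ T] X by blast
        have "act (g C) X = act (g C) (act (inv (g C) \<otimes> h) X)" using e by simp
        also have "\<dots> = act (g C \<otimes> (inv (g C) \<otimes> h)) X" using G XV by (simp add: act_mult)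
        also have "g C \<otimes> (inv (g C) \<otimes> h) = h" using G by (simp flip: m_assoc)
        finally show ?thesis by (simp add: E_def C_def)
      qed
      have Esub: "subspace (E C)" if "C \<in> orb S A" for C
        using act_subsp[OF _ Xs, of "g C"] g[OF that] SG by (auto simp: E_def subsp_def)
      have EC: "E C \<subseteq> C" if "C \<in> orb S A" for C
        using act_mono[of X A "g C"] X g[OF that] by (simp add: E_def)
      have osub: "subsp C" if "C \<in> orb S A" for C using orb_subsp[OF SG A(1) that] .
      have Ao: "A \<in> orb S A" using orb_self[OF S AV] .
      have "\<one> \<in> S" using S by (rule subgroup.one_closed)
      then have EA: "E A = X" using E[of \<one>] act_one[OF AV] act_one[OF XV] by simp
      have "a \<in> X" if a: "a \<in> A" for a
      proof -
        have "\<Union>(orb S X) \<subseteq> (\<Union>C\<in>orb S A. E C)" using E by (auto simp: orb_def)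
        then have "a \<in> span (\<Union>C\<in>orb S A. E C)" using a A(2) spX span_mono by blast
        then obtain F f where F: "finite F" "F \<subseteq> orb S A" "\<forall>C\<in>F. f C \<in> E C" "a = sum f F"
          using span_UN[of "orb S A" E a] Esub by blast
        have fC: "f C \<in> C" if "C \<in> F" for C using F(2,3) EC that by blast
        note u = indep_unique[OF ind osub, of "{A}" "\<lambda>_. a" F f A]
        show "a \<in> X"
        proof (cases "A \<in> F")
          case True
          then have "a = f A" using u(1) Ao a F(1,2,4) fC by simp
          then show ?thesis using F(3) True EA by blast
        next
          case False
          then have "a = 0" using u(2) Ao a F(1,2,4) fC by simp
          then show ?thesis using subsp_0[OF Xs] by simp
        qed
      qed
      then show False using X \<open>X \<noteq> A\<close> by blast
    qed
  qed
qed

lemma weights_subsp: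
  assumes W: "subsp W" and H: "H \<subseteq> carrier G"
  shows "subsp (weights W H \<chi>)"
proof -
  have "subspace (weights W H \<chi>)"
  proof (rule subspaceI)
    show "0 \<in> weights W H \<chi>" using H subsp_0[OF W] by (auto simp: weight_space_def)
  next
    fix v w assume "v \<in> weights W H \<chi>" "w \<in> weights W H \<chi>"
    then show "v + w \<in> weights W H \<chi>"
      using W H by (auto simp: weight_space_def subsp_def subspace_add rep_add subset_iff scale_right_distrib)
  next
    fix c v assume "v \<in> weights W H \<chi>"
    then show "scale c v \<in> weights W H \<chi>"
      using W H by (auto simp: weight_space_def subsp_def subspace_scale rep_scale subset_iff mult.commute)
  qed
  then show ?thesis using W by (auto simp: subsp_def weight_space_def)
qed

text \<open>The stabilizer of a block permutes the remaining blocks. Hence the projection to the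
  block along the others commutes with the stabilizer.\<close>

lemma complement_invariant:
  assumes S: "subgroup S G" and A: "subsp A" and A': "A' \<in> orb S A"
    and h: "h \<in> stab S A'" and r: "r \<in> span (\<Union>(orb S A - {A'}))"
  shows "\<pi> h r \<in> span (\<Union>(orb S A - {A'}))"
proof -
  let ?R = "span (\<Union>(orb S A - {A'}))"
  have AV: "A \<subseteq> V" using A by (simp add: subsp_def)
  have SG: "S \<subseteq> carrier G" using S by (rule subgroup.subset)
  have osub: "subsp C" if "C \<in> orb S A" for C using orb_subsp[OF SG A that] .
  have A'V: "A' \<subseteq> V" using osub[OF A'] by (simp add: subsp_def)
  have hS: "h \<in> S" "h \<in> carrier G" "act h A' = A'" using h SG by (auto simp: stab_def)
  have RV: "\<Union>(orb S A - {A'}) \<subseteq> V" using orb_V[OF SG AV] by blast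
  have "act h ` (orb S A - {A'}) \<subseteq> orb S A - {A'}"
  proof
    fix B assume "B \<in> act h ` (orb S A - {A'})"
    then obtain C where C: "C \<in> orb S A" "C \<noteq> A'" "B = act h C" by auto
    have "B \<in> orb S A" using orb_act_left[OF S hS(1) AV] C by blast
    moreover have "B \<noteq> A'" using act_inj[OF hS(2), of C A'] C hS(3) osub[OF C(1)] A'V
      by (auto simp: subsp_def)
    ultimately show "B \<in> orb S A - {A'}" by blast
  qed
  then have "span (act h (\<Union>(orb S A - {A'}))) \<subseteq> ?R" unfolding act_Union by (intro span_mono) blast
  then have "act h ?R \<subseteq> ?R" using act_span[OF hS(2) RV] by simp
  then show ?thesis using r by (auto simp: act_def)
qed

text \<open>\<open>H\<close> permutes the finitely many components of a weight vector, so it has a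
  subgroup of finite index stabilizing the block of one of them, and the component is a weight
  vector of this subgroup. Finite dimension is inherited because the projection maps the weight
  space of \<open>W\<close> onto that of the block: a weight vector of the block is spread over its
  finite \<open>H\<close>-orbit to give a preimage.\<close>

lemma imprimitive_weight:
  assumes S: "subgroup S G" and W: "irr S W" and A: "subsp A" "A \<subseteq> W" "A \<noteq> {0}"
    and ind: "indep (orb S A)"
    and H: "subgroup H G" "H \<subseteq> S" and \<chi>: "is_char H \<chi>"
    and ne: "weights W H \<chi> \<noteq> {0}" and fd: "finite_dim (weights W H \<chi>)"
  obtains A' where "A' \<in> orb S A" "covered G H (stab H A')"
    "weights A' (stab H A') \<chi> \<noteq> {0}" "finite_dim (weights A' (stab H A') \<chi>)"
proof -
  have AV: "A \<subseteq> V" using A by (simp add: subsp_def)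
  have SG: "S \<subseteq> carrier G" using S by (rule subgroup.subset)
  have HG: "H \<subseteq> carrier G" using H SG by blast
  have Ws: "subsp W" using W by (simp add: irr_def invsub_def)
  have sp: "span (\<Union>(orb S A)) = W" using span_orb_eq[OF S W A] .
  have osub: "subsp C" if "C \<in> orb S A" for C using orb_subsp[OF SG A(1) that] .
  have wsub: "subsp (weights W H \<chi>)" using weights_subsp[OF Ws HG] .
  obtain e where e: "e \<in> weights W H \<chi>" "e \<noteq> 0" using ne subsp_0[OF wsub] by blast
  have eW: "e \<in> W" and eh: "\<And>h. h \<in> H \<Longrightarrow> \<pi> h e = scale (\<chi> h) e" using e by (auto simp: weight_space_def)
  obtain F0 f where F0: "finite F0" "F0 \<subseteq> orb S A" "\<And>C. C \<in> F0 \<Longrightarrow> f C \<in> C" "e = sum f F0"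
    using span_Union[of "orb S A" e] osub eW sp by blast
  define F where "F = {C \<in> F0. f C \<noteq> 0}"
  have eF: "e = sum f F" unfolding F_def F0(4) using F0(1) by (intro sum.mono_neutral_right) auto
  have F: "finite F" "F \<subseteq> orb S A" "\<And>C. C \<in> F \<Longrightarrow> f C \<in> C" "\<And>C. C \<in> F \<Longrightarrow> f C \<noteq> 0"
    using F0 by (auto simp: F_def)
  obtain A' where A': "A' \<in> F" using e(2) eF by (cases "F = {}") auto
  have eig: "\<pi> h (sum f F) = scale (\<chi> h) (sum f F)" if "h \<in> H" for h using eh[OF that] eF by simp
  have c0: "\<chi> h \<noteq> 0" if "h \<in> H" for h using \<chi> that by (simp add: is_char_def)
  have p1: "act h C \<in> F \<and> \<pi> h (f C) = scale (\<chi> h) (f (act h C))" if "h \<in> H" "C \<in> F" for h C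
    by (rule permute_finite_support(1)[OF ind S A(1) F(1,2) _ _ H]) (use F(3,4) eig that in auto)
  have p2: "covered G H {h \<in> H. \<forall>C\<in>F. act h C = C}"
    by (rule permute_finite_support(2)[OF ind S A(1) F(1,2) _ _ H, of f \<chi>]) (use F(3,4) eig in auto)
  define K where "K = stab H A'"
  have A'o: "A' \<in> orb S A" using A' F by blast
  have A's: "subsp A'" using osub[OF A'o] .
  have A'V: "A' \<subseteq> V" using A's by (simp add: subsp_def)
  have K: "subgroup K G" "K \<subseteq> H" using stab_subgroup[OF H(1) A'V] by (auto simp: K_def stab_def)
  have "covered G H K" by (rule covered_mono[OF p2 subset_refl]) (use A' in \<open>auto simp: K_def stab_def\<close>)
  moreover have "f A' \<in> weights A' K \<chi>"
  proof -
    have "\<pi> h (f A') = scale (\<chi> h) (f A')" if "h \<in> K" for h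
      using p1[of h A'] that A' by (simp add: K_def stab_def)
    then show ?thesis using F(3)[OF A'] by (simp add: weight_space_def)
  qed
  then have "weights A' K \<chi> \<noteq> {0}" using F(4)[OF A'] by blast
  moreover have "finite_dim (weights A' K \<chi>)"
  proof -
    let ?R = "span (\<Union>(orb S A - {A'}))"
    obtain p where p: "\<And>z. z \<in> span (\<Union>(orb S A)) \<Longrightarrow> p z \<in> A' \<and> z - p z \<in> ?R"
      and pu: "\<And>z a. a \<in> A' \<Longrightarrow> z - a \<in> ?R \<Longrightarrow> p z = a"
      using projection_exists[OF ind osub A'o] by blast
    have pW: "p z \<in> A' \<and> z - p z \<in> ?R" if "z \<in> W" for z using p sp that by blast
    have padd: "p (y + z) = p y + p z" if "y \<in> W" "z \<in> W" for y z
    proof (rule pu)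
      show "p y + p z \<in> A'" using pW that A's by (simp add: subsp_def subspace_add)
      have "(y - p y) + (z - p z) \<in> ?R" using pW that by (intro span_add) auto
      then show "y + z - (p y + p z) \<in> ?R" by (simp add: algebra_simps)
    qed
    have pscale: "p (scale c z) = scale c (p z)" if "z \<in> W" for c z
    proof (rule pu)
      show "scale c (p z) \<in> A'" using pW that A's by (simp add: subsp_def subspace_scale)
      have "scale c (z - p z) \<in> ?R" using pW that by (intro span_scale) auto
      then show "scale c z - scale c (p z) \<in> ?R" by (simp add: scale_right_diff_distrib)
    qed
    have Rinv: "\<pi> h r \<in> ?R" if h: "h \<in> K" and r: "r \<in> ?R" for h r
      using complement_invariant[OF S A(1) A'o _ r] h H(2) by (auto simp: K_def stab_def)
    obtain B where B: "finite B" "weights W H \<chi> = span B" using fd by (auto simp: finite_dim_def)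
    have Bw: "b \<in> W" "\<And>h. h \<in> H \<Longrightarrow> \<pi> h b = scale (\<chi> h) b" if "b \<in> B" for b
      using that B(2) span_base[of b B] by (auto simp: weight_space_def)
    have "weights A' K \<chi> = span (p ` B)"
    proof
      show "span (p ` B) \<subseteq> weights A' K \<chi>"
      proof (rule span_minimal)
        show "subspace (weights A' K \<chi>)" using weights_subsp[OF A's] K(2) HG by (auto simp: subsp_def)
        show "p ` B \<subseteq> weights A' K \<chi>"
        proof
          fix y assume "y \<in> p ` B"
          then obtain b where b: "b \<in> B" "y = p b" by auto
          have "\<pi> h (p b) = scale (\<chi> h) (p b)" if h: "h \<in> K" for h
          proof -
            have hH: "h \<in> H" "h \<in> carrier G" "act h A' = A'" using h HG by (auto simp: K_def stab_def)
            have pb: "p b \<in> A'" "b - p b \<in> ?R" using pW Bw b by auto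
            have bV: "b \<in> V" "p b \<in> V" using Bw(1)[OF b(1)] pb(1) Ws A'V by (auto simp: subsp_def)
            have "\<pi> h (p b) \<in> A'" using pb(1) hH(3) by (auto simp: act_def)
            moreover have "scale (\<chi> h) b - \<pi> h (p b) \<in> ?R"
              using Rinv[OF h pb(2)] Bw(2)[OF b(1) hH(1)] rep_diff[OF hH(2) bV] by simp
            ultimately have "p (scale (\<chi> h) b) = \<pi> h (p b)" by (rule pu)
            then show ?thesis using pscale Bw(1)[OF b(1)] by simp
          qed
          then show "y \<in> weights A' K \<chi>" using pW Bw b by (auto simp: weight_space_def)
        qed
      qed
      show "weights A' K \<chi> \<subseteq> span (p ` B)"
      proof
        fix w assume w: "w \<in> weights A' K \<chi>"
        have wA: "w \<in> A'" and wK: "\<And>h. h \<in> K \<Longrightarrow> \<pi> h w = scale (\<chi> h) w"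
          using w by (auto simp: weight_space_def)
        have wV: "w \<in> V" using wA A'V by blast
        define Ob where "Ob = orb H A'"
        have finO: "finite Ob"
        proof (rule finite_subset)
          show "Ob \<subseteq> F" using p1 A' by (auto simp: Ob_def orb_def)
        qed (rule F(1))
        define t where "t C = (SOME h. h \<in> H \<and> act h A' = C)" for C
        have t: "t C \<in> H \<and> act (t C) A' = C" if "C \<in> Ob" for C
          unfolding t_def using that
          by (intro someI_ex[of "\<lambda>h. h \<in> H \<and> act h A' = C"]) (auto simp: Ob_def orb_def)
        \<comment> \<open>The vector \<open>\<pi> h w\<close> divided by \<open>\<chi> h\<close>
          depends only on the coset of \<open>h\<close> modulo \<open>K\<close>, that is, on the
          block \<open>act h A'\<close>. This common value is \<open>s C\<close>.\<close>
        define s where "s C = scale (inverse (\<chi> (t C))) (\<pi> (t C) w)" for C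
        have tG: "t C \<in> carrier G" if "C \<in> Ob" for C using t[OF that] HG by blast
        have sV: "s C \<in> V" if "C \<in> Ob" for C using tG[OF that] wV by (simp add: s_def V_scale rep_closed)
        have sh: "\<pi> h w = scale (\<chi> h) (s (act h A'))" if h: "h \<in> H" for h
        proof -
          define C where "C = act h A'"
          have C: "C \<in> Ob" using h by (auto simp: C_def Ob_def orb_def)
          note tC = t[OF C] tG[OF C]
          have hG: "h \<in> carrier G" using h HG by blast
          define q where "q = inv (t C) \<otimes> h"
          have "act q A' = act (inv (t C)) C" using hG tC A'V by (simp add: q_def C_def flip: act_mult)
          also have "\<dots> = A'" using tC A'V by (metis act_inv)
          finally have "q \<in> K"
            using h tC H(1) by (simp add: q_def K_def stab_def subgroup.m_closed subgroup.m_inv_closed)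
          then have q: "\<pi> q w = scale (\<chi> q) w" "q \<in> H" "q \<in> carrier G" using wK K(2) HG by auto
          have hq: "h = t C \<otimes> q" using hG tC by (simp add: q_def) (simp flip: m_assoc)
          have "\<chi> h = \<chi> (t C) * \<chi> q" unfolding hq using \<chi> tC q by (simp add: is_char_def)
          moreover have "\<pi> h w = scale (\<chi> q) (\<pi> (t C) w)"
            unfolding hq using rep_mult[OF _ q(3) wV, of "t C"] tC q(1) rep_scale[OF _ wV] by simp
          moreover have "\<chi> (t C) \<noteq> 0" using c0 tC by blast
          ultimately show ?thesis unfolding C_def[symmetric] s_def by simp
        qed
        \<comment> \<open>The sum over the cosets of \<open>K\<close> in \<open>H\<close>: a weight
          vector of \<open>H\<close> whose component in \<open>A'\<close> is
          \<open>w\<close>.\<close>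
        define z where "z = sum s Ob"
        have OS: "Ob \<subseteq> orb S A"
        proof -
          have "orb H A' \<subseteq> orb S A'" using H(2) by (auto simp: orb_def)
          moreover obtain g where "g \<in> S" "A' = act g A" using A'o by (auto simp: orb_def)
          then have "orb S A' = orb S A" using orb_act_right[OF S _ AV] by blast
          ultimately show ?thesis by (simp add: Ob_def)
        qed
        have sC: "s C \<in> C" if C: "C \<in> Ob" for C
        proof -
          have "\<pi> (t C) w \<in> C" using t[OF C] wA by (auto simp: act_def)
          moreover have "subspace C" using osub OS C by (auto simp: subsp_def)
          ultimately show ?thesis by (simp add: s_def subspace_scale)
        qed
        have zW: "z \<in> W"
        proof -
          have "C \<subseteq> W" if "C \<in> orb S A" for C using sp that span_superset by blast
          then show ?thesis unfolding z_def using Ws sC OS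
            by (intro subspace_sum) (auto simp: subsp_def)
        qed
        have zH: "\<pi> h z = scale (\<chi> h) z" if h: "h \<in> H" for h
        proof -
          have hG: "h \<in> carrier G" using h HG by blast
          have "\<pi> h (s C) = scale (\<chi> h) (s (act h C))" if C: "C \<in> Ob" for C
          proof -
            note tC = t[OF C] tG[OF C]
            have "\<pi> h (s C) = scale (inverse (\<chi> (t C))) (\<pi> (h \<otimes> t C) w)"
              using hG tC wV by (simp add: s_def rep_scale rep_mult rep_closed)
            also have "\<dots> = scale (inverse (\<chi> (t C)) * \<chi> (h \<otimes> t C)) (s (act (h \<otimes> t C) A'))"
              using sh[of "h \<otimes> t C"] h tC H(1) by (simp add: subgroup.m_closed)
            also have "inverse (\<chi> (t C)) * \<chi> (h \<otimes> t C) = \<chi> h"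
              using \<chi> h tC by (simp add: is_char_def)
            also have "act (h \<otimes> t C) A' = act h C" using hG tC A'V by (metis act_mult)
            finally show ?thesis .
          qed
          then have "\<pi> h z = (\<Sum>C\<in>Ob. scale (\<chi> h) (s (act h C)))"
            unfolding z_def using hG sV by (simp add: rep_sum)
          also have "\<dots> = scale (\<chi> h) (\<Sum>C\<in>Ob. s (act h C))" by (simp add: scale_sum_right)
          also have "(\<Sum>C\<in>Ob. s (act h C)) = sum s Ob"
          proof -
            have "inj_on (act h) Ob" using act_inj[OF hG] osub OS by (auto simp: inj_on_def subsp_def subset_iff)
            moreover have "act h ` Ob = Ob" unfolding Ob_def using orb_act_left[OF H(1) h A'V] .
            ultimately show ?thesis by (metis sum.reindex_cong)
          qed
          finally show ?thesis by (simp add: z_def)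
        qed
        then have "z \<in> span B" using zW B(2) by (auto simp: weight_space_def)
        have "p z = w"
        proof (rule pu[OF wA])
          have A'Ob: "A' \<in> Ob" unfolding Ob_def using orb_self[OF H(1) A'V] .
          have "\<one> \<in> H" using H(1) by (rule subgroup.one_closed)
          then have "s A' = w"
          proof -
            assume one: "\<one> \<in> H"
            have "\<chi> \<one> * \<chi> \<one> = \<chi> \<one>" using \<chi> one by (auto simp: is_char_def dest!: bspec[of _ _ \<one>])
            then have "\<chi> \<one> = 1" using c0[OF one] by simp
            then show ?thesis using sh[OF one] act_one[OF A'V] rep_one[OF wV] by simp
          qed
          then have "z - w = sum s (Ob - {A'})" unfolding z_def using finO A'Ob by (simp add: sum.remove)
          also have "\<dots> \<in> ?R" using sC OS by (intro span_sum span_base) blast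
          finally show "z - w \<in> ?R" .
        qed
        moreover have "p y \<in> span (p ` B) \<and> y \<in> W" if "y \<in> span B" for y
          using that
        proof (induction rule: span_induct_alt)
          case base
          have "p (scale 0 0) = scale 0 (p 0)" using Ws subsp_0 by (intro pscale) auto
          then show ?case using subsp_0[OF Ws] by (simp add: span_zero)
        next
          case (step c b y)
          have cb: "scale c b \<in> W" "b \<in> W" using Bw(1)[OF step(1)] Ws by (auto simp: subsp_def subspace_scale)
          then have "p (scale c b + y) = scale c (p b) + p y" using padd pscale step(2) by simp
          moreover have "scale c (p b) + p y \<in> span (p ` B)"
            using step by (intro span_add[OF span_scale[OF span_base]]) auto
          ultimately show ?case using step cb Ws by (auto simp: subsp_def subspace_add)
        qed
        ultimately show "w \<in> span (p ` B)" using \<open>z \<in> span B\<close> by blast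
      qed
    qed
    then show ?thesis using B(1) by (auto simp: finite_dim_def)
  qed
  ultimately show ?thesis using that A'o by (simp add: K_def)
qed

text \<open>Induction in stages. The translates of the line inside a block \<open>act h A\<close>
  are the images under \<open>h\<close> of its orbit under the stabilizer of \<open>A\<close>, so
  they are independent; different blocks are independent of each other.\<close>

lemma monomial_trans:
  assumes S: "subgroup S G" and A: "subsp A" "A \<subseteq> W" and ind: "indep (orb S A)"
    and mon: "monomial (stab S A) A"
  shows "monomial S W"
proof -
  have AV: "A \<subseteq> V" using A by (simp add: subsp_def)
  have SG: "S \<subseteq> carrier G" using S by (rule subgroup.subset)
  have osub: "subsp C" if "C \<in> orb S A" for C using orb_subsp[OF SG A(1) that] .
  obtain e where e: "e \<in> A" "e \<noteq> 0" "indep (orb (stab S A) (span {e}))"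
    using mon by (auto simp: monomial_def)
  have eV: "span {e} \<subseteq> V" using e AV subsp_span[of "{e}"] by (auto simp: subsp_def)
  have eA: "span {e} \<subseteq> A" using e A(1) by (intro span_minimal) (auto simp: subsp_def)
  have "indep (orb S (span {e}))"
  proof (rule indep_group[OF ind osub])
    fix C assume "C \<in> orb S (span {e})"
    then show "\<exists>B\<in>orb S A. C \<subseteq> B" using act_mono[OF eA] by (auto simp: orb_def)
  next
    fix B assume B: "B \<in> orb S A"
    then obtain h where h: "h \<in> S" "B = act h A" by (auto simp: orb_def)
    have hG: "h \<in> carrier G" using h SG by auto
    have "{C \<in> orb S (span {e}). C \<subseteq> B} \<subseteq> act h ` orb (stab S A) (span {e})"
    proof
      fix C assume "C \<in> {C \<in> orb S (span {e}). C \<subseteq> B}"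
      then obtain g where g: "g \<in> S" "C = act g (span {e})" "C \<subseteq> B" by (auto simp: orb_def)
      have gG: "g \<in> carrier G" using g SG by auto
      have "\<pi> g e \<in> C" using g(2) span_base[of e "{e}"] by (auto simp: act_def)
      moreover have "\<pi> g e \<in> act g A" using e by (auto simp: act_def)
      moreover have "\<pi> g e \<noteq> 0" using rep_eq_0[OF gG] e AV by auto
      moreover have "act g A \<in> orb S A" using g by (auto simp: orb_def)
      ultimately have eq: "act g A = B" using indep_common[OF ind osub _ B] g(3) by blast
      have "act (inv h \<otimes> g) A = A" using eq h hG gG AV by (metis act_inv act_mult inv_closed)
      then have "inv h \<otimes> g \<in> stab S A"
        using g h S by (simp add: stab_def subgroup.m_closed subgroup.m_inv_closed)
      moreover have "act h (act (inv h \<otimes> g) (span {e})) = C"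
        unfolding g(2) using hG gG eV by (simp add: act_mult) (simp flip: m_assoc)
      ultimately show "C \<in> act h ` orb (stab S A) (span {e})" by (auto simp: orb_def)
    qed
    moreover have "indep (act h ` orb (stab S A) (span {e}))"
    proof (rule indep_act[OF e(3) hG])
      fix C assume "C \<in> orb (stab S A) (span {e})"
      then show "C \<subseteq> V" using act_V[OF _ eV] SG by (auto simp: orb_def stab_def)
    qed
    ultimately show "indep {C \<in> orb S (span {e}). C \<subseteq> B}" by (rule indep_mono[rotated])
  qed
  then show ?thesis using e A(2) by (auto simp: monomial_def)
qed

end

section \<open>Eigenvectors from finite weights\<close>

text \<open>If all power sums vanished, the sum of \<open>c * poly p c\<close> over \<open>C\<close>
  would vanish for every polynomial \<open>p\<close>. A polynomial with zeros at all points of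
  \<open>C\<close> but one excludes this.\<close>

lemma exists_nonzero_power_sum:
  fixes C :: "complex set"
  assumes C: "finite C" "C \<noteq> {}" "0 \<notin> C"
  shows "\<exists>r\<ge>1. (\<Sum>c\<in>C. c ^ r) \<noteq> 0"
proof (rule ccontr)
  assume "\<not> ?thesis"
  then have *: "(\<Sum>c\<in>C. c ^ r) = 0" if "r \<ge> 1" for r using that by blast
  have z: "(\<Sum>c\<in>C. c ^ Suc r) = 0" for r by (rule *) simp
  have P: "(\<Sum>c\<in>C. c * poly p c) = 0" for p :: "complex poly"
  proof -
    have "(\<Sum>c\<in>C. c * poly p c) = (\<Sum>c\<in>C. \<Sum>i\<le>degree p. coeff p i * c ^ Suc i)"
      by (simp add: poly_altdef sum_distrib_left algebra_simps)
    also have "\<dots> = (\<Sum>i\<le>degree p. coeff p i * (\<Sum>c\<in>C. c ^ Suc i))"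
      by (subst sum.swap) (simp only: sum_distrib_left)
    finally show ?thesis using z by simp
  qed
  obtain c0 where c0: "c0 \<in> C" using C by auto
  define p where "p = (\<Prod>c\<in>C - {c0}. [:-c, 1:])"
  have "poly p c = 0" if "c \<in> C - {c0}" for c
    unfolding p_def poly_prod using that C(1) by (intro prod_zero) auto
  then have "(\<Sum>c\<in>C - {c0}. c * poly p c) = 0" by (intro sum.neutral) simp
  then have "(\<Sum>c\<in>C. c * poly p c) = c0 * poly p c0" using C(1) c0 by (simp add: sum.remove)
  moreover have "poly p c0 \<noteq> 0" unfolding p_def poly_prod using C(1) by (simp add: prod_zero_iff)
  ultimately show False using P[of p] c0 C(3) by auto
qed

text \<open>A subgroup of a cyclic group is cyclic. The exponents \<open>I\<close> that occur in
  \<open>S\<close> form a subgroup of the integers, generated by its least positive element or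
  zero.\<close>

lemma (in cyclic_series) N_Int_gen:
  assumes i: "i \<le> k" and S: "subgroup S G"
  shows "\<exists>x\<in>N i \<inter> S. \<forall>a\<in>N i \<inter> S. \<exists>n::int. a \<otimes> inv (x [^] n) \<in> N (Suc i) \<inter> S"
proof -
  interpret q: group_hom G "G Mod N (Suc i)" "coset i" by (rule coset_hom[OF i])
  obtain x0 where x0: "x0 \<in> N i" and gen: "\<And>y. y \<in> N i \<Longrightarrow> \<exists>n::int. coset i y = coset i (x0 [^] n)"
    using coset_gen[OF i] by blast
  have xG: "x0 \<in> carrier G" using N_carrier[OF _ x0] i by auto
  have NS: "subgroup (N i \<inter> S) G" using i S by (intro subgroups_Inter_pair N_subgroup) auto
  have NSG: "N i \<inter> S \<subseteq> carrier G" using NS by (rule subgroup.subset)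
  define I where "I = {n::int. \<exists>a\<in>N i \<inter> S. coset i a = coset i (x0 [^] n)}"
  have step: "a \<otimes> inv (b [^] j) \<in> N i \<inter> S \<and> coset i (a \<otimes> inv (b [^] j)) = coset i (x0 [^] (n - m * j))"
    if a: "a \<in> N i \<inter> S" "coset i a = coset i (x0 [^] n)" and b: "b \<in> N i \<inter> S" "coset i b = coset i (x0 [^] m)"
    for a b and n m j :: int
  proof
    have G: "a \<in> carrier G" "b \<in> carrier G" using a b NSG by auto
    have "b [^] j \<in> N i \<inter> S" using subgroup_int_pow_closed[OF NS b(1)] .
    then show "a \<otimes> inv (b [^] j) \<in> N i \<inter> S"
      using a(1) NS by (meson subgroup.m_closed subgroup.m_inv_closed)
    have "coset i (b [^] j) = coset i ((x0 [^] m) [^] j)"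
      using b(2) G xG i by (intro coset_int_pow_cong) auto
    then have "coset i (inv (b [^] j)) = coset i (inv (x0 [^] (m * j)))"
      using G xG by (simp add: int_pow_pow q.hom_inv del: q.hom_int_pow)
    then have "coset i (a \<otimes> inv (b [^] j)) = coset i (x0 [^] n \<otimes> inv (x0 [^] (m * j)))"
      using a(2) q.hom_mult[of a "inv (b [^] j)"] q.hom_mult[of "x0 [^] n" "inv (x0 [^] (m * j))"] G xG
      by (simp only: inv_closed int_pow_closed)
    also have "x0 [^] n \<otimes> inv (x0 [^] (m * j)) = x0 [^] (n - m * j)"
      using int_pow_mult[OF xG, of n "- (m * j)"] int_pow_neg[OF xG, of "m * j"] by simp
    finally show "coset i (a \<otimes> inv (b [^] j)) = coset i (x0 [^] (n - m * j))" .
  qed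
  have Istep: "n - m * j \<in> I" if "n \<in> I" "m \<in> I" for n m j using that step unfolding I_def by blast
  have I0: "0 \<in> I" unfolding I_def
    using subgroup.one_closed[OF NS] by (intro CollectI bexI[of _ \<one>]) simp_all
  have "\<exists>d\<in>I. \<forall>n\<in>I. \<exists>j. n = d * j"
  proof (cases "\<exists>n::nat. n > 0 \<and> int n \<in> I")
    case True
    define d where "d = (LEAST n::nat. n > 0 \<and> int n \<in> I)"
    have d: "d > 0" "int d \<in> I" using LeastI_ex[OF True] by (auto simp: d_def)
    have "n = int d * (n div int d)" if n: "n \<in> I" for n
    proof -
      have r: "n mod int d \<in> I" using Istep[OF n d(2), of "n div int d"] by (simp add: minus_mult_div_eq_mod)
      have "n mod int d \<ge> 0" "n mod int d < int d" using d by auto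
      then have "nat (n mod int d) < d" "int (nat (n mod int d)) = n mod int d" by linarith+
      then have "\<not> nat (n mod int d) > 0"
        using not_less_Least[of "nat (n mod int d)" "\<lambda>n. n > 0 \<and> int n \<in> I"] r unfolding d_def by auto
      then have "n mod int d = 0" using \<open>n mod int d \<ge> 0\<close> by linarith
      then show ?thesis by (metis add.right_neutral mult_div_mod_eq)
    qed
    then show ?thesis using d(2) by blast
  next
    case False
    have "n = 0" if n: "n \<in> I" for n
    proof (rule ccontr)
      assume "n \<noteq> 0"
      then have "nat \<bar>n\<bar> > 0" by simp
      moreover have "int (nat \<bar>n\<bar>) \<in> I" using n Istep[OF I0 n, of 1] by (cases "n \<ge> 0") auto
      ultimately show False using False by blast
    qed
    then show ?thesis using I0 by force
  qed
  then obtain d where d: "d \<in> I" "\<And>n. n \<in> I \<Longrightarrow> \<exists>j. n = d * j" by blast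
  obtain x where x: "x \<in> N i \<inter> S" "coset i x = coset i (x0 [^] d)" using d(1) by (auto simp: I_def)
  show ?thesis
  proof (rule bexI[OF _ x(1)], rule ballI)
    fix a assume a: "a \<in> N i \<inter> S"
    obtain n :: int where n: "coset i a = coset i (x0 [^] n)" using gen a by blast
    then have "n \<in> I" using a by (auto simp: I_def)
    then obtain j where j: "n = d * j" using d(2) by blast
    have "a \<otimes> inv (x [^] j) \<in> N i \<inter> S" "coset i (a \<otimes> inv (x [^] j)) = coset i (x0 [^] (n - d * j))"
      using step[OF a n x] by auto
    moreover have "x0 [^] (n - d * j) = \<one>" using j by simp
    ultimately have "a \<otimes> inv (x [^] j) \<in> N i \<inter> S" "a \<otimes> inv (x [^] j) \<otimes> inv \<one> \<in> N (Suc i)"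
      using coset_eq_iff[OF i, of "a \<otimes> inv (x [^] j)" \<one>] NSG by auto
    then show "\<exists>n::int. a \<otimes> inv (x [^] n) \<in> N (Suc i) \<inter> S" using NSG by (intro exI[of _ j]) auto
  qed
qed

context complex_rep
begin

lemma rep_nat_pow: "x \<in> carrier G \<Longrightarrow> w \<in> V \<Longrightarrow> (\<pi> x ^^ n) w = \<pi> (x [^] n) w"
proof (induction n)
  case (Suc n)
  then have "(\<pi> x ^^ Suc n) w = \<pi> (x \<otimes> x [^] n) w" by (simp add: rep_mult)
  also have "x \<otimes> x [^] n = x [^] Suc n" using Suc.prems by (intro nat_pow_Suc2[symmetric])
  finally show ?case .
qed (simp add: rep_one)

lemma rep_int_pow_eigen:
  assumes x: "x \<in> carrier G" and w: "w \<in> V" and l: "l \<noteq> 0" "\<pi> x w = scale l w"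
  shows "\<pi> (x [^] (n::int)) w = scale (l powi n) w"
proof -
  have nat: "\<pi> (x [^] (n::nat)) w = scale (l ^ n) w" for n
    by (induction n) (use x w l in \<open>simp_all add: rep_one rep_mult rep_scale\<close>)
  show ?thesis
  proof (cases n rule: int_cases2)
    case (nonneg m)
    then show ?thesis using nat[of m] by (simp add: int_pow_int)
  next
    case (nonpos m)
    have "\<pi> (inv (x [^] m)) w = scale (inverse (l ^ m)) w"
      using eigenvector_inv[OF _ w _ nat[of m]] x l by simp
    then show ?thesis unfolding nonpos using x by (simp add: int_pow_neg int_pow_int power_int_minus)
  qed
qed

text \<open>
  The commutator condition makes the operators of the \<open>H\<close>-conjugates of \<open>x\<close> a finite set. Their
  power sums commute with \<open>H\<close>, hence preserve the finite dimensional weight space, and an eigenvector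
  of a suitable power sum is annihilated by a nonzero polynomial in \<open>x\<close>.
\<close>

lemma eigenvector_of_finite_weight:
  assumes S: "subgroup S G" and W: "invsub S W" and x: "x \<in> S"
    and conj: "\<And>g. g \<in> S \<Longrightarrow> \<exists>(a::int) c. c \<noteq> 0 \<and> (\<forall>w\<in>W. \<pi> (g \<otimes> x \<otimes> inv g) w = scale c (\<pi> (x [^] a) w))"
    and H: "subgroup H G" "H \<subseteq> S" and \<chi>: "is_char H \<chi>"
    and ne: "weights W H \<chi> \<noteq> {0}" and fd: "finite_dim (weights W H \<chi>)"
    and AC: "\<And>w. w \<in> W \<Longrightarrow> \<exists>D. covered G H D \<and> D \<subseteq> H \<and> (\<forall>h\<in>D. \<pi> (x \<otimes> h \<otimes> inv x \<otimes> inv h) w = w)"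
  shows "\<exists>l. \<exists>w\<in>W. w \<noteq> 0 \<and> \<pi> x w = scale l w"
proof (rule ccontr)
  assume noeig: "\<not> ?thesis"
  have SG: "S \<subseteq> carrier G" using S by (rule subgroup.subset)
  have HG: "H \<subseteq> carrier G" using H SG by blast
  have xG: "x \<in> carrier G" using x SG by auto
  have Ws: "subsp W" and WV: "W \<subseteq> V" using W by (auto simp: invsub_def subsp_def)
  have Wc: "\<pi> g w \<in> W" if "g \<in> S" "w \<in> W" for g w using W that by (simp add: invsub_def)
  have wV: "w \<in> V" if "w \<in> W" for w using WV that by auto
  have xS: "x [^] (n::int) \<in> S" for n using subgroup_int_pow_closed[OF S x] .
  have cS: "h \<otimes> x \<otimes> inv h \<in> S" if "h \<in> S" for h
    using that x S by (simp add: subgroup.m_closed subgroup.m_inv_closed)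
  interpret X: complex_operator scale W "\<pi> x"
    using Ws Wc[OF x] WV xG by unfold_locales (auto simp: subsp_def rep_add rep_scale subset_iff)
  \<comment> \<open>Without an eigenvector every nonzero polynomial in \<open>x\<close> is injective
    on \<open>W\<close>, and no nontrivial power of \<open>x\<close> is a scalar on any nonzero
    vector. The rest of the proof rests on this rigidity.\<close>
  have nopoly: "X.peval p w \<noteq> 0" if "p \<noteq> 0" "w \<in> W" "w \<noteq> 0" for p w
    using X.eigenvector_of_annihilator[OF that] noeig by blast
  have Xmonom: "X.peval (monom c n) w = scale c (\<pi> (x [^] n) w)" if "w \<in> W" for c n w
    using X.peval_monom[OF that] rep_nat_pow[OF xG wV[OF that]] by simp
  have nopos: "\<pi> (x [^] n) w \<noteq> scale c w" if n: "n > 0" and w: "w \<in> W" "w \<noteq> 0" for n :: nat and c w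
  proof
    assume e: "\<pi> (x [^] n) w = scale c w"
    have "X.peval (monom 1 n + monom (- c) 0) w = 0"
      using e w xG wV by (simp add: X.peval_add Xmonom rep_one)
    moreover have "coeff (monom 1 n + monom (- c) 0) n = 1" using n by simp
    then have "monom 1 n + monom (- c) 0 \<noteq> 0" by force
    ultimately show False using nopoly w by blast
  qed
  have nopow: "\<pi> (x [^] a) w \<noteq> scale c w" if a: "a \<noteq> 0" and w: "w \<in> W" "w \<noteq> 0" for a :: int and c w
  proof
    assume e: "\<pi> (x [^] a) w = scale c w"
    show False
    proof (cases a rule: int_cases2)
      case (nonneg n)
      then show ?thesis using nopos[of n w c] e a w by (simp add: int_pow_int)
    next
      case (nonpos n)
      have c0: "c \<noteq> 0" using eigenvalue_inv[of "x [^] a" w c] e xG w wV by blast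
      have "\<pi> (inv (x [^] a)) w = scale (inverse c) w"
        using eigenvector_inv[OF _ wV[OF w(1)] c0 e] xG by simp
      moreover have "inv (x [^] a) = x [^] n" using xG nonpos by (simp add: int_pow_neg int_pow_int)
      ultimately show ?thesis using nopos[of n w "inverse c"] a w nonpos by simp
    qed
  qed
  \<comment> \<open>The value 0 outside \<open>W\<close> makes equality of these functions the same
    as equality of operators on \<open>W\<close>.\<close>
  define op where "op h = (\<lambda>w. if w \<in> W then \<pi> (h \<otimes> x \<otimes> inv h) w else 0)" for h
  have op1: "op \<one> w = \<pi> x w" if "w \<in> W" for w using that xG by (simp add: op_def)
  define \<Xi> where "\<Xi> = op ` H"
  have oneH: "\<one> \<in> H" using H(1) by (rule subgroup.one_closed)
  have wsub: "subsp (weights W H \<chi>)" using weights_subsp[OF Ws HG] .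
  obtain w0 where w0: "w0 \<in> weights W H \<chi>" "w0 \<noteq> 0" using ne subsp_0[OF wsub] by blast
  have w0W: "w0 \<in> W" using w0 by (simp add: weight_space_def)
  obtain D where D: "covered G H D" "D \<subseteq> H" "\<And>h. h \<in> D \<Longrightarrow> \<pi> (x \<otimes> h \<otimes> inv x \<otimes> inv h) w0 = w0"
    using AC[OF w0W] by blast
  \<comment> \<open>The commutator hypothesis gives agreement of the conjugate with \<open>x\<close>
    at one vector only. But on \<open>W\<close> the conjugate is a multiple of a power of
    \<open>x\<close>, and agreement at one nonzero vector forces the exponent 1 and the factor 1,
    hence agreement everywhere.\<close>
  have Dfix: "\<pi> (h \<otimes> x \<otimes> inv h) w = \<pi> x w" if h: "h \<in> D" and w: "w \<in> W" for h w
  proof -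
    have hS: "h \<in> S" using h D(2) H(2) by auto
    have hG: "h \<in> carrier G" using hS SG by auto
    define y where "y = h \<otimes> x \<otimes> inv h"
    have yS: "y \<in> S" using cS[OF hS] by (simp add: y_def)
    have yG: "y \<in> carrier G" using yS SG by auto
    obtain a :: int and c where ac: "c \<noteq> 0" "\<And>w. w \<in> W \<Longrightarrow> \<pi> y w = scale c (\<pi> (x [^] a) w)"
      using conj[OF hS] unfolding y_def by blast
    define w1 where "w1 = \<pi> (inv y) w0"
    have w1: "w1 \<in> W" "w1 \<noteq> 0"
      using Wc[of "inv y" w0] yS S w0W w0(2) rep_eq_0[of "inv y" w0] yG wV
      by (auto simp: w1_def subgroup.m_inv_closed)
    have "x \<otimes> h \<otimes> inv x \<otimes> inv h = x \<otimes> inv y"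
      unfolding y_def using hG xG by (simp add: m_assoc inv_mult_group)
    then have "\<pi> x w1 = w0" using D(3)[OF h] xG yG w0W wV by (simp add: w1_def rep_mult)
    moreover have "\<pi> y w1 = w0" using yG w0W wV by (simp add: w1_def)
    ultimately have xw: "\<pi> x w1 = scale c (\<pi> (x [^] a) w1)" using ac(2)[OF w1(1)] by simp
    have "a = 1"
    proof (rule ccontr)
      assume a: "a \<noteq> 1"
      have "\<pi> (inv (x [^] a)) (\<pi> x w1) = scale c w1"
        unfolding xw using xG w1 wV by (simp add: rep_scale rep_closed)
      then have "\<pi> (inv (x [^] a) \<otimes> x) w1 = scale c w1" using xG w1 wV by (simp add: rep_mult)
      moreover have "inv (x [^] a) \<otimes> x = x [^] (1 - a)"
        using int_pow_mult[OF xG, of "- a" 1] int_pow_neg[OF xG, of a] xG by simp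
      ultimately show False using nopow[of "1 - a" w1 c] a w1 by simp
    qed
    moreover then have "\<pi> x w1 = scale c (\<pi> x w1)" using xw xG by simp
    then have "c = 1" using rep_eq_0[OF xG wV[OF w1(1)]] w1(2) by (metis scale_cancel_right scale_one)
    ultimately show ?thesis using ac(2)[OF w] xG by (simp add: y_def)
  qed
  have fin: "finite \<Xi>"
  proof -
    obtain F where F: "finite F" "F \<subseteq> carrier G" "H \<subseteq> (\<Union>f\<in>F. D #> f)" using D(1) by (auto simp: covered_def)
    define op' where "op' f = (\<lambda>w. if w \<in> W then \<pi> (inv f \<otimes> x \<otimes> f) w else 0)" for f
    have "\<Xi> \<subseteq> op' ` F"
    proof
      fix \<xi> assume "\<xi> \<in> \<Xi>"
      then obtain h where h: "h \<in> H" "\<xi> = op h" by (auto simp: \<Xi>_def)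
      have "inv h \<in> H" using h H(1) by (simp add: subgroup.m_inv_closed)
      \<comment> \<open>With right cosets it is \<open>inv h\<close> that has to be decomposed:
        conjugation by \<open>inv d\<close> then acts first, leaves the operator of \<open>x\<close>
        unchanged, and only \<open>f\<close> remains.\<close>
      then obtain f d where f: "f \<in> F" "d \<in> D" "inv h = d \<otimes> f" using F(3) by (auto simp: r_coset_def)
      have G: "h \<in> carrier G" "d \<in> carrier G" "f \<in> carrier G" using h f HG D(2) F(2) by auto
      have "f = inv d \<otimes> inv h" using f(3) G by (simp flip: m_assoc)
      then have fS: "f \<in> S" using f(2) D(2) h H S by (auto intro!: subgroup.m_closed subgroup.m_inv_closed)
      have "h = inv f \<otimes> inv d" using f(3) G by (metis inv_inv inv_mult_group)
      then have hx: "h \<otimes> x \<otimes> inv h = inv f \<otimes> (inv d \<otimes> x \<otimes> d) \<otimes> f"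
        using G xG by (simp add: m_assoc inv_mult_group)
      have "\<pi> (h \<otimes> x \<otimes> inv h) w = \<pi> (inv f \<otimes> x \<otimes> f) w" if w: "w \<in> W" for w
      proof -
        have fw: "\<pi> f w \<in> W" using Wc[OF fS w] .
        have v: "\<pi> d (\<pi> f w) \<in> W" using Wc[of d] fw f(2) D(2) H(2) by auto
        have v': "\<pi> x (\<pi> f w) \<in> W" using Wc[OF x fw] .
        have dS: "d \<in> S" using f(2) D(2) H(2) by auto
        have idS: "inv d \<in> S" using dS S by (simp add: subgroup.m_inv_closed)
        define u where "u = \<pi> (inv d) (\<pi> x (\<pi> d (\<pi> f w)))"
        have uW: "u \<in> W" using Wc[OF idS Wc[OF x v]] by (simp add: u_def)
        have "\<pi> d u = \<pi> x (\<pi> d (\<pi> f w))"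
          unfolding u_def using G(2) Wc[OF x v] wV by simp
        also have "\<dots> = \<pi> (d \<otimes> x \<otimes> inv d) (\<pi> d (\<pi> f w))" using Dfix[OF f(2) v] by simp
        also have "\<dots> = \<pi> d (\<pi> x (\<pi> f w))" using G xG fw v wV by (simp add: rep_mult rep_closed)
        finally have "u = \<pi> x (\<pi> f w)" using rep_inj[OF G(2)] uW v' wV by blast
        then have "\<pi> (inv d \<otimes> x \<otimes> d) (\<pi> f w) = \<pi> x (\<pi> f w)"
          using G xG fw wV by (simp add: rep_mult rep_closed u_def)
        then show ?thesis unfolding hx using G xG w wV by (simp add: rep_mult rep_closed)
      qed
      then have "\<xi> = op' f" unfolding h(2) op_def op'_def by auto
      then show "\<xi> \<in> op' ` F" using f(1) by blast
    qed
    then show ?thesis using F(1) finite_surj by blast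
  qed
  \<comment> \<open>Exponent and factor are mere choices; prescribing the exponent 1 for
    \<open>op \<one>\<close> guarantees that the largest exponent is positive.\<close>
  have "\<exists>c (a::int). c \<noteq> 0 \<and> (\<forall>w\<in>W. \<xi> w = scale c (\<pi> (x [^] a) w)) \<and> (\<xi> = op \<one> \<longrightarrow> a = 1)"
    if \<xi>: "\<xi> \<in> \<Xi>" for \<xi>
  proof (cases "\<xi> = op \<one>")
    case True
    then show ?thesis using op1 xG by (intro exI[of _ 1]) simp
  next
    case False
    obtain h where h: "h \<in> H" "\<xi> = op h" using \<xi> by (auto simp: \<Xi>_def)
    then have "h \<in> S" using H(2) by auto
    from conj[OF this] show ?thesis unfolding h(2) using False h(2) by (auto simp: op_def)
  qed
  then obtain cf and af :: "_ \<Rightarrow> int" where cf: "\<And>\<xi>. \<xi> \<in> \<Xi> \<Longrightarrow> cf \<xi> \<noteq> 0"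
    and caf: "\<And>\<xi> w. \<xi> \<in> \<Xi> \<Longrightarrow> w \<in> W \<Longrightarrow> \<xi> w = scale (cf \<xi>) (\<pi> (x [^] af \<xi>) w)"
    and af1: "op \<one> \<in> \<Xi> \<Longrightarrow> af (op \<one>) = 1"
    by metis
  have op1\<Xi>: "op \<one> \<in> \<Xi>" using oneH by (simp add: \<Xi>_def)
  have xpW: "\<pi> (x [^] (a::int)) w \<in> W" if "w \<in> W" for a w using Wc[OF xS that] .
  have pow: "(\<xi> ^^ r) w = scale (cf \<xi> ^ r) (\<pi> (x [^] (int r * af \<xi>)) w)" if \<xi>: "\<xi> \<in> \<Xi>" and w: "w \<in> W" for \<xi> r w
  proof (induction r)
    case 0
    then show ?case using rep_one wV[OF w] by simp
  next
    case (Suc r)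
    have s: "scale (cf \<xi> ^ r) (\<pi> (x [^] (int r * af \<xi>)) w) \<in> W"
      using xpW[OF w] Ws by (simp add: subsp_def subspace_scale)
    have "(\<xi> ^^ Suc r) w = scale (cf \<xi>) (\<pi> (x [^] af \<xi>) (scale (cf \<xi> ^ r) (\<pi> (x [^] (int r * af \<xi>)) w)))"
      using Suc caf[OF \<xi> s] by simp
    also have "\<dots> = scale (cf \<xi> ^ Suc r) (\<pi> (x [^] af \<xi>) (\<pi> (x [^] (int r * af \<xi>)) w))"
      using xG xpW[OF w] wV by (simp add: rep_scale)
    also have "\<pi> (x [^] af \<xi>) (\<pi> (x [^] (int r * af \<xi>)) w) = \<pi> (x [^] (af \<xi> + int r * af \<xi>)) w"
      using xG wV[OF w] by (simp add: rep_mult int_pow_mult)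
    finally show ?case by (simp add: algebra_simps)
  qed
  have powW: "(\<xi> ^^ r) w \<in> W" if "\<xi> \<in> \<Xi>" "w \<in> W" for \<xi> r w
    using pow[OF that] xpW[OF that(2)] Ws by (simp add: subsp_def subspace_scale)
  define A where "A = Max (af ` \<Xi>)"
  have Amax: "af \<xi> \<le> A" if "\<xi> \<in> \<Xi>" for \<xi> using that fin by (simp add: A_def)
  have A1: "A \<ge> 1" using Amax[OF op1\<Xi>] af1[OF op1\<Xi>] by simp
  have "A \<in> af ` \<Xi>" unfolding A_def using fin op1\<Xi> by (intro Max_in) auto
  define Top where "Top = {\<xi> \<in> \<Xi>. af \<xi> = A}"
  have Top: "finite Top" "Top \<noteq> {}" using fin \<open>A \<in> af ` \<Xi>\<close> by (auto simp: Top_def)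
  have supp: "\<xi> w = 0" if "\<xi> \<in> \<Xi>" "w \<notin> W" for \<xi> w using that by (auto simp: \<Xi>_def op_def)
  have injc: "inj_on cf Top"
  proof (rule inj_onI)
    fix \<xi> \<xi>' assume *: "\<xi> \<in> Top" "\<xi>' \<in> Top" "cf \<xi> = cf \<xi>'"
    show "\<xi> = \<xi>'"
    proof
      fix w show "\<xi> w = \<xi>' w"
        using caf[of \<xi> w] caf[of \<xi>' w] supp[of \<xi> w] supp[of \<xi>' w] * by (cases "w \<in> W") (auto simp: Top_def)
    qed
  qed
  \<comment> \<open>The operators with the largest exponent differ only by scalars, which may cancel
    in the plain sum. Raising every operator to a suitable power \<open>r\<close> prevents the
    cancellation.\<close>
  obtain r where r: "r \<ge> 1" "(\<Sum>c\<in>cf ` Top. c ^ r) \<noteq> 0"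
  proof -
    have "0 \<notin> cf ` Top" using cf by (force simp: Top_def)
    then show ?thesis using exists_nonzero_power_sum[of "cf ` Top"] Top that by blast
  qed
  then have rTop: "(\<Sum>\<xi>\<in>Top. cf \<xi> ^ r) \<noteq> 0" using injc by (simp add: sum.reindex)
  define p where "p w = (\<Sum>\<xi>\<in>\<Xi>. (\<xi> ^^ r) w)" for w
  \<comment> \<open>Conjugation by \<open>\<pi> h\<close> permutes \<open>\<Xi>\<close>; this is why
    the sum \<open>p\<close> commutes with \<open>H\<close>.\<close>
  define \<Phi> where "\<Phi> h \<xi> = (\<lambda>w. if w \<in> W then \<pi> h (\<xi> (\<pi> (inv h) w)) else 0)" for h and \<xi> :: "'v \<Rightarrow> 'v"
  have \<Phi>op: "\<Phi> h (op h') = op (h \<otimes> h')" if h: "h \<in> H" and h': "h' \<in> H" for h h'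
  proof
    fix w
    have G: "h \<in> carrier G" "h' \<in> carrier G" using that HG by auto
    have ihS: "inv h \<in> S" using h H S by (meson subgroup.m_inv_closed subsetD)
    show "\<Phi> h (op h') w = op (h \<otimes> h') w"
    proof (cases "w \<in> W")
      case True
      then have "\<pi> (inv h) w \<in> W" using Wc[OF ihS] by blast
      then have "\<Phi> h (op h') w = \<pi> h (\<pi> (h' \<otimes> x \<otimes> inv h') (\<pi> (inv h) w))" using True by (simp add: \<Phi>_def op_def)
      also have "\<dots> = \<pi> (h \<otimes> (h' \<otimes> x \<otimes> inv h') \<otimes> inv h) w" using G xG True wV by (simp add: rep_mult rep_closed)
      also have "h \<otimes> (h' \<otimes> x \<otimes> inv h') \<otimes> inv h = (h \<otimes> h') \<otimes> x \<otimes> inv (h \<otimes> h')"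
        using G xG by (simp add: m_assoc inv_mult_group)
      finally show ?thesis using True by (simp add: op_def)
    qed (simp add: \<Phi>_def op_def)
  qed
  have \<Phi>bij: "bij_betw (\<Phi> h) \<Xi> \<Xi>" if h: "h \<in> H" for h
  proof (rule bij_betw_byWitness[where f' = "\<Phi> (inv h)"])
    have ih: "inv h \<in> H" using h H(1) by (simp add: subgroup.m_inv_closed)
    have hG: "h \<in> carrier G" using h HG by auto
    have m: "h' \<in> carrier G" "h \<otimes> h' \<in> H" "inv h \<otimes> h' \<in> H" if "h' \<in> H" for h'
      using that h ih H(1) HG by (auto simp: subgroup.m_closed)
    have e: "inv h \<otimes> (h \<otimes> h') = h'" "h \<otimes> (inv h \<otimes> h') = h'" if "h' \<in> H" for h'
      using m[OF that] hG by (simp_all flip: m_assoc)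
    show "\<forall>\<xi>\<in>\<Xi>. \<Phi> (inv h) (\<Phi> h \<xi>) = \<xi>" using \<Phi>op h ih m e by (auto simp: \<Xi>_def)
    show "\<forall>\<xi>\<in>\<Xi>. \<Phi> h (\<Phi> (inv h) \<xi>) = \<xi>" using \<Phi>op h ih m e by (auto simp: \<Xi>_def)
    show "\<Phi> h ` \<Xi> \<subseteq> \<Xi>" using \<Phi>op h m by (auto simp: \<Xi>_def)
    show "\<Phi> (inv h) ` \<Xi> \<subseteq> \<Xi>" using \<Phi>op ih m by (auto simp: \<Xi>_def)
  qed
  have \<Phi>pow: "\<pi> h ((\<xi> ^^ n) w) = (\<Phi> h \<xi> ^^ n) (\<pi> h w)" if h: "h \<in> H" and \<xi>: "\<xi> \<in> \<Xi>" and w: "w \<in> W" for h \<xi> n w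
  proof (induction n)
    case (Suc n)
    have hS: "h \<in> S" "h \<in> carrier G" using h H(2) SG by auto
    have v: "(\<xi> ^^ n) w \<in> W" using powW[OF \<xi> w] .
    then have "\<Phi> h \<xi> (\<pi> h ((\<xi> ^^ n) w)) = \<pi> h (\<xi> ((\<xi> ^^ n) w))"
      using Wc[OF hS(1) v] hS wV by (simp add: \<Phi>_def)
    then show ?case using Suc by simp
  qed simp
  have pE: "\<pi> h (p e) = scale (\<chi> h) (p e)" if e: "e \<in> weights W H \<chi>" and h: "h \<in> H" for e h
  proof -
    have eW: "e \<in> W" and he: "\<pi> h e = scale (\<chi> h) e" using e h by (auto simp: weight_space_def)
    have hG: "h \<in> carrier G" using h HG by auto
    have "\<pi> h (p e) = (\<Sum>\<xi>\<in>\<Xi>. \<pi> h ((\<xi> ^^ r) e))"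
      unfolding p_def using hG powW eW wV by (intro rep_sum) auto
    also have "\<dots> = (\<Sum>\<xi>\<in>\<Xi>. (\<Phi> h \<xi> ^^ r) (\<pi> h e))" using \<Phi>pow[OF h _ eW] by simp
    also have "\<dots> = (\<Sum>\<xi>\<in>\<Xi>. (\<xi> ^^ r) (\<pi> h e))"
      by (rule sum.reindex_bij_betw[OF \<Phi>bij[OF h], of "\<lambda>\<xi>. (\<xi> ^^ r) (\<pi> h e)"])
    also have "\<dots> = (\<Sum>\<xi>\<in>\<Xi>. scale (\<chi> h) ((\<xi> ^^ r) e))"
    proof (rule sum.cong[OF refl])
      fix \<xi> assume \<xi>: "\<xi> \<in> \<Xi>"
      have s: "scale (\<chi> h) e \<in> W" using eW Ws by (simp add: subsp_def subspace_scale)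
      show "(\<xi> ^^ r) (\<pi> h e) = scale (\<chi> h) ((\<xi> ^^ r) e)"
        unfolding he pow[OF \<xi> s] pow[OF \<xi> eW] using xG eW wV by (simp add: rep_scale mult.commute)
    qed
    also have "\<dots> = scale (\<chi> h) (p e)" by (simp add: p_def scale_sum_right)
    finally show ?thesis .
  qed
  have pW: "p w \<in> W" if "w \<in> W" for w unfolding p_def using powW[OF _ that] Ws by (intro subspace_sum) (auto simp: subsp_def)
  have EW: "weights W H \<chi> \<subseteq> W" by (auto simp: weight_space_def)
  interpret E: complex_operator scale "weights W H \<chi>" p
  proof unfold_locales
    show "subspace (weights W H \<chi>)" using wsub by (simp add: subsp_def)
    show "p w \<in> weights W H \<chi>" if "w \<in> weights W H \<chi>" for w
      using pE[OF that] pW that EW by (auto simp: weight_space_def)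
    show "p (v + w) = p v + p w" if "v \<in> weights W H \<chi>" "w \<in> weights W H \<chi>" for v w
    proof -
      have vw: "v \<in> W" "w \<in> W" using that EW by auto
      then have "v + w \<in> W" using Ws by (simp add: subsp_def subspace_add)
      note vw = vw this
      have "(\<xi> ^^ r) (v + w) = (\<xi> ^^ r) v + (\<xi> ^^ r) w" if "\<xi> \<in> \<Xi>" for \<xi>
        using pow[OF that] vw xG wV by (simp add: rep_add scale_right_distrib)
      then show ?thesis by (simp add: p_def sum.distrib)
    qed
    show "p (scale c w) = scale c (p w)" if "w \<in> weights W H \<chi>" for c w
    proof -
      have cw: "w \<in> W" using that EW by auto
      then have "scale c w \<in> W" using Ws by (simp add: subsp_def subspace_scale)
      note cw = cw this
      have "(\<xi> ^^ r) (scale c w) = scale c ((\<xi> ^^ r) w)" if "\<xi> \<in> \<Xi>" for \<xi>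
        using pow[OF that] cw xG wV by (simp add: rep_scale mult.commute)
      then show ?thesis by (simp add: p_def scale_sum_right)
    qed
  qed
  obtain B where B: "finite B" "weights W H \<chi> = span B" using fd by (auto simp: finite_dim_def)
  obtain \<mu> e where e: "e \<in> weights W H \<chi>" "e \<noteq> 0" "p e = scale \<mu> e"
    using E.eigenvector_of_finite_dim[OF B(1)] B(2) ne by auto
  have eW: "e \<in> W" using e EW by auto
  \<comment> \<open>Exponents may be negative. Multiplication by \<open>x [^] M\<close> makes all of
    them nonnegative and turns the relation \<open>p e = scale \<mu> e\<close> into a polynomial
    \<open>P\<close> in \<open>x\<close> that annihilates \<open>e\<close>.\<close>
  define M where "M = (\<Sum>\<xi>\<in>\<Xi>. nat \<bar>int r * af \<xi>\<bar>)"
  have M: "int M + int r * af \<xi> \<ge> 0" if "\<xi> \<in> \<Xi>" for \<xi>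
  proof -
    have "nat \<bar>int r * af \<xi>\<bar> \<le> M" unfolding M_def using that fin by (intro member_le_sum) auto
    then show ?thesis by linarith
  qed
  define m where "m \<xi> = nat (int M + int r * af \<xi>)" for \<xi>
  define P where "P = (\<Sum>\<xi>\<in>\<Xi>. monom (cf \<xi> ^ r) (m \<xi>)) + monom (- \<mu>) M"
  have "X.peval P e = (\<Sum>\<xi>\<in>\<Xi>. scale (cf \<xi> ^ r) (\<pi> (x [^] m \<xi>) e)) - scale \<mu> (\<pi> (x [^] M) e)"
    unfolding P_def using eW by (simp add: X.peval_add X.peval_sum Xmonom)
  also have "(\<Sum>\<xi>\<in>\<Xi>. scale (cf \<xi> ^ r) (\<pi> (x [^] m \<xi>) e)) = (\<Sum>\<xi>\<in>\<Xi>. \<pi> (x [^] M) ((\<xi> ^^ r) e))"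
  proof (rule sum.cong[OF refl])
    fix \<xi> assume \<xi>: "\<xi> \<in> \<Xi>"
    have "x [^] m \<xi> = x [^] (int M + int r * af \<xi>)" using M[OF \<xi>] by (simp add: m_def flip: int_pow_int)
    also have "\<dots> = x [^] M \<otimes> x [^] (int r * af \<xi>)" using xG by (simp add: int_pow_mult int_pow_int)
    finally show "scale (cf \<xi> ^ r) (\<pi> (x [^] m \<xi>) e) = \<pi> (x [^] M) ((\<xi> ^^ r) e)"
      using pow[OF \<xi> eW] xG wV[OF eW] wV[OF xpW[OF eW]] by (simp add: rep_mult rep_scale)
  qed
  also have "\<dots> = \<pi> (x [^] M) (p e)" unfolding p_def using xG powW eW wV by (intro rep_sum[symmetric]) auto
  also have "\<dots> = scale \<mu> (\<pi> (x [^] M) e)" unfolding e(3) using xG wV[OF eW] by (simp add: rep_scale)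
  finally have P0: "X.peval P e = 0" by simp
  \<comment> \<open>The degree at which exactly the operators in \<open>Top\<close> contribute. It
    differs from \<open>M\<close>, the degree of the term with \<open>\<mu>\<close>, because
    \<open>r\<close> and \<open>A\<close> are positive.\<close>
  define d where "d = nat (int M + int r * A)"
  have "1 * 1 \<le> int r * A" using A1 r(1) by (intro mult_mono) auto
  then have rA: "int r * A \<ge> 1" by simp
  have d: "int d = int M + int r * A" using rA by (simp add: d_def)
  then have dM: "d \<noteq> M" using rA by auto
  have md: "m \<xi> = d \<longleftrightarrow> af \<xi> = A" if "\<xi> \<in> \<Xi>" for \<xi>
  proof
    assume "m \<xi> = d"
    moreover have "int (m \<xi>) = int M + int r * af \<xi>" using M[OF that] by (simp add: m_def)
    ultimately have "int r * af \<xi> = int r * A" using d by linarith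
    then show "af \<xi> = A" using r(1) by auto
  qed (simp add: m_def d_def)
  have "coeff P d = (\<Sum>\<xi>\<in>\<Xi>. if m \<xi> = d then cf \<xi> ^ r else 0)" using dM by (simp add: P_def coeff_sum)
  also have "\<dots> = (\<Sum>\<xi>\<in>Top. cf \<xi> ^ r)" unfolding Top_def using fin md
    by (simp add: sum.inter_filter cong: sum.cong)
  finally have "P \<noteq> 0" using rTop by auto
  then show False using nopoly[OF _ eW e(2)] P0 by blast
qed

end

section \<open>Eigenspaces of one element as a system of imprimitivity\<close>

context complex_rep
begin

definition eigsp :: "'v set \<Rightarrow> 'g \<Rightarrow> complex \<Rightarrow> 'v set" where
  "eigsp W x l = {w \<in> W. \<pi> x w = scale l w}"

lemma eigsp_subsp:
  assumes W: "subsp W" and x: "x \<in> carrier G"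
  shows "subsp (eigsp W x l)"
proof -
  have WV: "W \<subseteq> V" using W by (simp add: subsp_def)
  have "subspace (eigsp W x l)"
  proof (rule subspaceI)
    show "0 \<in> eigsp W x l" using subsp_0[OF W] x by (simp add: eigsp_def)
  next
    fix v w assume "v \<in> eigsp W x l" "w \<in> eigsp W x l"
    then show "v + w \<in> eigsp W x l"
      using W WV x rep_add[OF x, of v w] by (auto simp: eigsp_def subsp_def subspace_add scale_right_distrib)
  next
    fix c v assume "v \<in> eigsp W x l"
    then show "scale c v \<in> eigsp W x l"
      using W WV x rep_scale[OF x, of v c] by (auto simp: eigsp_def subsp_def subspace_scale mult.commute)
  qed
  then show ?thesis using WV by (auto simp: subsp_def eigsp_def)
qed

text \<open>The usual elimination by \<open>x\<close> minus one eigenvalue. Scalars that are not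
  eigenvalues all give the member \<open>{0}\<close>, so \<open>l\<close> selects one scalar for
  each member, and distinct members get distinct scalars.\<close>

lemma eigsp_indep:
  assumes W: "subsp W" and x: "x \<in> carrier G"
  shows "indep (range (eigsp W x))"
proof (rule indepI)
  define l where "l A = (SOME l. A = eigsp W x l)" for A
  have l: "A = eigsp W x (l A)" if "A \<in> range (eigsp W x)" for A
    unfolding l_def using that by (intro someI_ex[of "\<lambda>l. A = eigsp W x l"]) auto
  have WV: "W \<subseteq> V" using W by (simp add: subsp_def)
  fix F f A
  assume F: "finite F" "F \<subseteq> range (eigsp W x)" "\<And>A. A \<in> F \<Longrightarrow> f A \<in> A" "sum f F = 0" "A \<in> F"
  have "\<forall>A\<in>F. f A = 0"
    using F(1-4)
  proof (induction F arbitrary: f rule: finite_induct)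
    case (insert B F)
    have fA: "f A \<in> V" "\<pi> x (f A) = scale (l A) (f A)" if "A \<in> insert B F" for A
    proof -
      have "f A \<in> eigsp W x (l A)" using insert.prems(2)[OF that] l[of A] insert.prems(1) that by blast
      then show "f A \<in> V" "\<pi> x (f A) = scale (l A) (f A)" using WV by (auto simp: eigsp_def)
    qed
    have "0 = \<pi> x (sum f (insert B F)) - scale (l B) (sum f (insert B F))"
      using insert.prems(3) x by simp
    also have "\<pi> x (sum f (insert B F)) = (\<Sum>A\<in>insert B F. scale (l A) (f A))"
      by (rule trans[OF rep_sum[OF x] sum.cong[OF refl]]) (use fA in auto)
    also have "\<dots> - scale (l B) (sum f (insert B F)) = (\<Sum>A\<in>insert B F. scale (l A - l B) (f A))"
      by (simp add: scale_sum_right sum_subtractf scale_left_diff_distrib del: sum.insert)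
    also have "\<dots> = (\<Sum>A\<in>F. scale (l A - l B) (f A))" using insert.hyps by simp
    finally have s: "(\<Sum>A\<in>F. scale (l A - l B) (f A)) = 0" by simp
    have m: "scale (l A - l B) (f A) \<in> A" if "A \<in> F" for A
    proof -
      have "A \<in> range (eigsp W x)" using that insert.prems(1) by blast
      then have "subspace A" using eigsp_subsp[OF W x] by (auto simp: subsp_def)
      then show ?thesis using insert.prems(2) that by (simp add: subspace_scale)
    qed
    have z: "f A = 0" if A: "A \<in> F" for A
    proof -
      have "scale (l A - l B) (f A) = 0"
        using insert.IH[of "\<lambda>A. scale (l A - l B) (f A)"] m s insert.prems(1) A by blast
      moreover have "l A \<noteq> l B"
      proof
        assume "l A = l B"
        then have "A = B" using l[of A] l[of B] insert.prems(1) A by auto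
        then show False using A insert.hyps by blast
      qed
      ultimately show ?thesis by simp
    qed
    then have "f B = 0" using insert.prems(3) insert.hyps by simp
    then show ?case using z by blast
  qed simp
  then show "f A = 0" using F(5) by blast
qed

text \<open>As the conjugates of \<open>x\<close> act as multiples of powers of \<open>x\<close>,
  each \<open>g\<close> maps an eigenspace of \<open>x\<close> into another one. The same for
  \<open>inv g\<close> gives equality, where the nonzero \<open>w\<close> shows that the way back
  ends in the original eigenspace.\<close>

lemma eigsp_orb:
  assumes S: "subgroup S G" and W: "invsub S W" and x: "x \<in> S"
    and conj: "\<And>g. g \<in> S \<Longrightarrow> \<exists>(a::int) c. c \<noteq> 0 \<and> (\<forall>w\<in>W. \<pi> (g \<otimes> x \<otimes> inv g) w = scale c (\<pi> (x [^] a) w))"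
    and w: "w \<in> eigsp W x l" "w \<noteq> 0"
  shows "orb S (eigsp W x l) \<subseteq> range (eigsp W x)"
proof -
  have SG: "S \<subseteq> carrier G" using S by (rule subgroup.subset)
  have xG: "x \<in> carrier G" using x SG by auto
  have WV: "W \<subseteq> V" using W by (simp add: invsub_def subsp_def)
  have step: "\<exists>l'. act g (eigsp W x l) \<subseteq> eigsp W x l'" if g: "g \<in> S" and l: "l \<noteq> 0" for g l
  proof -
    have gG: "g \<in> carrier G" using g SG by auto
    have "inv g \<in> S" using g S by (simp add: subgroup.m_inv_closed)
    from conj[OF this] obtain a :: int and c
      where ac: "\<And>w. w \<in> W \<Longrightarrow> \<pi> (inv g \<otimes> x \<otimes> g) w = scale c (\<pi> (x [^] a) w)"
      using gG by auto
    have "\<pi> g w \<in> eigsp W x (c * l powi a)" if w: "w \<in> eigsp W x l" for w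
    proof -
      have wW: "w \<in> W" "\<pi> x w = scale l w" using w by (auto simp: eigsp_def)
      have wV: "w \<in> V" using wW WV by auto
      have "\<pi> (inv g \<otimes> x \<otimes> g) w = scale (c * l powi a) w"
        using ac[OF wW(1)] rep_int_pow_eigen[OF xG wV l wW(2)] by simp
      then have "\<pi> g (\<pi> (inv g \<otimes> x \<otimes> g) w) = scale (c * l powi a) (\<pi> g w)"
        using gG wV by (simp add: rep_scale)
      moreover have "\<pi> g (\<pi> (inv g \<otimes> x \<otimes> g) w) = \<pi> x (\<pi> g w)"
        using gG xG wV by (simp add: rep_mult rep_closed)
      moreover have "\<pi> g w \<in> W" using W g wW by (simp add: invsub_def)
      ultimately show ?thesis by (simp add: eigsp_def)
    qed
    then show ?thesis by (auto simp: act_def)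
  qed
  have "act g (eigsp W x l) \<in> range (eigsp W x)" if g: "g \<in> S" for g
  proof -
    have gG: "g \<in> carrier G" "inv g \<in> S" using g SG S by (auto simp: subgroup.m_inv_closed)
    have wV: "w \<in> V" "w \<in> W" using w WV by (auto simp: eigsp_def)
    have EV: "eigsp W x l \<subseteq> V" for l using WV by (auto simp: eigsp_def)
    have l0: "l \<noteq> 0" using eigenvalue_inv[of x w l] xG w wV by (simp add: eigsp_def)
    obtain l' where l': "act g (eigsp W x l) \<subseteq> eigsp W x l'" using step[OF g l0] by blast
    have gw: "\<pi> g w \<in> eigsp W x l'" "\<pi> g w \<noteq> 0" using l' w rep_eq_0[OF gG(1) wV(1)] by (auto simp: act_def)
    then have l'0: "l' \<noteq> 0" using eigenvalue_inv[of x "\<pi> g w" l'] xG gG wV by (simp add: eigsp_def rep_closed)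
    obtain l'' where l'': "act (inv g) (eigsp W x l') \<subseteq> eigsp W x l''" using step[OF gG(2) l'0] by blast
    then have "\<pi> (inv g) (\<pi> g w) \<in> eigsp W x l''" using gw by (auto simp: act_def)
    then have "w \<in> eigsp W x l''" using gG wV by simp
    then have "l'' = l" using w by (auto simp: eigsp_def)
    then have "act g (act (inv g) (eigsp W x l')) \<subseteq> act g (eigsp W x l)" using l'' by (intro act_mono) simp
    then have "eigsp W x l' \<subseteq> act g (eigsp W x l)" using gG EV by simp
    then show ?thesis using l' by blast
  qed
  then show ?thesis by (auto simp: orb_def)
qed

definition scalar_on :: "'g set \<Rightarrow> 'v set \<Rightarrow> bool" where
  "scalar_on X W \<longleftrightarrow> (\<forall>g\<in>X. \<exists>c. \<forall>w\<in>W. \<pi> g w = scale c w)"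

text \<open>Every line in \<open>W\<close> is invariant, so \<open>W\<close> is itself a line and
  equals all its translates.\<close>

lemma monomial_of_scalar:
  assumes S: "subgroup S G" and W: "irr S W" and sc: "scalar_on S W"
  shows "monomial S W"
proof -
  have Winv: "invsub S W" and Ws: "subsp W" and WV: "W \<subseteq> V"
    using W by (auto simp: irr_def invsub_def subsp_def)
  obtain e where e: "e \<in> W" "e \<noteq> 0" using W subsp_0[OF Ws] by (auto simp: irr_def)
  have eW: "span {e} \<subseteq> W" using e Ws by (intro span_minimal) (auto simp: subsp_def)
  have "invsub S (span {e})"
    unfolding invsub_def
  proof (intro conjI ballI)
    show "subsp (span {e})" using e WV by (intro subsp_span) auto
    fix g y assume g: "g \<in> S" and y: "y \<in> span {e}"
    obtain c where "\<pi> g y = scale c y" using sc g y eW unfolding scalar_on_def by blast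
    then show "\<pi> g y \<in> span {e}" using y by (simp add: span_scale)
  qed
  then have eq: "span {e} = W" using W eW e span_base[of e "{e}"] unfolding irr_def by blast
  have "orb S W \<subseteq> {W}" using invsub_act_eq[OF Winv S] by (auto simp: orb_def)
  then have "indep (orb S (span {e}))" unfolding eq by (rule indep_mono[OF indep_singleton])
  then show ?thesis using e by (auto simp: monomial_def)
qed

end

section \<open>Descent along the series by passing to eigenspaces\<close>

context series_rep
begin

text \<open>Once \<open>N (Suc m) \<inter> S\<close> acts by scalars, \<open>N m \<inter> S\<close>
  acts through scalars and powers of one element \<open>x\<close>, so on an eigenspace of
  \<open>x\<close> its part in the stabilizer acts by scalars as well. At \<open>m = 0\<close> this
  part is the whole group. In the commutator condition \<open>D\<close> may depend on
  \<open>w\<close>; this weak form holds for classes and is inherited by smaller \<open>W\<close>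
  and by subgroups of \<open>H\<close>.\<close>

lemma monomial_of_finite_weight:
  assumes "m \<le> Suc k" "subgroup S G" "irr S W" "subgroup H G" "H \<subseteq> S" "is_char H \<chi>"
    "weights W H \<chi> \<noteq> {0}" "finite_dim (weights W H \<chi>)"
    "\<And>g w. \<lbrakk>g \<in> S; w \<in> W\<rbrakk> \<Longrightarrow> \<exists>D. subgroup D G \<and> covered G H D \<and> D \<subseteq> H \<and>
        (\<forall>h\<in>D. \<pi> (g \<otimes> h \<otimes> inv g \<otimes> inv h) w = w)"
    "scalar_on (N m \<inter> S) W"
  shows "monomial S W"
  using assms
proof (induction m arbitrary: S W H)
  case 0
  have "N 0 \<inter> S = S" using N_0 subgroup.subset[OF 0(2)] by auto
  then show ?case using monomial_of_scalar[OF 0(2,3)] 0(10) by simp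
next
  case (Suc m)
  note S = Suc.prems(2) and W = Suc.prems(3) and H = Suc.prems(4,5) and \<chi> = Suc.prems(6)
    and wt = Suc.prems(7,8) and AC = Suc.prems(9) and sc = Suc.prems(10)
  have mk: "m \<le> k" using Suc.prems(1) by simp
  have SG: "S \<subseteq> carrier G" using S by (rule subgroup.subset)
  have Winv: "invsub S W" and Ws: "subsp W" and WV: "W \<subseteq> V"
    using W by (auto simp: irr_def invsub_def subsp_def)
  obtain w0 where w0: "w0 \<in> W" "w0 \<noteq> 0" using W subsp_0[OF Ws] by (auto simp: irr_def)
  obtain x where x: "x \<in> N m \<inter> S" "\<And>a. a \<in> N m \<inter> S \<Longrightarrow> \<exists>n::int. a \<otimes> inv (x [^] n) \<in> N (Suc m) \<inter> S"
    using N_Int_gen[OF mk S] by blast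
  have xS: "x \<in> S" and xG: "x \<in> carrier G" using x SG by auto
  have rel: "\<exists>(n::int) c. c \<noteq> 0 \<and> (\<forall>w\<in>W. \<pi> a w = scale c (\<pi> (x [^] n) w))" if a: "a \<in> N m \<inter> S" for a
  proof -
    obtain n :: int where n: "a \<otimes> inv (x [^] n) \<in> N (Suc m) \<inter> S" using x(2)[OF a] by blast
    obtain c where c: "\<And>w. w \<in> W \<Longrightarrow> \<pi> (a \<otimes> inv (x [^] n)) w = scale c w"
      using sc n unfolding scalar_on_def by blast
    have aG: "a \<in> carrier G" using a SG by auto
    have "c \<noteq> 0" using eigenvalue_inv[of "a \<otimes> inv (x [^] n)" w0 c] c[OF w0(1)] w0 WV aG xG by auto
    moreover have "\<pi> a w = scale c (\<pi> (x [^] n) w)" if w: "w \<in> W" for w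
    proof -
      have xw: "\<pi> (x [^] n) w \<in> W"
        using Winv w subgroup_int_pow_closed[OF S xS] by (simp add: invsub_def)
      have "a = a \<otimes> inv (x [^] n) \<otimes> x [^] n" using aG xG by (simp add: m_assoc)
      then have "\<pi> a w = \<pi> (a \<otimes> inv (x [^] n)) (\<pi> (x [^] n) w)"
        using rep_mult[of "a \<otimes> inv (x [^] n)" "x [^] n" w] aG xG w WV by auto
      then show ?thesis using c[OF xw] by simp
    qed
    ultimately show ?thesis by blast
  qed
  have conj: "\<exists>(a::int) c. c \<noteq> 0 \<and> (\<forall>w\<in>W. \<pi> (g \<otimes> x \<otimes> inv g) w = scale c (\<pi> (x [^] a) w))" if g: "g \<in> S" for g
  proof (rule rel)
    have "g \<otimes> x \<otimes> inv g \<in> N m" using N_conj[of m x g] mk x g SG by auto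
    moreover have "g \<otimes> x \<otimes> inv g \<in> S" using g xS S by (simp add: subgroup.m_closed subgroup.m_inv_closed)
    ultimately show "g \<otimes> x \<otimes> inv g \<in> N m \<inter> S" by simp
  qed
  have "\<exists>l. \<exists>w\<in>W. w \<noteq> 0 \<and> \<pi> x w = scale l w"
  proof (rule eigenvector_of_finite_weight[OF S Winv xS conj H \<chi> wt])
    fix w assume "w \<in> W"
    then show "\<exists>D. covered G H D \<and> D \<subseteq> H \<and> (\<forall>h\<in>D. \<pi> (x \<otimes> h \<otimes> inv x \<otimes> inv h) w = w)"
      using AC[OF xS] by blast
  qed
  then obtain l w where w: "w \<in> W" "w \<noteq> 0" "\<pi> x w = scale l w" by blast
  define A where "A = eigsp W x l"
  have wA: "w \<in> A" using w by (simp add: A_def eigsp_def)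
  have As: "subsp A" unfolding A_def using eigsp_subsp[OF Ws xG] .
  have AW: "A \<subseteq> W" by (auto simp: A_def eigsp_def)
  have AV: "A \<subseteq> V" using AW WV by blast
  have A0: "A \<noteq> {0}" using wA w by blast
  have rng: "orb S A \<subseteq> range (eigsp W x)" unfolding A_def
    by (rule eigsp_orb[OF S Winv xS conj, of w]) (use wA w in \<open>auto simp: A_def\<close>)
  have ind: "indep (orb S A)" using eigsp_indep[OF Ws xG] rng by (rule indep_mono)
  obtain A' where A': "A' \<in> orb S A" "covered G H (stab H A')"
    "weights A' (stab H A') \<chi> \<noteq> {0}" "finite_dim (weights A' (stab H A') \<chi>)"
    using imprimitive_weight[OF S W As AW A0 ind H \<chi> wt] .
  obtain g where g: "g \<in> S" "A' = act g A" using A'(1) by (auto simp: orb_def)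
  have orb_eq: "orb S A' = orb S A" unfolding g(2) using orb_act_right[OF S g(1) AV] .
  obtain l' where l': "A' = eigsp W x l'" using rng A'(1) by blast
  have A's: "subsp A'" unfolding l' using eigsp_subsp[OF Ws xG] .
  have A'W: "A' \<subseteq> W" by (auto simp: l' eigsp_def)
  have A'V: "A' \<subseteq> V" using A'W WV by blast
  have "weights A' (stab H A') \<chi> \<subseteq> A'" by (auto simp: weight_space_def)
  moreover have "subsp (weights A' (stab H A') \<chi>)"
    by (rule weights_subsp[OF A's]) (use H SG in \<open>auto simp: stab_def\<close>)
  ultimately obtain w' where w': "w' \<in> A'" "w' \<noteq> 0" using A'(3) subsp_0 by blast
  then have A'0: "A' \<noteq> {0}" by blast
  have l'0: "l' \<noteq> 0" using w' eigenvalue_inv[of x w' l'] xG A'V by (auto simp: l' eigsp_def)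
  define T K where "T = stab S A'" and "K = stab H A'"
  have T: "subgroup T G" "T \<subseteq> S" and K: "subgroup K G" "K \<subseteq> H" "K \<subseteq> T"
    using stab_subgroup[OF S A'V] stab_subgroup[OF H(1) A'V] H(2) by (auto simp: T_def K_def stab_def)
  have "monomial T A'"
  proof (rule Suc.IH[OF _ T(1) _ K(1,3)])
    show "m \<le> Suc k" using mk by simp
    show "irr T A'" unfolding T_def using irr_stab[OF S W A's A'W A'0] ind orb_eq by simp
    show "is_char K \<chi>" using \<chi> K(2) by (auto simp: is_char_def)
    show "weights A' K \<chi> \<noteq> {0}" "finite_dim (weights A' K \<chi>)" using A' by (auto simp: K_def)
    show "scalar_on (N m \<inter> T) A'"
      unfolding scalar_on_def
    proof
      fix a assume "a \<in> N m \<inter> T"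
      then have "a \<in> N m \<inter> S" using T by auto
      then obtain n :: int and c where c: "\<And>w. w \<in> W \<Longrightarrow> \<pi> a w = scale c (\<pi> (x [^] n) w)" using rel by blast
      have "\<pi> a w = scale (c * l' powi n) w" if w: "w \<in> A'" for w
      proof -
        have "w \<in> W" "w \<in> V" "\<pi> x w = scale l' w" using w A'V by (auto simp: l' eigsp_def)
        then show ?thesis using c rep_int_pow_eigen[OF xG _ l'0] by simp
      qed
      then show "\<exists>c. \<forall>w\<in>A'. \<pi> a w = scale c w" by blast
    qed
    fix h w assume h: "h \<in> T" and w: "w \<in> A'"
    then have "h \<in> S" "w \<in> W" using T A'W by auto
    then obtain D where D: "subgroup D G" "covered G H D" "D \<subseteq> H"
      "\<forall>y\<in>D. \<pi> (h \<otimes> y \<otimes> inv h \<otimes> inv y) w = w" using AC by blast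
    have "covered G K (D \<inter> K)"
      using D K subgroup.subset[OF K(1)]
      by (intro covered_Int covered_mono[OF D(2) K(2)] covered_subset) auto
    moreover have "subgroup (D \<inter> K) G" using D(1) K(1) by (rule subgroups_Inter_pair)
    ultimately show "\<exists>D. subgroup D G \<and> covered G K D \<and> D \<subseteq> K \<and>
        (\<forall>y\<in>D. \<pi> (h \<otimes> y \<otimes> inv h \<otimes> inv y) w = w)"
      using D(4) by (intro exI[of _ "D \<inter> K"]) auto
  qed
  then show ?case unfolding T_def using monomial_trans[OF S A's A'W] ind orb_eq by simp
qed

text \<open>The finite weight is moved to a block \<open>A'\<close>, which is the class of a weight
  vector \<open>e\<close> of \<open>K\<close>. For \<open>w\<close> in \<open>A'\<close> and
  \<open>t\<close> in its stabilizer, a subgroup of finite index in \<open>K\<close> acts by the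
  same scalar on \<open>w\<close> and on \<open>\<pi> (inv t) w\<close>, and the commutator of
  \<open>t\<close> with such an element fixes \<open>w\<close>. The descent starts at the trivial
  end of the series, which acts by the scalar 1.\<close>

theorem monomial_of_irreducible:
  assumes V: "irr (carrier G) V" and H: "subgroup H G" and \<chi>: "is_char H \<chi>"
    and wt: "weights V H \<chi> \<noteq> {0}" "finite_dim (weights V H \<chi>)"
  shows "monomial (carrier G) V"
proof -
  have CG: "subgroup (carrier G) G" by (rule subgroup_self)
  have HG: "H \<subseteq> carrier G" using H by (rule subgroup.subset)
  have "V \<noteq> {0}" using V by (simp add: irr_def)
  then obtain u where u: "maximal u" using maximal_exists by blast
  have uV: "u \<in> V" "u \<noteq> 0" using u by (auto simp: maximal_def)
  define A where "A = cls u"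
  have As: "subsp A" unfolding A_def using cls_subsp uV by blast
  have AV: "A \<subseteq> V" using As by (simp add: subsp_def)
  have A0: "A \<noteq> {0}" using cls_self uV by (auto simp: A_def)
  have ind: "indep (orb (carrier G) A)" unfolding A_def using indep_classes[OF u] .
  obtain A' where A': "A' \<in> orb (carrier G) A" "covered G H (stab H A')"
    "weights A' (stab H A') \<chi> \<noteq> {0}" "finite_dim (weights A' (stab H A') \<chi>)"
    using imprimitive_weight[OF CG V As AV A0 ind H HG \<chi> wt] .
  obtain g where g: "g \<in> carrier G" "A' = act g A" using A'(1) by (auto simp: orb_def)
  have orb_eq: "orb (carrier G) A' = orb (carrier G) A"
    unfolding g(2) using orb_act_right[OF CG g(1) AV] .
  have A's: "subsp A'" unfolding g(2) using act_subsp[OF g(1) As] .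
  have A'V: "A' \<subseteq> V" using A's by (simp add: subsp_def)
  have A'eq: "A' = cls (\<pi> g u)" unfolding g(2) A_def using act_cls[OF g(1) uV(1)] .
  define T K where "T = stab (carrier G) A'" and "K = stab H A'"
  have T: "subgroup T G" and K: "subgroup K G" "K \<subseteq> H" "K \<subseteq> T"
    using stab_subgroup[OF CG A'V] stab_subgroup[OF H A'V] HG by (auto simp: T_def K_def stab_def)
  have KG: "K \<subseteq> carrier G" and TG: "T \<subseteq> carrier G" using K HG T subgroup.subset by blast+
  have wsub: "subsp (weights A' K \<chi>)" using weights_subsp[OF A's KG] .
  obtain e where e: "e \<in> weights A' K \<chi>" "e \<noteq> 0" using A'(3) subsp_0[OF wsub] by (auto simp: K_def)
  have eA: "e \<in> A'" and eK: "\<And>h. h \<in> K \<Longrightarrow> \<pi> h e = scale (\<chi> h) e" using e by (auto simp: weight_space_def)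
  have eV: "e \<in> V" using eA A'V by blast
  have cle: "cls e = A'" using cls_eq(2)[OF maximal_rep[OF u g(1)], of e] eA e(2) A'eq by simp
  have A'0: "A' \<noteq> {0}" using eA e by blast
  have Kst: "K \<subseteq> lstab e" using eK KG by (auto simp: lstab2_def)
  have "monomial T A'"
  proof (rule monomial_of_finite_weight[OF _ T _ K(1,3)])
    show "Suc k \<le> Suc k" by simp
    show "irr T A'" unfolding T_def using irr_stab[OF CG V A's A'V A'0] ind orb_eq by simp
    show "is_char K \<chi>" using \<chi> K(2) by (auto simp: is_char_def)
    show "weights A' K \<chi> \<noteq> {0}" "finite_dim (weights A' K \<chi>)" using A' by (auto simp: K_def)
    have "\<pi> a w = scale 1 w" if "a \<in> N (Suc k) \<inter> T" "w \<in> A'" for a w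
      using that N_end rep_one A'V by auto
    then show "scalar_on (N (Suc k) \<inter> T) A'" unfolding scalar_on_def by blast
    fix t w assume t: "t \<in> T" and w: "w \<in> A'"
    have tG: "t \<in> carrier G" using t TG by blast
    define w' where "w' = \<pi> (inv t) w"
    have "inv t \<in> T" using t T by (simp add: subgroup.m_inv_closed)
    then have w': "w' \<in> A'" using w by (auto simp: w'_def T_def stab_def act_def)
    have wV: "w \<in> V" "w' \<in> V" using w w' A'V by auto
    define D where "D = lstab2 e w \<inter> lstab2 e w' \<inter> K"
    have ls: "subgroup (lstab2 e w) G" "subgroup (lstab2 e w') G" using lstab2_subgroup eV e(2) wV by auto
    have D: "subgroup D G" unfolding D_def using ls K(1) by (intro subgroups_Inter_pair)
    have c: "covered G (lstab e) (lstab2 e w)" "covered G (lstab e) (lstab2 e w')"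
      using w w' by (auto simp: cle[symmetric] cls_def)
    have "covered G K (lstab2 e w \<inter> lstab2 e w')"
      using covered_mono[OF c(1) Kst subset_refl] covered_mono[OF c(2) Kst subset_refl]
      by (rule covered_Int[OF ls])
    then have "covered G K D" unfolding D_def
      using covered_subset[OF subset_refl KG] by (rule covered_Int[OF subgroups_Inter_pair[OF ls] K(1)])
    moreover have "\<pi> (t \<otimes> h \<otimes> inv t \<otimes> inv h) w = w" if h: "h \<in> D" for h
    proof -
      have hG: "h \<in> carrier G" using h KG by (auto simp: D_def)
      obtain c where c: "\<pi> h e = scale c e" "\<pi> h w = scale c w" using h by (auto simp: D_def lstab2_def)
      obtain d where d: "\<pi> h e = scale d e" "\<pi> h w' = scale d w'" using h by (auto simp: D_def lstab2_def)
      have cd: "d = c" using c(1) d(1) e(2) by simp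
      have c0: "c \<noteq> 0" using eigenvalue_inv[OF hG eV e(2) c(1)] .
      have "\<pi> (inv h) w = scale (inverse c) w" using eigenvector_inv[OF hG wV(1) c0 c(2)] .
      then have "\<pi> (t \<otimes> h \<otimes> inv t \<otimes> inv h) w = \<pi> t (\<pi> h (\<pi> (inv t) (scale (inverse c) w)))"
        using tG hG wV by (simp add: rep_mult rep_closed V_scale)
      also have "\<dots> = \<pi> t (\<pi> h (scale (inverse c) w'))" using tG wV by (simp add: rep_scale w'_def)
      also have "\<dots> = \<pi> t w'" using hG wV d(2) cd c0 by (simp add: rep_scale)
      also have "\<dots> = w" using tG wV by (simp add: w'_def)
      finally show ?thesis .
    qed
    ultimately show "\<exists>D. subgroup D G \<and> covered G K D \<and> D \<subseteq> K \<and>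
        (\<forall>h\<in>D. \<pi> (t \<otimes> h \<otimes> inv t \<otimes> inv h) w = w)"
      using D by (intro exI[of _ D]) (auto simp: D_def)
  qed
  then show ?thesis unfolding T_def using monomial_trans[OF CG A's A'V] ind orb_eq by simp
qed

end

section \<open>Induced representations\<close>

context complex_rep
begin

lemma irreducible_rep_imp_irr: "irreducible_rep G scale V \<pi> \<Longrightarrow> irr (carrier G) V"
  unfolding irreducible_rep_def irr_def invsub_def subsp_def
  using subspace_V rep_closed by blast

lemma character_is_char:
  assumes "subgroup_character G H \<chi>"
  shows "subgroup H G" "is_char H \<chi>"
  using assms by (auto simp: subgroup_character_def is_char_def hom_def complex_units_def)

text \<open>Frobenius reciprocity made explicit: the coefficient \<open>co\<close> of
  \<open>e\<close> along the other translates of the line is a functional on which \<open>H\<close>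
  acts by \<open>\<chi>\<close>, and \<open>v\<close> is sent to the function
  \<open>x \<mapsto> co (\<pi> x v)\<close>. The kernel is invariant and misses \<open>e\<close>. A
  function \<open>f\<close> is the image of the sum of the vectors \<open>f x\<close> times
  \<open>\<pi> (inv x) e\<close> over representatives of its cosets.\<close>

lemma monomial_imp_monomial_rep:
  assumes irr: "irr (carrier G) V" and mon: "monomial (carrier G) V"
  shows "monomial_rep G scale V \<pi>"
proof -
  have CG: "subgroup (carrier G) G" by (rule subgroup_self)
  obtain e where e: "e \<in> V" "e \<noteq> 0" and ind: "indep (orb (carrier G) (span {e}))"
    using mon by (auto simp: monomial_def)
  define L where "L = span {e}"
  have L: "subsp L" unfolding L_def using e by (intro subsp_span) auto
  have LV: "L \<subseteq> V" using L by (simp add: subsp_def)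
  have eL: "e \<in> L" by (simp add: L_def span_base)
  have Lmem: "y \<in> L \<longleftrightarrow> (\<exists>c. y = scale c e)" for y by (auto simp: L_def span_singleton)
  define H where "H = lstab e"
  have H: "subgroup H G" unfolding H_def using lstab2_subgroup e by blast
  have HG: "H \<subseteq> carrier G" using H by (rule subgroup.subset)
  have stabH: "stab (carrier G) L = H"
  proof
    show "stab (carrier G) L \<subseteq> H"
    proof
      fix g assume g: "g \<in> stab (carrier G) L"
      then have "\<pi> g e \<in> L" using eL by (auto simp: stab_def act_def)
      then show "g \<in> H" using g Lmem by (auto simp: H_def lstab2_def stab_def)
    qed
    show "H \<subseteq> stab (carrier G) L"
    proof
      fix g assume "g \<in> H"
      then obtain c where g: "g \<in> carrier G" "\<pi> g e = scale c e" by (auto simp: H_def lstab2_def)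
      have c0: "c \<noteq> 0" using eigenvalue_inv g e by blast
      have "act g L = span (act g {e})" unfolding L_def using act_span g e by simp
      also have "act g {e} = {scale c e}" using g by (simp add: act_def)
      also have "span {scale c e} = L"
      proof
        show "span {scale c e} \<subseteq> L" using L eL by (intro span_minimal) (auto simp: subsp_def subspace_scale)
        have "scale (inverse c) (scale c e) \<in> span {scale c e}" by (intro span_scale span_base) simp
        then show "L \<subseteq> span {scale c e}" unfolding L_def using c0 by (intro span_minimal) auto
      qed
      finally show "g \<in> stab (carrier G) L" using g by (simp add: stab_def)
    qed
  qed
  define \<chi> where "\<chi> g = (THE c. \<pi> g e = scale c e)" for g
  have \<chi>: "\<pi> g e = scale (\<chi> g) e" if "g \<in> H" for g
  proof -
    obtain c where c: "\<pi> g e = scale c e" using \<open>g \<in> H\<close> by (auto simp: H_def lstab2_def)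
    have "\<chi> g = c" unfolding \<chi>_def using c e(2) by (intro the_equality) auto
    then show ?thesis using c by simp
  qed
  have \<chi>0: "\<chi> g \<noteq> 0" if "g \<in> H" for g using eigenvalue_inv[of g e] \<chi>[OF that] that HG e by blast
  have \<chi>mult: "\<chi> (g \<otimes> h) = \<chi> g * \<chi> h" if "g \<in> H" "h \<in> H" for g h
  proof -
    have "scale (\<chi> (g \<otimes> h)) e = \<pi> (g \<otimes> h) e" using \<chi>[of "g \<otimes> h"] that H by (simp add: subgroup.m_closed)
    also have "\<dots> = \<pi> g (scale (\<chi> h) e)" using that HG e \<chi> by (simp add: rep_mult subset_iff)
    also have "\<dots> = scale (\<chi> g * \<chi> h) e" using that HG e \<chi> by (simp add: rep_scale subset_iff mult.commute)
    finally show ?thesis using e(2) by simp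
  qed
  have char: "subgroup_character G H \<chi>"
    using H \<chi>0 \<chi>mult by (auto simp: subgroup_character_def hom_def complex_units_def)
  let ?\<A> = "orb (carrier G) L"
  let ?R = "span (\<Union>(?\<A> - {L}))"
  have ind: "indep ?\<A>" using ind by (simp add: L_def)
  have osub: "subsp A" if "A \<in> ?\<A>" for A using orb_subsp[OF subset_refl L that] .
  have Lo: "L \<in> ?\<A>" using orb_self[OF CG LV] .
  have spV: "span (\<Union>?\<A>) = V" using span_orb_eq[OF CG irr L LV] eL e by blast
  obtain p where p: "\<And>z. z \<in> V \<Longrightarrow> p z \<in> L \<and> z - p z \<in> ?R"
    and pu: "\<And>z a. a \<in> L \<Longrightarrow> z - a \<in> ?R \<Longrightarrow> p z = a"
    using projection_exists[OF ind osub Lo] unfolding spV by metis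
  define co where "co z = (THE c. p z = scale c e)" for z
  have coI: "co z = c" if "z - scale c e \<in> ?R" for z c
  proof -
    have "p z = scale c e" using that Lmem by (intro pu) auto
    then show ?thesis unfolding co_def using e(2) by (intro the_equality) auto
  qed
  have co: "z - scale (co z) e \<in> ?R" if z: "z \<in> V" for z
  proof -
    obtain c where "p z = scale c e" using p[OF z] Lmem by blast
    then have "z - scale c e \<in> ?R" using p[OF z] by simp
    then show ?thesis using coI by simp
  qed
  have co_add: "co (y + z) = co y + co z" if "y \<in> V" "z \<in> V" for y z
  proof (rule coI)
    have "(y - scale (co y) e) + (z - scale (co z) e) \<in> ?R" using co that by (simp add: span_add)
    then show "y + z - scale (co y + co z) e \<in> ?R" by (simp add: algebra_simps scale_left_distrib)
  qed
  have co_scale: "co (scale c z) = c * co z" if "z \<in> V" for c z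
  proof (rule coI)
    have "scale c (z - scale (co z) e) \<in> ?R" using co that by (simp add: span_scale)
    then show "scale c z - scale (c * co z) e \<in> ?R" by (simp add: scale_right_diff_distrib)
  qed
  have co_R: "co z = 0" if "z \<in> ?R" for z using coI[of z 0] that by simp
  have co_sum: "co (sum f F) = (\<Sum>i\<in>F. co (f i))" if "\<And>i. i \<in> F \<Longrightarrow> f i \<in> V" for f and F :: "'x set"
    using that
  proof (induction F rule: infinite_finite_induct)
    case (insert x F)
    then show ?case by (simp add: co_add V_sum)
  qed (use co_R span_zero in auto)
  have co_H: "co (\<pi> h z) = \<chi> h * co z" if h: "h \<in> H" and z: "z \<in> V" for h z
  proof (rule coI)
    have hG: "h \<in> carrier G" using h HG by blast
    have "\<pi> h (z - scale (co z) e) \<in> ?R"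
      by (rule complement_invariant[OF CG L Lo _ co[OF z]]) (use h stabH in simp)
    then show "\<pi> h z - scale (\<chi> h * co z) e \<in> ?R"
      using hG z e \<chi>[OF h] by (simp add: rep_diff V_scale rep_scale mult.commute)
  qed
  have co_e: "co (\<pi> g e) = (if g \<in> H then \<chi> g else 0)" if g: "g \<in> carrier G" for g
  proof (cases "g \<in> H")
    case True
    then show ?thesis using coI[of "\<pi> g e" "\<chi> g"] \<chi> span_zero by simp
  next
    case False
    then have "act g L \<noteq> L" using stabH g by (auto simp: stab_def)
    then have "act g L \<in> ?\<A> - {L}" using g by (auto simp: orb_def)
    moreover have "\<pi> g e \<in> act g L" using eL by (auto simp: act_def)
    ultimately have "\<pi> g e \<in> ?R" by (intro span_base) blast
    then show ?thesis using co_R False by simp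
  qed
  let ?I = "ind_space G H UNIV (\<lambda>h. (*) (\<chi> h))"
  define T where "T v = (\<lambda>x. if x \<in> carrier G then co (\<pi> x v) else 0)" for v
  have TI: "T v \<in> ?I" if v: "v \<in> V" for v
  proof -
    have "v \<in> span (\<Union>?\<A>)" using v spV by simp
    then obtain F f where F: "finite F" "F \<subseteq> ?\<A>" "\<And>A. A \<in> F \<Longrightarrow> f A \<in> A" "v = sum f F"
      using span_Union[of ?\<A> v] osub by blast
    define g where "g A = (SOME g. g \<in> carrier G \<and> A = act g L)" for A
    have g: "g A \<in> carrier G \<and> A = act (g A) L" if "A \<in> F" for A
      unfolding g_def using F(2) that by (intro someI_ex[of "\<lambda>g. g \<in> carrier G \<and> A = act g L"]) (auto simp: orb_def)
    have fV: "f A \<in> V" if "A \<in> F" for A using F(2,3) that osub by (auto simp: subsp_def)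
    \<comment> \<open>The value at \<open>x\<close> can be nonzero only if \<open>x\<close> moves
      some line \<open>A\<close> occurring in \<open>v\<close> to \<open>L\<close>, which confines
      \<open>x\<close> to the coset of \<open>inv (g A)\<close>.\<close>
    have "x \<in> (\<Union>y\<in>(\<lambda>A. inv (g A)) ` F. H #> y)" if x: "x \<in> carrier G" "T v x \<noteq> 0" for x
    proof -
      have s: "co (\<pi> x v) = (\<Sum>A\<in>F. co (\<pi> x (f A)))"
        unfolding F(4) using fV x(1) by (simp add: rep_sum co_sum rep_closed)
      have "\<exists>A\<in>F. co (\<pi> x (f A)) \<noteq> 0"
      proof (rule ccontr)
        assume "\<not> ?thesis"
        then have "(\<Sum>A\<in>F. co (\<pi> x (f A))) = 0" by (intro sum.neutral) blast
        then show False using x s by (simp add: T_def)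
      qed
      then obtain A where A: "A \<in> F" "co (\<pi> x (f A)) \<noteq> 0" by blast
      have gA: "g A \<in> carrier G" "A = act (g A) L" using g[OF A(1)] by auto
      have xA: "act x A = act (x \<otimes> g A) L" using gA x LV act_mult by metis
      have "act x A = L"
      proof (rule ccontr)
        assume "act x A \<noteq> L"
        then have "act x A \<in> ?\<A> - {L}" unfolding xA using gA x by (auto simp: orb_def)
        moreover have "\<pi> x (f A) \<in> act x A" using F(3)[OF A(1)] by (auto simp: act_def)
        ultimately have "\<pi> x (f A) \<in> ?R" by (intro span_base) blast
        then show False using co_R A(2) by blast
      qed
      then have "x \<otimes> g A \<in> H" using xA stabH x gA by (auto simp: stab_def)
      moreover have "x = (x \<otimes> g A) \<otimes> inv (g A)" using x gA by (simp add: m_assoc)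
      ultimately have "x \<in> H #> inv (g A)" unfolding r_coset_def by blast
      then show ?thesis using A(1) by blast
    qed
    then have "\<exists>F. finite F \<and> F \<subseteq> carrier G \<and> {x \<in> carrier G. T v x \<noteq> 0} \<subseteq> (\<Union>x\<in>F. H #> x)"
      using F(1) g by (intro exI[of _ "(\<lambda>A. inv (g A)) ` F"]) auto
    moreover have "T v (h \<otimes> x) = \<chi> h * T v x" if "h \<in> H" "x \<in> carrier G" for h x
      using that HG v co_H[of h "\<pi> x v"] by (simp add: T_def rep_mult rep_closed subset_iff)
    ultimately show ?thesis by (simp add: ind_space_def) (simp add: T_def)
  qed
  have T_add: "T (v + w) = T v + T w" if "v \<in> V" "w \<in> V" for v w
    using that by (auto simp: T_def rep_add co_add rep_closed)
  have T_scale: "T (scale c v) = ind_scale (*) c (T v)" if "v \<in> V" for c v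
    using that by (auto simp: T_def ind_scale_def rep_scale co_scale rep_closed)
  have T_act: "T (\<pi> g v) = ind_action G g (T v)" if "g \<in> carrier G" "v \<in> V" for g v
    using that by (auto simp: T_def ind_action_def rep_mult)
  have "inj_on T V"
  proof (rule inj_onI)
    define K where "K = {v \<in> V. \<forall>x\<in>carrier G. co (\<pi> x v) = 0}"
    have "subspace K"
    proof (rule subspaceI)
      show "0 \<in> K" using co_R span_zero by (simp add: K_def)
    next
      fix v w assume "v \<in> K" "w \<in> K"
      then show "v + w \<in> K" by (simp add: K_def V_add rep_add co_add rep_closed)
    next
      fix c v assume "v \<in> K"
      then show "scale c v \<in> K" by (simp add: K_def V_scale rep_scale co_scale rep_closed)
    qed
    moreover have "\<pi> g v \<in> K" if "g \<in> carrier G" "v \<in> K" for g v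
      using that by (simp add: K_def rep_closed rep_mult[symmetric])
    ultimately have "invsub (carrier G) K" by (auto simp: invsub_def subsp_def K_def)
    moreover have "e \<notin> K"
    proof
      assume "e \<in> K"
      then have "co (\<pi> \<one> e) = 0" by (simp add: K_def)
      moreover have "\<one> \<in> H" using H by (rule subgroup.one_closed)
      ultimately show False using co_e[of \<one>] \<chi>0[of \<one>] by simp
    qed
    then have "K \<noteq> V" using e by blast
    moreover have "K \<subseteq> V" by (auto simp: K_def)
    ultimately have K0: "K = {0}" using irr by (auto simp: irr_def)
    fix v w assume vw: "v \<in> V" "w \<in> V" "T v = T w"
    have "co (\<pi> x (v - w)) = 0" if x: "x \<in> carrier G" for x
    proof -
      have "co (\<pi> x v) = co (\<pi> x w)" using fun_cong[OF vw(3), of x] x by (simp add: T_def)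
      moreover have "\<pi> x v = \<pi> x (v - w) + \<pi> x w" using vw x by (simp add: rep_diff)
      ultimately show ?thesis
        using co_add[of "\<pi> x (v - w)" "\<pi> x w"] vw x subspace_diff[OF subspace_V] by (simp add: rep_closed)
    qed
    then have "v - w \<in> K" using vw subspace_diff[OF subspace_V] by (simp add: K_def)
    then show "v = w" using K0 by simp
  qed
  moreover have "?I \<subseteq> T ` V"
  proof
    fix f assume f: "f \<in> ?I"
    then obtain F where F: "finite F" "F \<subseteq> carrier G" "{x \<in> carrier G. f x \<noteq> 0} \<subseteq> (\<Union>x\<in>F. H #> x)"
      by (auto simp: ind_space_def)
    have f0: "f x = 0" if "x \<notin> carrier G" for x using f that by (simp add: ind_space_def)
    have fH: "f (h \<otimes> x) = \<chi> h * f x" if "h \<in> H" "x \<in> carrier G" for h x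
      using f that by (simp add: ind_space_def)
    \<comment> \<open>\<open>F\<close> may contain several elements of one coset, which would be
      counted repeatedly; \<open>F'\<close> keeps one for each coset.\<close>
    define s where "s = inv_into F (\<lambda>x. H #> x)"
    define F' where "F' = s ` (\<lambda>x. H #> x) ` F"
    have F'F: "F' \<subseteq> F" unfolding F'_def s_def by (auto intro: inv_into_into)
    have F': "finite F'" "F' \<subseteq> carrier G" using F F'F finite_subset by auto
    have cos: "H #> s (H #> x) = H #> x" if "x \<in> F" for x
      unfolding s_def by (rule f_inv_into_f) (use that in auto)
    have distinct: "x = y" if xy: "x \<in> F'" "y \<in> F'" and eq: "H #> x = H #> y" for x y
    proof -
      obtain a b where "a \<in> F" "x = s (H #> a)" "b \<in> F" "y = s (H #> b)" using xy by (auto simp: F'_def)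
      then show ?thesis using eq cos by metis
    qed
    define v where "v = (\<Sum>x\<in>F'. scale (f x) (\<pi> (inv x) e))"
    have vV: "v \<in> V" unfolding v_def using F' e by (intro V_sum V_scale rep_closed) auto
    have "T v y = f y" for y
    proof (cases "y \<in> carrier G")
      case True
      have mem: "y \<otimes> inv x \<in> H \<longleftrightarrow> y \<in> H #> x" if "x \<in> F'" for x
        using subgroup.rcos_module[OF H group_axioms, of x y] that F' True by auto
      have "T v y = (\<Sum>x\<in>F'. f x * co (\<pi> (y \<otimes> inv x) e))"
      proof -
        have t: "scale (f x) (\<pi> (inv x) e) \<in> V" if "x \<in> F'" for x
          using that F'(2) e by (intro V_scale rep_closed) auto
        have "\<pi> y v = (\<Sum>x\<in>F'. \<pi> y (scale (f x) (\<pi> (inv x) e)))"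
          unfolding v_def using True t by (intro rep_sum)
        also have "\<dots> = (\<Sum>x\<in>F'. scale (f x) (\<pi> (y \<otimes> inv x) e))"
          using True F'(2) e by (intro sum.cong refl) (auto simp: rep_scale rep_mult rep_closed subset_iff)
        finally have "co (\<pi> y v) = (\<Sum>x\<in>F'. co (scale (f x) (\<pi> (y \<otimes> inv x) e)))"
          using co_sum[of F' "\<lambda>x. scale (f x) (\<pi> (y \<otimes> inv x) e)"] True F'(2) e
          by (auto intro!: V_scale rep_closed)
        also have "\<dots> = (\<Sum>x\<in>F'. f x * co (\<pi> (y \<otimes> inv x) e))"
          using True F'(2) e by (intro sum.cong refl co_scale rep_closed) auto
        finally show ?thesis using True by (simp add: T_def)
      qed
      also have "\<dots> = (\<Sum>x\<in>F'. if y \<in> H #> x then f x * \<chi> (y \<otimes> inv x) else 0)"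
        using True F'(2) mem by (intro sum.cong refl) (auto simp: co_e subset_iff)
      also have "\<dots> = (\<Sum>x\<in>F'. if y \<in> H #> x then f y else 0)"
      proof (rule sum.cong[OF refl])
        fix x assume x: "x \<in> F'"
        have xG: "x \<in> carrier G" using x F' by auto
        have "f y = \<chi> (y \<otimes> inv x) * f x" if "y \<in> H #> x"
        proof -
          have "y = (y \<otimes> inv x) \<otimes> x" using True xG by (simp add: m_assoc)
          then show ?thesis using fH[of "y \<otimes> inv x" x] mem[OF x] that xG by simp
        qed
        then show "(if y \<in> H #> x then f x * \<chi> (y \<otimes> inv x) else 0) = (if y \<in> H #> x then f y else 0)"
          by (simp add: mult.commute)
      qed
      also have "\<dots> = f y"
      proof (cases "\<exists>x\<in>F'. y \<in> H #> x")
        case True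
        then obtain x where x: "x \<in> F'" "y \<in> H #> x" by blast
        have uniq: "x' = x" if "x' \<in> F'" "y \<in> H #> x'" for x'
        proof (rule distinct[OF that(1) x(1)])
          show "H #> x' = H #> x"
            using repr_independence[OF that(2) _ H] repr_independence[OF x(2) _ H] that(1) x(1) F'(2)
            by (metis subsetD)
        qed
        have "(\<Sum>x\<in>F'. if y \<in> H #> x then f y else 0) = (\<Sum>z\<in>F'. if z = x then f y else 0)"
        proof (rule sum.cong[OF refl])
          fix z assume "z \<in> F'"
          then have "y \<in> H #> z \<longleftrightarrow> z = x" using uniq x(2) by blast
          then show "(if y \<in> H #> z then f y else 0) = (if z = x then f y else 0)" by simp
        qed
        also have "\<dots> = f y" using F'(1) x(1) by simp
        finally show ?thesis .
      next
        case False
        have "y \<notin> (\<Union>x\<in>F. H #> x)"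
        proof
          assume "y \<in> (\<Union>x\<in>F. H #> x)"
          then obtain x where "x \<in> F" "y \<in> H #> x" by blast
          then have "y \<in> H #> s (H #> x)" "s (H #> x) \<in> F'" using cos by (auto simp: F'_def)
          then show False using False by blast
        qed
        then have "f y = 0" using F(3) True by blast
        then show ?thesis by (simp cong: if_cong)
      qed
      finally show ?thesis .
    qed (simp add: T_def f0)
    then have "T v = f" by blast
    then show "f \<in> T ` V" using vV by blast
  qed
  ultimately have "bij_betw T V ?I" using TI by (auto simp: bij_betw_def)
  moreover have "complex_rep G (ind_scale (*)) ?I (ind_action G)"
    using complex_rep_ind[OF group_axioms H complex_rep_character[OF group_axioms char]] .
  ultimately have "rep_isomorphic G scale V \<pi> (ind_scale (*)) ?I (ind_action G)"
    unfolding rep_isomorphic_def using complex_rep_axioms T_add T_scale T_act by blast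
  then show ?thesis unfolding monomial_rep_def using char by blast
qed

end

section \<open>Schur's lemma and weights of monomial representations\<close>

lemma uncountable_UNIV_complex: "uncountable (UNIV :: complex set)"
proof
  assume "countable (UNIV :: complex set)"
  then have "countable (range complex_of_real)" by (rule countable_subset[rotated]) simp
  then have "countable (UNIV :: real set)" by (rule countable_image_inj_on) (simp add: inj_of_real)
  then show False using uncountable_UNIV_real by simp
qed

context complex_rep
begin

text \<open>Dixmier's argument. If \<open>T\<close> were not a scalar, kernel and image of
  \<open>T\<close> minus \<open>l\<close> would make it bijective on \<open>V\<close> for every
  complex \<open>l\<close>, and \<open>v l\<close> would be the preimage of a fixed vector
  \<open>e\<close>. A space of countable dimension cannot hold all \<open>v l\<close> independently,
  and a relation between them is a polynomial relation for \<open>T\<close> at \<open>e\<close>,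
  which yields an eigenvector after all.\<close>

lemma schur_countable:
  assumes irr: "irr (carrier G) V" and cnt: "countable (carrier G)"
    and T: "\<And>v. v \<in> V \<Longrightarrow> T v \<in> V" "\<And>v w. v \<in> V \<Longrightarrow> w \<in> V \<Longrightarrow> T (v + w) = T v + T w"
      "\<And>c v. v \<in> V \<Longrightarrow> T (scale c v) = scale c (T v)"
    and comm: "\<And>g v. g \<in> carrier G \<Longrightarrow> v \<in> V \<Longrightarrow> T (\<pi> g v) = \<pi> g (T v)"
  shows "\<exists>l. \<forall>v\<in>V. T v = scale l v"
proof (rule ccontr)
  assume no: "\<not> ?thesis"
  have CG: "subgroup (carrier G) G" by (rule subgroup_self)
  interpret T: complex_operator scale V T
    using subspace_V T by unfold_locales auto
  obtain e where e: "e \<in> V" "e \<noteq> 0" using irr V_zero by (auto simp: irr_def)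
  have ker: "T v \<noteq> scale l v" if v: "v \<in> V" "v \<noteq> 0" for v l
  proof
    assume eq: "T v = scale l v"
    define K where "K = {v \<in> V. T v = scale l v}"
    have "subspace K"
    proof (rule subspaceI)
      show "0 \<in> K" by (simp add: K_def T.T_zero)
      show "x + y \<in> K" if "x \<in> K" "y \<in> K" for x y using that by (simp add: K_def V_add T scale_right_distrib)
      show "scale c x \<in> K" if "x \<in> K" for c x using that by (simp add: K_def V_scale T mult.commute)
    qed
    then have "invsub (carrier G) K"
      by (auto simp: invsub_def subsp_def K_def comm rep_scale rep_closed)
    moreover have "K \<subseteq> V" "v \<in> K" using v eq by (auto simp: K_def)
    ultimately have "K = V" using irr v(2) unfolding irr_def by blast
    then show False using no by (auto simp: K_def)
  qed
  have "\<exists>v\<in>V. T v - scale l v = e" for l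
  proof -
    define I where "I = (\<lambda>v. T v - scale l v) ` V"
    have IV: "I \<subseteq> V" using T(1) subspace_diff[OF subspace_V] V_scale by (auto simp: I_def)
    have "subspace I"
    proof (rule subspaceI)
      show "0 \<in> I" unfolding I_def by (rule image_eqI[of _ _ 0]) (simp_all add: T.T_zero)
    next
      fix x y assume "x \<in> I" "y \<in> I"
      then obtain a b where "a \<in> V" "b \<in> V" "x = T a - scale l a" "y = T b - scale l b" by (auto simp: I_def)
      then show "x + y \<in> I" unfolding I_def
        by (intro image_eqI[of _ _ "a + b"]) (simp_all add: T V_add scale_right_distrib)
    next
      fix c x assume "x \<in> I"
      then obtain a where "a \<in> V" "x = T a - scale l a" by (auto simp: I_def)
      then show "scale c x \<in> I" unfolding I_def
        by (intro image_eqI[of _ _ "scale c a"]) (simp_all add: T V_scale scale_right_diff_distrib mult.commute)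
    qed
    moreover have "\<pi> g x \<in> I" if g: "g \<in> carrier G" and "x \<in> I" for g x
    proof -
      obtain a where a: "a \<in> V" "x = T a - scale l a" using \<open>x \<in> I\<close> by (auto simp: I_def)
      then have "\<pi> g x = T (\<pi> g a) - scale l (\<pi> g a)"
        using g T by (simp add: rep_diff V_scale comm rep_scale)
      then show ?thesis using a g rep_closed by (auto simp: I_def)
    qed
    ultimately have "invsub (carrier G) I" using IV by (simp add: invsub_def subsp_def)
    moreover have "T e - scale l e \<in> I" "T e - scale l e \<noteq> 0" using e ker by (auto simp: I_def)
    then have "I \<noteq> {0}" by blast
    ultimately have "I = V" using irr IV unfolding irr_def by blast
    then have "e \<in> I" using e by simp
    then show ?thesis by (auto simp: I_def)
  qed
  then obtain v where v: "\<And>l. v l \<in> V" "\<And>l. T (v l) - scale l (v l) = e" by metis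
  define E where "E = (\<lambda>g. \<pi> g e) ` carrier G"
  have VE: "V \<subseteq> span E"
  proof -
    have s: "subsp (span {e})" using e by (intro subsp_span) auto
    have "span {e} \<noteq> {0}" using e span_base[of e "{e}"] by auto
    then have "span (\<Union>(orb (carrier G) (span {e}))) = V"
      using span_orb_eq[OF CG irr s] s by (simp add: subsp_def)
    moreover have "act g (span {e}) \<subseteq> span E" if "g \<in> carrier G" for g
    proof -
      have "act g (span {e}) = span (act g {e})" using act_span that e by simp
      also have "\<dots> \<subseteq> span E" using that by (intro span_mono) (auto simp: act_def E_def)
      finally show ?thesis .
    qed
    then have "span (\<Union>(orb (carrier G) (span {e}))) \<subseteq> span E"
      by (intro span_minimal) (auto simp: orb_def)
    ultimately show ?thesis by simp
  qed
  have "\<exists>F. finite F \<and> F \<subseteq> E \<and> v l \<in> span F" for l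
  proof -
    have "v l \<in> span E" using v(1) VE by blast
    then obtain t r where t: "finite t" "t \<subseteq> E" "v l = (\<Sum>a\<in>t. scale (r a) a)"
      unfolding span_explicit by blast
    then have "v l \<in> span t" by (auto intro: span_sum span_scale span_base)
    then show ?thesis using t by blast
  qed
  then obtain F where F: "\<And>l. finite (F l)" "\<And>l. F l \<subseteq> E" "\<And>l. v l \<in> span (F l)" by metis
  \<comment> \<open>There are uncountably many \<open>l\<close> but only countably many finite
    subsets of \<open>E\<close>, so one subset serves infinitely many \<open>l\<close>.\<close>
  have "\<exists>B. finite B \<and> infinite {l. F l = B}"
  proof (rule ccontr)
    assume a: "\<not> ?thesis"
    have "countable E" using cnt by (simp add: E_def)
    then have "countable {B. finite B \<and> B \<subseteq> E}" by (rule countable_Collect_finite_subset)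
    then have "countable (range F)" by (rule countable_subset[rotated]) (use F in auto)
    moreover have "countable {l. F l = B}" if "B \<in> range F" for B
      using a F(1) that by (auto intro: countable_finite)
    ultimately have "countable (\<Union>B\<in>range F. {l. F l = B})" by (rule countable_UN)
    moreover have "(\<Union>B\<in>range F. {l. F l = B}) = UNIV" by auto
    ultimately show False using uncountable_UNIV_complex by simp
  qed
  then obtain B where B: "finite B" "infinite {l. F l = B}" by blast
  obtain \<Lambda> where \<Lambda>: "finite \<Lambda>" "card \<Lambda> = Suc (card B)" "\<Lambda> \<subseteq> {l. F l = B}"
    using infinite_arbitrarily_large[OF B(2)] by blast
  have inj: "inj_on v \<Lambda>"
  proof (rule inj_onI)
    fix l m assume "v l = v m"
    then have "scale l (v l) = scale m (v l)" using v(2)[of l] v(2)[of m] by (metis diff_left_imp_eq)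
    moreover have "v l \<noteq> 0" using v(2)[of l] e(2) T.T_zero by auto
    ultimately show "l = m" by simp
  qed
  have "v ` \<Lambda> \<subseteq> span B" using F(3) \<Lambda>(3) by auto
  then have "dependent (v ` \<Lambda>)"
    using independent_span_bound[OF B(1), of "v ` \<Lambda>"] card_image[OF inj] \<Lambda>(2) by linarith
  then obtain u where u: "\<exists>w\<in>v ` \<Lambda>. u w \<noteq> 0" "(\<Sum>w\<in>v ` \<Lambda>. scale (u w) w) = 0"
    using dependent_finite[of "v ` \<Lambda>"] \<Lambda>(1) by auto
  define a where "a l = u (v l)" for l
  have a0: "(\<Sum>l\<in>\<Lambda>. scale (a l) (v l)) = 0" using u(2) by (simp add: sum.reindex[OF inj] a_def)
  obtain l0 where l0: "l0 \<in> \<Lambda>" "a l0 \<noteq> 0" using u(1) by (auto simp: a_def)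
  \<comment> \<open>As \<open>v l\<close> is \<open>e\<close> divided by \<open>T\<close> minus
    \<open>l\<close>, multiplying the relation by the product over \<Lambda> clears the
    denominators.\<close>
  define Q where "Q S = (\<Prod>\<mu>\<in>S. [:-\<mu>, 1:])" for S :: "complex set"
  have Q: "T.peval (Q (\<Lambda> - {l})) e = T.peval (Q \<Lambda>) (v l)" if "l \<in> \<Lambda>" for l
  proof -
    have "Q \<Lambda> = Q (\<Lambda> - {l}) * [:-l, 1:]" unfolding Q_def using \<Lambda>(1) that by (simp only: prod.remove mult.commute)
    then show ?thesis using T.peval_mult[OF v(1)] T.peval_linear_factor v(2) by metis
  qed
  define p where "p = (\<Sum>l\<in>\<Lambda>. smult (a l) (Q (\<Lambda> - {l})))"
  have "T.peval p e = (\<Sum>l\<in>\<Lambda>. scale (a l) (T.peval (Q \<Lambda>) (v l)))"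
    unfolding p_def using e Q by (simp add: T.peval_sum T.peval_smult)
  also have "\<dots> = T.peval (Q \<Lambda>) (\<Sum>l\<in>\<Lambda>. scale (a l) (v l))"
    using v(1) by (simp add: T.peval_vsum T.peval_vscale V_scale)
  also have "\<dots> = 0" unfolding a0 using T.peval_vscale[of 0 "Q \<Lambda>" 0] by simp
  finally have "T.peval p e = 0" .
  moreover have "p \<noteq> 0"
  proof
    assume "p = 0"
    then have "0 = poly p l0" by simp
    \<comment> \<open>As in Lagrange interpolation, only the summand of \<open>l0\<close> survives
      evaluation at \<open>l0\<close>.\<close>
    also have "\<dots> = (\<Sum>l\<in>\<Lambda>. a l * (\<Prod>\<mu>\<in>\<Lambda> - {l}. l0 - \<mu>))"
      by (simp add: p_def poly_sum Q_def poly_prod)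
    also have "\<dots> = a l0 * (\<Prod>\<mu>\<in>\<Lambda> - {l0}. l0 - \<mu>) + (\<Sum>l\<in>\<Lambda> - {l0}. a l * (\<Prod>\<mu>\<in>\<Lambda> - {l}. l0 - \<mu>))"
      using \<Lambda>(1) l0(1) by (rule sum.remove)
    also have "(\<Sum>l\<in>\<Lambda> - {l0}. a l * (\<Prod>\<mu>\<in>\<Lambda> - {l}. l0 - \<mu>)) = 0"
      using \<Lambda>(1) l0(1) by (intro sum.neutral ballI) auto
    finally show False using l0 \<Lambda>(1) by (auto simp: prod_zero_iff)
  qed
  ultimately show False using T.eigenvector_of_annihilator[of p e] e ker by blast
qed

text \<open>The hypothesis \<open>free\<close> says that \<open>e \<mapsto> w\<close> extends to an endomorphism of \<open>V\<close>.\<close>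

lemma multiple_of_generator:
  assumes irr: "irr (carrier G) V" and cnt: "countable (carrier G)"
    and e: "e \<in> V" "e \<noteq> 0" and w: "w \<in> V"
    and free: "\<And>F c. \<lbrakk>finite F; F \<subseteq> carrier G; (\<Sum>g\<in>F. scale (c g) (\<pi> g e)) = 0\<rbrakk>
      \<Longrightarrow> (\<Sum>g\<in>F. scale (c g) (\<pi> g w)) = 0"
  shows "\<exists>l. w = scale l e"
proof -
  \<comment> \<open>The element of the group algebra with coefficients \<open>c\<close> on
    \<open>F\<close>, applied to \<open>u\<close>.\<close>
  define comb where "comb u F c = (\<Sum>g\<in>F. scale (c g) (\<pi> g u))" for u and F :: "'g set" and c
  have comb_V: "comb u F c \<in> V" if "u \<in> V" "F \<subseteq> carrier G" for u F c
    unfolding comb_def using that by (intro V_sum V_scale rep_closed) auto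
  define add where "add F c F' c' = (\<lambda>g. (if g \<in> F then c g else 0) + (if g \<in> F' then c' g else (0::complex)))"
    for F F' :: "'g set" and c c'
  have comb_add: "comb u F c + comb u F' c' = comb u (F \<union> F') (add F c F' c')" if "finite F" "finite F'" for u F F' c c'
  proof -
    have "comb u F c = (\<Sum>g\<in>F \<union> F'. scale (if g \<in> F then c g else 0) (\<pi> g u))"
      unfolding comb_def using that by (intro sum.mono_neutral_cong_left) auto
    moreover have "comb u F' c' = (\<Sum>g\<in>F \<union> F'. scale (if g \<in> F' then c' g else 0) (\<pi> g u))"
      unfolding comb_def using that by (intro sum.mono_neutral_cong_left) auto
    ultimately show ?thesis by (simp add: comb_def add_def sum.distrib[symmetric] scale_left_distrib)
  qed
  have comb_scale: "scale a (comb u F c) = comb u F (\<lambda>g. a * c g)" for a u F c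
    by (simp add: comb_def scale_sum_right)
  have comb_act: "\<pi> h (comb u F c) = comb u ((\<lambda>g. h \<otimes> g) ` F) (\<lambda>g. c (inv h \<otimes> g))"
    if h: "h \<in> carrier G" and u: "u \<in> V" and F: "F \<subseteq> carrier G" for h u F c
  proof -
    have inj: "inj_on (\<lambda>g. h \<otimes> g) F" using h F by (auto simp: inj_on_def subset_iff)
    have e: "inv h \<otimes> (h \<otimes> g) = g" if "g \<in> F" for g using that F h by (auto simp flip: m_assoc)
    have "\<pi> h (comb u F c) = (\<Sum>g\<in>F. \<pi> h (scale (c g) (\<pi> g u)))"
      unfolding comb_def using h u F by (intro rep_sum V_scale rep_closed) auto
    also have "\<dots> = (\<Sum>g\<in>F. scale (c (inv h \<otimes> (h \<otimes> g))) (\<pi> (h \<otimes> g) u))"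
      using h u F e by (intro sum.cong refl) (auto simp: rep_scale rep_mult rep_closed subset_iff)
    finally show ?thesis by (simp add: comb_def sum.reindex[OF inj])
  qed
  have wd: "comb w F c = comb w F' c'"
    if F: "finite F" "F \<subseteq> carrier G" "finite F'" "F' \<subseteq> carrier G" and eq: "comb e F c = comb e F' c'" for F F' c c'
  proof -
    have d: "comb u F c - comb u F' c' = comb u (F \<union> F') (add F c F' (\<lambda>g. - 1 * c' g))" for u
    proof -
      have "comb u F c - comb u F' c' = comb u F c + scale (- 1) (comb u F' c')" by simp
      also have "\<dots> = comb u F c + comb u F' (\<lambda>g. - 1 * c' g)" by (simp only: comb_scale)
      finally show ?thesis using comb_add[OF F(1,3)] by simp
    qed
    have "comb e (F \<union> F') (add F c F' (\<lambda>g. - 1 * c' g)) = 0" using d[of e] eq by simp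
    then have "comb w (F \<union> F') (add F c F' (\<lambda>g. - 1 * c' g)) = 0"
      unfolding comb_def using F by (intro free) auto
    then show ?thesis using d[of w] by simp
  qed
  define U where "U = {v. \<exists>F c. finite F \<and> F \<subseteq> carrier G \<and> v = comb e F c}"
  have e1: "e = comb e {\<one>} (\<lambda>_. 1)" "w = comb w {\<one>} (\<lambda>_. 1)" using e w rep_one by (simp_all add: comb_def)
  have "subspace U"
  proof (rule subspaceI)
    show "0 \<in> U" unfolding U_def by (intro CollectI exI[of _ "{}"]) (simp add: comb_def)
  next
    fix x y assume "x \<in> U" "y \<in> U"
    then obtain F c F' c' where *: "finite F" "F \<subseteq> carrier G" "x = comb e F c"
      "finite F'" "F' \<subseteq> carrier G" "y = comb e F' c'" unfolding U_def by blast
    show "x + y \<in> U" unfolding U_def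
      by (intro CollectI exI[of _ "F \<union> F'"] exI[of _ "add F c F' c'"]) (use * comb_add in auto)
  next
    fix a x assume "x \<in> U"
    then obtain F c where *: "finite F" "F \<subseteq> carrier G" "x = comb e F c" unfolding U_def by blast
    show "scale a x \<in> U" unfolding U_def
      by (intro CollectI exI[of _ F] exI[of _ "\<lambda>g. a * c g"]) (use * comb_scale in auto)
  qed
  moreover have "\<pi> h x \<in> U" if h: "h \<in> carrier G" and x: "x \<in> U" for h x
  proof -
    obtain F c where *: "finite F" "F \<subseteq> carrier G" "x = comb e F c" using x unfolding U_def by blast
    show ?thesis unfolding U_def
      by (intro CollectI exI[of _ "(\<lambda>g. h \<otimes> g) ` F"] exI[of _ "\<lambda>g. c (inv h \<otimes> g)"])
        (use * comb_act h e in auto)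
  qed
  moreover have UV: "U \<subseteq> V" using comb_V e by (auto simp: U_def)
  ultimately have "invsub (carrier G) U" by (simp add: invsub_def subsp_def)
  moreover have "e \<in> U" unfolding U_def using e1(1) one_closed by blast
  ultimately have UV: "U = V" using irr UV e(2) unfolding irr_def by blast
  define T where "T v = (SOME y. \<exists>F c. finite F \<and> F \<subseteq> carrier G \<and> v = comb e F c \<and> y = comb w F c)" for v
  have T: "T (comb e F c) = comb w F c" if F: "finite F" "F \<subseteq> carrier G" for F c
  proof -
    have "\<exists>F' c'. finite F' \<and> F' \<subseteq> carrier G \<and> comb e F c = comb e F' c' \<and> T (comb e F c) = comb w F' c'"
      unfolding T_def using F by (intro someI_ex[of "\<lambda>y. \<exists>F' c'. finite F' \<and> F' \<subseteq> carrier G \<and> comb e F c = comb e F' c' \<and> y = comb w F' c'"]) blast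
    then show ?thesis using wd F by metis
  qed
  have ex: "\<exists>F c. finite F \<and> F \<subseteq> carrier G \<and> v = comb e F c" if v: "v \<in> V" for v using v UV by (auto simp: U_def)
  have "\<exists>l. \<forall>v\<in>V. T v = scale l v"
  proof (rule schur_countable[OF irr cnt])
    fix v assume "v \<in> V"
    then obtain F c where F: "finite F" "F \<subseteq> carrier G" "v = comb e F c" using ex by blast
    show "T v \<in> V" using F T comb_V w by simp
    show "T (scale a v) = scale a (T v)" for a using F T by (simp add: comb_scale)
    show "T (\<pi> h v) = \<pi> h (T v)" if h: "h \<in> carrier G" for h
    proof -
      have "(\<lambda>g. h \<otimes> g) ` F \<subseteq> carrier G" using F h by auto
      then show ?thesis using F h T e w by (simp add: comb_act)
    qed
    show "T (v + y) = T v + T y" if y: "y \<in> V" for y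
    proof -
      obtain F' c' where F': "finite F'" "F' \<subseteq> carrier G" "y = comb e F' c'" using ex[OF y] by blast
      show ?thesis using F F' T by (simp add: comb_add)
    qed
  qed
  then obtain l where l: "\<And>v. v \<in> V \<Longrightarrow> T v = scale l v" by blast
  have "T (comb e {\<one>} (\<lambda>_. 1)) = comb w {\<one>} (\<lambda>_. 1)" by (rule T) auto
  then have "T e = w" using e1 by simp
  then show ?thesis using l e(1) by auto
qed

text \<open>The vector \<open>e\<close> corresponds to the function \<open>\<delta>\<close>
  supported on \<open>H\<close>. Evaluating a relation among translates of \<open>\<delta>\<close>
  at \<open>inv g0\<close> shows that the coefficients, weighted by \<open>\<chi>\<close>, have sum
  0 over the left coset of \<open>g0\<close>. A weight vector therefore satisfies every relation
  that \<open>e\<close> does, so it is the image of \<open>e\<close> under an endomorphism and a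
  multiple of \<open>e\<close>.\<close>

lemma monomial_rep_imp_finite_weight_rep:
  assumes irr: "irr (carrier G) V" and cnt: "countable (carrier G)"
    and mon: "monomial_rep G scale V \<pi>"
  shows "finite_weight_rep G scale V \<pi>"
proof -
  obtain H \<chi> where char: "subgroup_character G H \<chi>"
    and iso: "rep_isomorphic G scale V \<pi> (ind_scale (*)) (ind_space G H UNIV (\<lambda>h. (*) (\<chi> h))) (ind_action G)"
    using mon by (auto simp: monomial_rep_def)
  let ?I = "ind_space G H UNIV (\<lambda>h. (*) (\<chi> h))"
  obtain T where T: "bij_betw T V ?I" "\<And>v w. v \<in> V \<Longrightarrow> w \<in> V \<Longrightarrow> T (v + w) = T v + T w"
    "\<And>c v. v \<in> V \<Longrightarrow> T (scale c v) = ind_scale (*) c (T v)"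
    "\<And>g v. g \<in> carrier G \<Longrightarrow> v \<in> V \<Longrightarrow> T (\<pi> g v) = ind_action G g (T v)"
    using iso unfolding rep_isomorphic_def by blast
  have H: "subgroup H G" and \<chi>: "is_char H \<chi>" using character_is_char[OF char] by auto
  have HG: "H \<subseteq> carrier G" using H by (rule subgroup.subset)
  have \<chi>mult: "\<chi> (g \<otimes> h) = \<chi> g * \<chi> h" if "g \<in> H" "h \<in> H" for g h using \<chi> that by (simp add: is_char_def)
  have oneH: "\<one> \<in> H" using H by (rule subgroup.one_closed)
  have mulH: "x \<otimes> h \<in> H \<longleftrightarrow> x \<in> H" "h \<otimes> x \<in> H \<longleftrightarrow> x \<in> H" if "x \<in> carrier G" "h \<in> H" for x h
  proof -
    have hG: "h \<in> carrier G" using that HG by auto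
    have "x = (x \<otimes> h) \<otimes> inv h" "x = inv h \<otimes> (h \<otimes> x)" using that hG by (simp add: m_assoc) (simp flip: m_assoc add: that hG)
    then show "x \<otimes> h \<in> H \<longleftrightarrow> x \<in> H" "h \<otimes> x \<in> H \<longleftrightarrow> x \<in> H"
      using that(2) H by (metis subgroup.m_closed subgroup.m_inv_closed)+
  qed
  define \<delta> where "\<delta> = (\<lambda>x. if x \<in> H then \<chi> x else 0)"
  have "\<delta> \<in> ?I"
  proof -
    have "{x \<in> carrier G. \<delta> x \<noteq> 0} \<subseteq> (\<Union>x\<in>{\<one>}. H #> x)" using HG by (auto simp: \<delta>_def r_coset_def split: if_splits)
    then have "\<exists>F. finite F \<and> F \<subseteq> carrier G \<and> {x \<in> carrier G. \<delta> x \<noteq> 0} \<subseteq> (\<Union>x\<in>F. H #> x)"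
      by (intro exI[of _ "{\<one>}"]) auto
    moreover have "\<delta> (h \<otimes> x) = \<chi> h * \<delta> x" if "h \<in> H" "x \<in> carrier G" for h x
      using that mulH \<chi>mult by (simp add: \<delta>_def)
    ultimately show ?thesis using HG by (auto simp: ind_space_def \<delta>_def)
  qed
  then have "\<delta> \<in> T ` V" using T(1) by (simp add: bij_betw_def)
  then obtain e where e: "e \<in> V" "T e = \<delta>" by (metis imageE)
  have T0: "T 0 = 0" using T(2)[of 0 0] by simp
  have "\<chi> \<one> \<noteq> 0" using \<chi> oneH by (simp add: is_char_def)
  then have "\<delta> \<one> \<noteq> 0" using oneH by (simp add: \<delta>_def)
  then have e0: "e \<noteq> 0" using T0 e(2) by auto
  have eH: "\<pi> h e = scale (\<chi> h) e" if h: "h \<in> H" for h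
  proof -
    have hG: "h \<in> carrier G" using h HG by auto
    have "T (\<pi> h e) = ind_action G h \<delta>" using T(4)[OF hG e(1)] e(2) by simp
    also have "\<dots> = ind_scale (*) (\<chi> h) \<delta>"
    proof
      fix x show "ind_action G h \<delta> x = ind_scale (*) (\<chi> h) \<delta> x"
        using h mulH(1)[OF _ h] \<chi>mult HG by (auto simp: ind_action_def ind_scale_def \<delta>_def mult.commute)
    qed
    also have "\<dots> = T (scale (\<chi> h) e)" using T(3)[OF e(1)] e(2) by simp
    finally show ?thesis using T(1) hG e(1) rep_closed V_scale by (auto simp: bij_betw_def inj_on_def)
  qed
  have Tsum: "T (sum f F) x = (\<Sum>i\<in>F. T (f i) x)" if "\<And>i. i \<in> F \<Longrightarrow> f i \<in> V" for f :: "'g \<Rightarrow> 'v" and F x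
    using that
  proof (induction F rule: infinite_finite_induct)
    case (insert i F)
    then show ?case by (simp add: T(2) V_sum)
  qed (use T0 in auto)
  have "\<exists>l. w = scale l e" if w: "w \<in> weights V H \<chi>" for w
  proof (rule multiple_of_generator[OF irr cnt e(1) e0])
    show wV: "w \<in> V" using w by (simp add: weight_space_def)
    have wH: "\<pi> h w = scale (\<chi> h) w" if "h \<in> H" for h using w that by (simp add: weight_space_def)
    fix F c assume F: "finite F" "F \<subseteq> carrier G" and z: "(\<Sum>g\<in>F. scale (c g) (\<pi> g e)) = 0"
    have ev: "(\<Sum>g\<in>F. c g * \<delta> (x \<otimes> g)) = 0" if x: "x \<in> carrier G" for x
    proof -
      have "T (scale (c g) (\<pi> g e)) x = c g * \<delta> (x \<otimes> g)" if "g \<in> F" for g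
        using that F(2) e x T(3)[of "\<pi> g e" "c g"] T(4)[of g e]
        by (auto simp: ind_scale_def ind_action_def rep_closed subset_iff)
      then have "T (\<Sum>g\<in>F. scale (c g) (\<pi> g e)) x = (\<Sum>g\<in>F. c g * \<delta> (x \<otimes> g))"
        using F(2) e by (subst Tsum) (auto intro: V_scale rep_closed)
      then show ?thesis using z T0 by simp
    qed
    \<comment> \<open>The left coset of \<open>g\<close>. The induced functions are built on right
      cosets, but relations among the translates of \<open>e\<close> decompose along left
      ones.\<close>
    define \<kappa> where "\<kappa> g = {y \<in> carrier G. inv g \<otimes> y \<in> H}" for g
    have \<kappa>: "\<kappa> g = \<kappa> g0 \<longleftrightarrow> inv g0 \<otimes> g \<in> H" if "g \<in> carrier G" "g0 \<in> carrier G" for g g0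
    proof
      assume "\<kappa> g = \<kappa> g0"
      moreover have "g \<in> \<kappa> g" using that oneH by (simp add: \<kappa>_def)
      ultimately show "inv g0 \<otimes> g \<in> H" by (auto simp: \<kappa>_def)
    next
      assume h: "inv g0 \<otimes> g \<in> H"
      have "inv g0 \<otimes> y \<in> H \<longleftrightarrow> inv g \<otimes> y \<in> H" if y: "y \<in> carrier G" for y
      proof -
        have "g \<otimes> (inv g \<otimes> y) = y" using that \<open>g \<in> carrier G\<close> y by (simp flip: m_assoc)
        then have "inv g0 \<otimes> y = (inv g0 \<otimes> g) \<otimes> (inv g \<otimes> y)"
          using \<open>g \<in> carrier G\<close> \<open>g0 \<in> carrier G\<close> y by (simp add: m_assoc)
        then show ?thesis using mulH(2)[of "inv g \<otimes> y", OF _ h] y \<open>g \<in> carrier G\<close> by simp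
      qed
      then show "\<kappa> g = \<kappa> g0" by (auto simp: \<kappa>_def)
    qed
    have "(\<Sum>g\<in>F. scale (c g) (\<pi> g w)) = (\<Sum>C\<in>\<kappa> ` F. \<Sum>g\<in>{g \<in> F. \<kappa> g = C}. scale (c g) (\<pi> g w))"
      using F(1) by (intro sum.group[symmetric]) auto
    also have "\<dots> = 0"
    proof (rule sum.neutral, rule ballI)
      fix C assume "C \<in> \<kappa> ` F"
      then obtain g0 where g0: "g0 \<in> F" "C = \<kappa> g0" by auto
      have g0G: "g0 \<in> carrier G" using g0 F by auto
      have "(\<Sum>g\<in>{g \<in> F. \<kappa> g = C}. scale (c g) (\<pi> g w)) = (\<Sum>g\<in>F. scale (c g * \<delta> (inv g0 \<otimes> g)) (\<pi> g0 w))"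
      proof (rule sum.mono_neutral_cong_left[OF F(1)])
        show "\<forall>g\<in>F - {g \<in> F. \<kappa> g = C}. scale (c g * \<delta> (inv g0 \<otimes> g)) (\<pi> g0 w) = 0"
          using \<kappa>[OF _ g0G] F(2) g0(2) by (auto simp: \<delta>_def)
        fix g assume "g \<in> {g \<in> F. \<kappa> g = C}"
        then have g: "g \<in> carrier G" "inv g0 \<otimes> g \<in> H" using \<kappa>[OF _ g0G] F(2) g0(2) by auto
        have "g = g0 \<otimes> (inv g0 \<otimes> g)" using g g0G by (simp flip: m_assoc)
        then have "\<pi> g w = \<pi> g0 (\<pi> (inv g0 \<otimes> g) w)" using rep_mult[of g0 "inv g0 \<otimes> g" w] g g0G wV by simp
        also have "\<dots> = scale (\<delta> (inv g0 \<otimes> g)) (\<pi> g0 w)"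
          using wH[OF g(2)] g g0G wV by (simp add: rep_scale \<delta>_def)
        finally show "scale (c g) (\<pi> g w) = scale (c g * \<delta> (inv g0 \<otimes> g)) (\<pi> g0 w)" by simp
      qed auto
      also have "\<dots> = scale (\<Sum>g\<in>F. c g * \<delta> (inv g0 \<otimes> g)) (\<pi> g0 w)" by (simp add: scale_sum_left)
      also have "\<dots> = 0" using ev[of "inv g0"] g0G by simp
      finally show "(\<Sum>g\<in>{g \<in> F. \<kappa> g = C}. scale (c g) (\<pi> g w)) = 0" .
    qed
    finally show "(\<Sum>g\<in>F. scale (c g) (\<pi> g w)) = 0" .
  qed
  then have "weights V H \<chi> \<subseteq> span {e}" by (auto simp: span_singleton)
  moreover have ew: "e \<in> weights V H \<chi>" using e(1) eH by (simp add: weight_space_def)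
  moreover have "subspace (weights V H \<chi>)"
    using weights_subsp[of V H \<chi>] subspace_V HG by (simp add: subsp_def)
  ultimately have "weights V H \<chi> = span {e}" using span_minimal[of "{e}" "weights V H \<chi>"] by auto
  then show ?thesis unfolding finite_weight_rep_def using char ew e0 by blast
qed

end

theorem theorem1p4:
  fixes G :: "('g, 'm) monoid_scheme"
    and scale :: "complex \<Rightarrow> 'v::ab_group_add \<Rightarrow> 'v"
    and V :: "'v set"
    and \<pi> :: "'g \<Rightarrow> 'v \<Rightarrow> 'v"
  assumes "supersolvable_group G"
    and "irreducible_rep G scale V \<pi>"
  shows "monomial_rep G scale V \<pi> \<longleftrightarrow> finite_weight_rep G scale V \<pi>"
proof -
  interpret complex_rep G scale V \<pi> using assms(2) by (simp add: irreducible_rep_def)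
  obtain k N where "cyclic_series G k N" using supersolvable_imp_cyclic_series[OF assms(1)] .
  then interpret cyclic_series G k N .
  interpret series_rep G scale V \<pi> k N ..
  have irr: "irr (carrier G) V" using irreducible_rep_imp_irr assms(2) .
  show ?thesis
  proof
    assume "monomial_rep G scale V \<pi>"
    then show "finite_weight_rep G scale V \<pi>"
      using monomial_rep_imp_finite_weight_rep[OF irr countable_carrier] by blast
  next
    assume "finite_weight_rep G scale V \<pi>"
    then obtain H \<chi> where H: "subgroup_character G H \<chi>" "weights V H \<chi> \<noteq> {0}"
      and "finite_dim (weights V H \<chi>)"
      by (auto simp: finite_weight_rep_def finite_dim_def)
    then have "monomial (carrier G) V"
      using monomial_of_irreducible[OF irr character_is_char[OF H(1)]] by blast
    then show "monomial_rep G scale V \<pi>" by (rule monomial_imp_monomial_rep[OF irr])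
  qed
qed

end
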